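(* Under the setting and assumptions of the context, for all sufficiently small $\varepsilon>0$, the minimum total number of CG iterations $K_{\mathrm{zero}}(\varepsilon)$ needed to achieve $\|u-\widetilde u_{h,L_{\max}}\|_{L^2_\varrho(\Gamma;H_0^1(D))}<\varepsilon$ using zero initial vectors is bounded by $$ \begin{aligned} K_{\mathrm{zero}}(\varepsilon)\le{}& C_1\left[\log\left(\frac{3C_{\mathrm{sc}}}{\varepsilon}\right)\right]^{N}\left[C_2+\frac{1}{\log 2}\log\log\left(\frac{3C_{\mathrm{sc}}}{\varepsilon}\right)\right]^{N-1}\\ &\times\frac{1}{\log\left(\frac{\sqrt{\overline\kappa}+1}{\sqrt{\overline\kappa}-1}\right)}\left\{\log\left(\frac{C_3}{\varepsilon}\right)+C_4+2N\log\log\left[\frac{1}{rN}\log\left(\frac{3C_{\mathrm{sc}}}{\varepsilon}\right)\right]\right\}, \end{aligned} $$ where $\overline\kappa=\sup_{\bm y\in\Gamma}\kappa(\bm y)$, with $\kappa(\bm y)$ the condition number of $\bm A(\bm y)$, and $$ C_1=\left(\frac{e}{\log 2}\right)^{N-1}\left(\frac{2}{rN}\right)^N,\quad C_2=1+\frac{1}{\log 2}\log\left(\frac{1}{rN}\right),\quad C_3=6\sqrt{\frac{\alpha}{\beta}}\,\|u_h\|_{L^\infty(\Gamma;H_0^1(D))},\quad C_4=2N\log\left(\frac{2N}{\log 2}\right). $$ Here $u_h$ and $\bm A(\bm y)$ correspond to the mesh size $h=h(\varepsilon)$.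
   Context: **PDE.** $D\subset\mathbb R^d$ ($d=1,2,3$) is a bounded domain, $\Gamma=[-1,1]^N$, and $\varrho(\bm y)=\prod_{n=1}^N\varrho_n(y_n)\in L^\infty(\Gamma)$ is a probability density on $\Gamma$. For $\bm y\in\Gamma$, $u(\bm y)\in H_0^1(D)$ solves $-\nabla\cdot(a(x,\bm y)\nabla u)=f(x,\bm y)$ in $D$, $u=0$ on $\partial D$, in weak form, with $0<a_{\min}\le a\le a_{\max}<\infty$ and $f$ square integrable. Constants $\alpha,\beta>0$, independent of $\bm y$, satisfy, for all $v,w\in H_0^1(D)$, $|\int_D a(\bm y)\nabla v\cdot\nabla w\,dx|\le\alpha\|v\|_{H_0^1(D)}\|w\|_{H_0^1(D)}$ and $\beta\|v\|^2_{H_0^1(D)}\le\int_D a(\bm y)|\nabla v|^2dx$. **Finite elements.** $W_h(D)\subset H_0^1(D)$ is a finite element space with basis $\varphi_1,\dots,\varphi_{M_h}$ on a uniform mesh of size $h$, $M_h=\mathcal O(1/h^d)$. $u_h(\bm y)=\sum_i c_i(\bm y)\varphi_i$ is the Galerkin solution; its coefficient vector $\bm c(\bm y)$ solves $\bm A(\bm y)\bm c(\bm y)=\bm f(\bm y)$, where $[\bm A(\bm y)]_{i,i'}=\int_D a(\bm y)\nabla\varphi_{i'}\cdot\nabla\varphi_i\,dx$ and $(\bm f(\bm y))_i=\int_D f(\bm y)\varphi_i\,dx$. Write $\|\bm c\|_{\bm A}^2=\bm c^\top\bm A\bm c$. Assume $u\in L^2_\varrho(\Gamma;H_0^1(D)\cap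 H^{s+1}(D))$, $s\in\mathbb N_+$, and let $C_{\mathrm{fem}}$ (independent of $h,\bm y$) be the constant with $\|u-u_h\|_{L^2_\varrho(\Gamma;H_0^1(D))}\le C_{\mathrm{fem}}h^s$. **Sparse grid interpolation.** Let $m(1)=1$, $m(l)=2^{l-1}+1$ for $l>1$; $\vartheta^1=\{0\}$, $\vartheta^l=\{-\cos(\pi(j-1)/(m(l)-1)):1\le j\le m(l)\}$ for $l>1$ (nested Clenshaw–Curtis points). $\mathscr U^{m(l)}$ is one-dimensional Lagrange interpolation at $\vartheta^l$ by polynomials of degree $m(l)-1$, and $\mathscr U^{m(0)}=0$. The isotropic sparse grid operator is $\mathcal I_L=\sum_{\mathbf l\in\mathbb N_+^N,\ \sum_n(l_n-1)\le L}\bigotimes_{n=1}^N(\mathscr U^{m(l_n)}-\mathscr U^{m(l_n-1)})$. It uses the nested points $\mathcal H_L=\bigcup_{\sum_n(l_n-1)=L}\vartheta^{l_1}\times\cdots\times\vartheta^{l_N}=\{\bm y_{L,j}\}_{j=1}^{M_L}$ and can be written $\mathcal I_L[v]=\sum_{j=1}^{M_L}v(\bm y_{L,j})\Psi_{L,j}$ with $\Psi_{L,j'}(\bm y_{L,j})=\delta_{jj'}$. **Regularity.** $u:\Gamma\to H_0^1(D)$ has a complex extension analytic on $\prod_n\Sigma(n;\gamma_n)\subset\mathbb C^N$, $\gamma_n>1$, where $\Sigma(n;\gamma_n)=\{\tfrac12(z+z^{-1}):1\le|z|\le\gamma_n\}$ is the region bounded by the Bernstein ellipse; $u_h$ has the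 same property. For a fixed $0<\delta<1$ let $r=(1-\delta)\min_n\log\gamma_n$, and let $C_{\mathrm{sc}}>0$ (depending on $N,u,\delta$) be the constant such that $\|w-\mathcal I_L[w]\|_{L^\infty(\Gamma;H_0^1(D))}\le C_{\mathrm{sc}}e^{-rN2^{L/N}}$ for $w=u$ and $w=u_h$, $L\in\mathbb N_+$. **Approximation and iteration counts.** At each $\bm y_{L_{\max},j}\in\mathcal H_{L_{\max}}$ the linear system is solved by CG from the zero initial vector until the iterate $\widetilde{\bm c}$ satisfies $\|\bm c-\widetilde{\bm c}\|_{\bm A}\le\tau$; $\widetilde u_{h,L_{\max}}=\sum_j(\sum_i\widetilde c_{L_{\max},j,i}\varphi_i)\Psi_{L_{\max},j}$. The number of CG iterations at a point $\bm y$ with initial vector $\bm c^{(0)}$ is the smallest $k$ for which the CG estimate $\|\bm c-\bm c^{(k)}\|_{\bm A}\le2\left(\frac{\sqrt{\kappa(\bm y)}-1}{\sqrt{\kappa(\bm y)}+1}\right)^k\|\bm c-\bm c^{(0)}\|_{\bm A}$ has right-hand side $\le\tau$. $K_{\mathrm{zero}}$ is the sum of these numbers over all points of $\mathcal H_{L_{\max}}$. $K_{\mathrm{zero}}(\varepsilon)$ is the minimum value of $K_{\mathrm{zero}}$ over choices of $h,L_{\max},\tau$ satisfying $$C_{\mathrm{fem}}h^s\le\tfrac{\varepsilon}{3},\qquad C_{\mathrm{sc}}e^{-rN2^{L_{\max}/N}}\le\tfrac{\varepsilon}{3},\qquad (L_{\max}+2)^{2N}\tfrac{\tau}{\sqrt\beta}\le\tfrac{\varepsilon}{3},$$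 which together suffice for $\|u-\widetilde u_{h,L_{\max}}\|_{L^2_\varrho}\le\varepsilon$. The corresponding choices are $h(\varepsilon)=(\varepsilon/(3C_{\mathrm{fem}}))^{1/s}$, $L_{\max}(\varepsilon)=\frac{N}{\log2}\log\left(\frac1{rN}\log\frac{3C_{\mathrm{sc}}}{\varepsilon}\right)$ and $\tau(\varepsilon)=\sqrt\beta\,\varepsilon/(3(L_{\max}(\varepsilon)+2)^{2N})$. **Convention.** The integer quantities (numbers of iterations, and the level $L_{\max}(\varepsilon)$, which is really the ceiling of the displayed value) are treated as positive real numbers, i.e. integer rounding is ignored. *)

theory Defs
  imports
    "HOL-Analysis.Analysis"
    "HOL-Probability.Probability_Measure"
    "HOL-Probability.Essential_Supremum"
    "HOL-Library.Landau_Symbols"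
    "Jordan_Normal_Form.Gauss_Jordan_Elimination"
begin

no_notation vec_index (infixl "$" 100)
no_notation scalar_prod (infix "\<bullet>" 70)

section \<open>Sobolev spaces on an open set\<close>

text \<open>Elements of the function spaces are represented by functions; only their values on \<open>D\<close>
  matter, and two functions are the same element when the norm of their difference vanishes.\<close>

definition L2_space :: "'a::euclidean_space set \<Rightarrow> ('a \<Rightarrow> real) set" where
  "L2_space D = {v. v \<in> borel_measurable (lebesgue_on D) \<and>
                    integrable (lebesgue_on D) (\<lambda>x. (v x)\<^sup>2)}"

definition L2_norm :: "'a::euclidean_space set \<Rightarrow> ('a \<Rightarrow> real) \<Rightarrow> real" where
  "L2_norm D v = sqrt (LINT x|lebesgue_on D. (v x)\<^sup>2)"

text \<open>A list of basis vectors \<open>[b1, ..., bk]\<close> encodes the partial derivative of order \<open>k\<close> in these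
  directions.\<close>

primrec partials :: "'a::euclidean_space list \<Rightarrow> ('a \<Rightarrow> real) \<Rightarrow> 'a \<Rightarrow> real" where
  "partials [] \<phi> = \<phi>"
| "partials (b # bs) \<phi> = (\<lambda>x. frechet_derivative (partials bs \<phi>) (at x) b)"

definition test_functions :: "'a::euclidean_space set \<Rightarrow> ('a \<Rightarrow> real) set" where
  "test_functions D = {\<phi>. (\<forall>bs\<in>lists Basis. \<forall>x. partials bs \<phi> differentiable (at x)) \<and>
      compact (closure {x. \<phi> x \<noteq> 0}) \<and> closure {x. \<phi> x \<noteq> 0} \<subseteq> D}"

definition has_weak_deriv ::
    "'a::euclidean_space set \<Rightarrow> 'a list \<Rightarrow> ('a \<Rightarrow> real) \<Rightarrow> ('a \<Rightarrow> real) \<Rightarrow> bool" where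
  "has_weak_deriv D bs v g \<longleftrightarrow> g \<in> L2_space D \<and>
     (\<forall>\<phi>\<in>test_functions D. (LINT x|lebesgue_on D. v x * partials bs \<phi> x) =
         (- 1) ^ length bs * (LINT x|lebesgue_on D. g x * \<phi> x))"

definition weak_deriv :: "'a::euclidean_space set \<Rightarrow> 'a list \<Rightarrow> ('a \<Rightarrow> real) \<Rightarrow> 'a \<Rightarrow> real" where
  "weak_deriv D bs v = (SOME g. has_weak_deriv D bs v g)"

definition sobolev :: "'a::euclidean_space set \<Rightarrow> nat \<Rightarrow> ('a \<Rightarrow> real) set" where
  "sobolev D k = {v \<in> L2_space D. \<forall>bs\<in>lists Basis. length bs \<le> k \<longrightarrow> (\<exists>g. has_weak_deriv D bs v g)}"

text \<open>Mixed derivatives are counted with their multiplicity, i.e. the derivative of order \<open>j\<close>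
  contributes the squared \<open>L2\<close> norm of its Frobenius norm.\<close>

definition sobolev_norm :: "'a::euclidean_space set \<Rightarrow> nat \<Rightarrow> ('a \<Rightarrow> real) \<Rightarrow> real" where
  "sobolev_norm D k v =
     sqrt (\<Sum>bs\<in>{bs \<in> lists Basis. length bs \<le> k}. (L2_norm D (weak_deriv D bs v))\<^sup>2)"

definition weak_grad :: "'a::euclidean_space set \<Rightarrow> ('a \<Rightarrow> real) \<Rightarrow> 'a \<Rightarrow> 'a" where
  "weak_grad D v x = (\<Sum>b\<in>Basis. weak_deriv D [b] v x *\<^sub>R b)"

definition H01 :: "'a::euclidean_space set \<Rightarrow> ('a \<Rightarrow> real) set" where
  "H01 D = {v \<in> sobolev D 1. \<exists>\<phi>. (\<forall>k. \<phi> k \<in> test_functions D) \<and>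
      (\<lambda>k. sobolev_norm D 1 (\<lambda>x. v x - \<phi> k x)) \<longlonglongrightarrow> 0}"

definition H01_norm :: "'a::euclidean_space set \<Rightarrow> ('a \<Rightarrow> real) \<Rightarrow> real" where
  "H01_norm D v = sqrt (LINT x|lebesgue_on D. (norm (weak_grad D v x))\<^sup>2)"

definition diffusion_form ::
    "'a::euclidean_space set \<Rightarrow> ('a \<Rightarrow> real) \<Rightarrow> ('a \<Rightarrow> real) \<Rightarrow> ('a \<Rightarrow> real) \<Rightarrow> real" where
  "diffusion_form D k v w = (LINT x|lebesgue_on D. k x * (weak_grad D v x \<bullet> weak_grad D w x))"

definition weak_solution ::
    "'a::euclidean_space set \<Rightarrow> ('a \<Rightarrow> real) \<Rightarrow> ('a \<Rightarrow> real) \<Rightarrow> ('a \<Rightarrow> real) \<Rightarrow> bool" where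
  "weak_solution D k g v \<longleftrightarrow> v \<in> H01 D \<and>
     (\<forall>w\<in>H01 D. diffusion_form D k v w = (LINT x|lebesgue_on D. g x * w x))"


section \<open>Parameter domain and spaces of functions of the parameter\<close>

definition param_box :: "(real ^ 'n::finite) set" where
  "param_box = {y. \<forall>n. y $ n \<in> {-1..1}}"

text \<open>The completion makes functions that differ on a set of vanishing density equally measurable,
  as is appropriate for equivalence classes modulo \<open>\<rho> dy\<close>.\<close>

definition density_measure :: "('n::finite \<Rightarrow> real \<Rightarrow> real) \<Rightarrow> (real ^ 'n) measure" where
  "density_measure \<rho> =
     completion (density (lebesgue_on param_box) (\<lambda>y. ennreal (\<Prod>n\<in>UNIV. \<rho> n (y $ n))))"

text \<open>Square integrable, strongly measurable functions with values in a space \<open>X\<close> with norm \<open>nrm\<close>.\<close>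

definition bochner_L2 ::
    "'y measure \<Rightarrow> ('a \<Rightarrow> real) set \<Rightarrow> (('a \<Rightarrow> real) \<Rightarrow> real) \<Rightarrow> ('y \<Rightarrow> 'a \<Rightarrow> real) set" where
  "bochner_L2 P X nrm = {v. (AE y in P. v y \<in> X) \<and>
     (\<exists>S. (\<forall>k. simple_function P (S k) \<and> S k ` space P \<subseteq> X) \<and>
          (AE y in P. (\<lambda>k. nrm (\<lambda>x. v y x - S k y x)) \<longlonglongrightarrow> 0)) \<and>
     integrable P (\<lambda>y. (nrm (v y))\<^sup>2)}"

definition bochner_L2_norm ::
    "'y measure \<Rightarrow> (('a \<Rightarrow> real) \<Rightarrow> real) \<Rightarrow> ('y \<Rightarrow> 'a \<Rightarrow> real) \<Rightarrow> real" where
  "bochner_L2_norm P nrm v = sqrt (LINT y|P. (nrm (v y))\<^sup>2)"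

definition Linf_H01_norm ::
    "'a::euclidean_space set \<Rightarrow> (real ^ 'n::finite \<Rightarrow> 'a \<Rightarrow> real) \<Rightarrow> ereal" where
  "Linf_H01_norm D w = esssup (lebesgue_on param_box) (\<lambda>y. ereal (H01_norm D (w y)))"


section \<open>Analytic extension in the parameter\<close>

definition H01_complex :: "'a::euclidean_space set \<Rightarrow> ('a \<Rightarrow> complex) set" where
  "H01_complex D = {v. (\<lambda>x. Re (v x)) \<in> H01 D \<and> (\<lambda>x. Im (v x)) \<in> H01 D}"

definition H01_complex_norm :: "'a::euclidean_space set \<Rightarrow> ('a \<Rightarrow> complex) \<Rightarrow> real" where
  "H01_complex_norm D v =
     sqrt ((H01_norm D (\<lambda>x. Re (v x)))\<^sup>2 + (H01_norm D (\<lambda>x. Im (v x)))\<^sup>2)"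

text \<open>Complex Frechet differentiability at every point of an open set of several complex variables,
  with values in the complexification of \<open>H01 D\<close>; \<open>g n\<close> is the complex partial derivative with
  respect to the \<open>n\<close>-th variable.\<close>

definition H01_holomorphic_on ::
    "'a::euclidean_space set \<Rightarrow> (complex ^ 'n::finite) set \<Rightarrow> (complex ^ 'n \<Rightarrow> 'a \<Rightarrow> complex) \<Rightarrow> bool" where
  "H01_holomorphic_on D U w \<longleftrightarrow> open U \<and> (\<forall>z\<in>U. w z \<in> H01_complex D) \<and>
     (\<forall>z\<in>U. \<exists>g. (\<forall>n. g n \<in> H01_complex D) \<and>
        ((\<lambda>\<zeta>. H01_complex_norm D (\<lambda>x. w \<zeta> x - w z x - (\<Sum>n\<in>UNIV. (\<zeta> $ n - z $ n) * g n x))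
               / norm (\<zeta> - z)) \<longlongrightarrow> 0) (at z))"

definition bernstein_region :: "real \<Rightarrow> complex set" where
  "bernstein_region \<gamma> = {(z + inverse z) / 2 | z. 1 \<le> norm z \<and> norm z \<le> \<gamma>}"

text \<open>Analyticity on the (closed) polyellipse means, as usual, analyticity on an open
  neighbourhood of it.\<close>

definition has_analytic_extension ::
    "'a::euclidean_space set \<Rightarrow> ('n::finite \<Rightarrow> real) \<Rightarrow> (real ^ 'n \<Rightarrow> 'a \<Rightarrow> real) \<Rightarrow> bool" where
  "has_analytic_extension D \<gamma> w \<longleftrightarrow>
     (\<exists>U v. {z. \<forall>n. z $ n \<in> bernstein_region (\<gamma> n)} \<subseteq> U \<and> H01_holomorphic_on D U v \<and>
        (\<forall>y\<in>param_box.
           H01_complex_norm D (\<lambda>x. v (\<chi> n. of_real (y $ n)) x - of_real (w y x)) = 0))"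


section \<open>Finite elements\<close>

text \<open>A quasi-uniform partition of \<open>D\<close> into open cells of size proportional to \<open>h\<close>.\<close>

definition uniform_mesh :: "'a::euclidean_space set \<Rightarrow> real \<Rightarrow> real \<Rightarrow> 'a set set \<Rightarrow> bool" where
  "uniform_mesh D \<sigma> h \<T> \<longleftrightarrow> finite \<T> \<and> pairwise disjnt \<T> \<and> \<Union>(closure ` \<T>) = closure D \<and>
     (\<forall>K\<in>\<T>. open K \<and> K \<subseteq> D \<and> diameter K \<le> h \<and> (\<exists>x. ball x (\<sigma> * h) \<subseteq> K))"

definition fe_function :: "nat \<Rightarrow> (nat \<Rightarrow> 'a \<Rightarrow> real) \<Rightarrow> real vec \<Rightarrow> 'a \<Rightarrow> real" where
  "fe_function M \<phi> c x = (\<Sum>i<M. vec_index c i * \<phi> i x)"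

text \<open>The span of \<open>\<phi> 0, ..., \<phi> (M - 1)\<close> is a conforming space of piecewise polynomials, and these
  functions are linearly independent in \<open>H01 D\<close>.\<close>

definition fe_basis ::
    "'a::euclidean_space set \<Rightarrow> 'a set set \<Rightarrow> nat \<Rightarrow> (nat \<Rightarrow> 'a \<Rightarrow> real) \<Rightarrow> bool" where
  "fe_basis D \<T> M \<phi> \<longleftrightarrow> 1 \<le> M \<and>
     (\<forall>i<M. \<phi> i \<in> H01 D \<and>
        (\<forall>K\<in>\<T>. \<exists>p. real_polynomial_function p \<and> (\<forall>x\<in>K. \<phi> i x = p x))) \<and>
     (\<forall>c\<in>carrier_vec M. H01_norm D (fe_function M \<phi> c) = 0 \<longrightarrow> c = 0\<^sub>v M)"

definition stiffness_matrix ::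
    "'a::euclidean_space set \<Rightarrow> ('a \<Rightarrow> real) \<Rightarrow> nat \<Rightarrow> (nat \<Rightarrow> 'a \<Rightarrow> real) \<Rightarrow> real mat" where
  "stiffness_matrix D k M \<phi> = mat M M (\<lambda>(i, i'). diffusion_form D k (\<phi> i') (\<phi> i))"

definition load_vector ::
    "'a::euclidean_space set \<Rightarrow> ('a \<Rightarrow> real) \<Rightarrow> nat \<Rightarrow> (nat \<Rightarrow> 'a \<Rightarrow> real) \<Rightarrow> real vec" where
  "load_vector D g M \<phi> = Matrix.vec M (\<lambda>i. LINT x|lebesgue_on D. g x * \<phi> i x)"


section \<open>Sparse grid interpolation\<close>

definition cc_size :: "nat \<Rightarrow> nat" where
  "cc_size l = (if l = 1 then 1 else 2 ^ (l - 1) + 1)"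

text \<open>There are no points at level \<open>0\<close>, so that the interpolation operator of level \<open>0\<close> is zero.\<close>

definition cc_points :: "nat \<Rightarrow> real set" where
  "cc_points l = (if l = 0 then {} else if l = 1 then {0}
     else (\<lambda>j. - cos (pi * (real j - 1) / (real (cc_size l) - 1))) ` {1..cc_size l})"

text \<open>The interpolant of level \<open>l\<close> of \<open>g\<close> at \<open>t\<close> is the sum of \<open>g p * lagrange l p t\<close> over the
  points \<open>p\<close>.\<close>

definition lagrange :: "nat \<Rightarrow> real \<Rightarrow> real \<Rightarrow> real" where
  "lagrange l p t =
     (if p \<in> cc_points l then \<Prod>q\<in>cc_points l - {p}. (t - q) / (p - q) else 0)"

text \<open>The one-dimensional difference operator of level \<open>l\<close> maps \<open>g\<close> to the sum of
  \<open>g p * (lagrange l p t - lagrange (l - 1) p t)\<close> over the points of both levels; the tensor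
  product of these operators has the product of the coefficients.\<close>

definition sparse_interpolation ::
    "nat \<Rightarrow> (real ^ 'n::finite \<Rightarrow> 'a \<Rightarrow> real) \<Rightarrow> real ^ 'n \<Rightarrow> 'a \<Rightarrow> real" where
  "sparse_interpolation L v y x =
     (\<Sum>l\<in>{l :: 'n \<Rightarrow> nat. (\<forall>n. 1 \<le> l n) \<and> (\<Sum>n\<in>UNIV. l n - 1) \<le> L}.
        \<Sum>p\<in>{p. \<forall>n. p $ n \<in> cc_points (l n) \<union> cc_points (l n - 1)}.
          v p x * (\<Prod>n\<in>UNIV. lagrange (l n) (p $ n) (y $ n) - lagrange (l n - 1) (p $ n) (y $ n)))"

definition sparse_grid :: "nat \<Rightarrow> (real ^ 'n::finite) set" where
  "sparse_grid L = (\<Union>l\<in>{l :: 'n \<Rightarrow> nat. (\<forall>n. 1 \<le> l n) \<and> (\<Sum>n\<in>UNIV. l n - 1) = L}.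
     {y. \<forall>n. y $ n \<in> cc_points (l n)})"


section \<open>Conjugate gradient iteration counts\<close>

definition vec_norm :: "real vec \<Rightarrow> real" where
  "vec_norm v = sqrt (scalar_prod v v)"

definition mat_norm :: "real mat \<Rightarrow> real" where
  "mat_norm A = Sup {vec_norm (A *\<^sub>v v) | v. v \<in> carrier_vec (dim_col A) \<and> vec_norm v \<le> 1}"

definition cond_number :: "real mat \<Rightarrow> real" where
  "cond_number A = mat_norm A * mat_norm (the (mat_inverse A))"

definition energy_norm :: "real mat \<Rightarrow> real vec \<Rightarrow> real" where
  "energy_norm A v = sqrt (scalar_prod v (A *\<^sub>v v))"

text \<open>Smallest \<open>k\<close> for which the bound of the CG error estimate with exact solution \<open>c\<close> and initial
  vector \<open>c0\<close> is at most \<open>\<tau>\<close>, where \<open>k\<close> is a nonnegative real number (no rounding). If the matrix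
  has condition number 1 the value is \<open>0\<close>, the limit as the condition number tends to 1.\<close>

definition cg_iterations :: "real mat \<Rightarrow> real vec \<Rightarrow> real vec \<Rightarrow> real \<Rightarrow> real" where
  "cg_iterations A c c0 \<tau> = Inf {k::real. 0 \<le> k \<and>
     2 * ((sqrt (cond_number A) - 1) / (sqrt (cond_number A) + 1)) powr k
       * energy_norm A (c - c0) \<le> \<tau>}"

definition K_zero_level ::
    "(real ^ 'n::finite \<Rightarrow> real mat) \<Rightarrow> (real ^ 'n \<Rightarrow> real vec) \<Rightarrow> nat \<Rightarrow> real \<Rightarrow> real" where
  "K_zero_level A c L \<tau> =
     (\<Sum>y\<in>sparse_grid L. cg_iterations (A y) (c y) (0\<^sub>v (dim_vec (c y))) \<tau>)"

text \<open>The level is treated as a real number: between consecutive integer levels the total number of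
  iterations is continued continuously by linear interpolation, so no rounding of the level takes
  place.\<close>

definition K_zero ::
    "(real ^ 'n::finite \<Rightarrow> real mat) \<Rightarrow> (real ^ 'n \<Rightarrow> real vec) \<Rightarrow> real \<Rightarrow> real \<Rightarrow> real" where
  "K_zero A c L \<tau> = (1 - frac L) * K_zero_level A c (nat \<lfloor>L\<rfloor>) \<tau>
                     + frac L * K_zero_level A c (nat \<lfloor>L\<rfloor> + 1) \<tau>"

text \<open>The minimum of the total number of iterations over the admissible mesh sizes, levels and
  tolerances. The matrices and coefficient vectors depend on the mesh size, which is restricted to
  the range \<open>0 < h \<le> h0\<close> in which meshes are given; the number of parameters is \<open>CARD('n)\<close>.\<close>

definition K_zero_min ::
    "real \<Rightarrow> nat \<Rightarrow> real \<Rightarrow> real \<Rightarrow> real \<Rightarrow> real \<Rightarrow>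
     (real \<Rightarrow> real ^ 'n::finite \<Rightarrow> real mat) \<Rightarrow> (real \<Rightarrow> real ^ 'n \<Rightarrow> real vec) \<Rightarrow> real \<Rightarrow> real" where
  "K_zero_min h0 s Cfem Csc r \<beta> A c \<epsilon> = Inf {K_zero (A h) (c h) L \<tau> | h L \<tau>.
     0 < h \<and> h \<le> h0 \<and> 0 < L \<and> 0 < \<tau> \<and>
     Cfem * h ^ s \<le> \<epsilon> / 3 \<and>
     Csc * exp (- r * real CARD('n) * 2 powr (L / real CARD('n))) \<le> \<epsilon> / 3 \<and>
     (L + 2) ^ (2 * CARD('n)) * (\<tau> / sqrt \<beta>) \<le> \<epsilon> / 3}"

end

theory Submission
  imports Defs "HOL-Computational_Algebra.Polynomial" "HOL-Complex_Analysis.Conformal_Mappings"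
    "Jordan_Normal_Form.Determinant"
begin

text \<open>
  The number of iterations is the number of sparse grid points times the number of iterations at one
  point. The mesh size \<open>h(\<epsilon>)\<close>, the level \<open>L(\<epsilon>)\<close> and the tolerance \<open>\<tau>(\<epsilon>)\<close> satisfy the three
  constraints with equality, so that the minimum is at most the count for this choice.

  The grid points. A sparse grid of level \<open>L\<close> in \<open>N\<close> dimensions is a union of tensor grids, one for
  each level vector, and each has at most \<open>(3 / 2)\<^sup>N * 2\<^sup>L\<close> points. Stars and bars counts the level
  vectors, and \<open>(m + 1)\<^sup>m \<le> e\<^sup>m * m!\<close> bounds the binomial coefficient. The slack
  between \<open>(3 / 2)\<^sup>N\<close> and \<open>2\<^sup>N\<close> pays for the linear interpolation between integer levels
  (\<open>interpolated_grid_size_le\<close>). With \<open>X = log (3 Csc / \<epsilon>) / (r N)\<close> the chosen level satisfies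
  \<open>2\<^sup>L = X\<^sup>N\<close>, which yields the powers of logarithms in the bound.

  The iterations at one point. Boundedness of the diffusion form gives the initial energy error
  \<open>E \<le> sqrt \<alpha> * |u_h|\<close>, where the norm is the supremum over the parameter box. The estimate falls below
  \<open>\<tau>\<close> after \<open>log (2 E / \<tau>)\<close> divided by the logarithmic convergence rate
  (\<open>cg_iterations_le\<close>), the rate deteriorates with the condition number, and the condition numbers are
  bounded uniformly in the parameter (\<open>galerkin_matrices_conditioned\<close>). Inserting \<open>\<tau>(\<epsilon>)\<close> and
  \<open>L + 2 \<le> 2 L\<close> gives the expression in braces (\<open>tolerance_choice\<close>).

  The last step needs the braces to be nonnegative, i.e. \<open>u_h\<close> must not be much smaller than \<open>\<epsilon>\<close> without
  being zero. There are two cases. If the zeros of \<open>u\<close> in the parameter box form a null set, convergence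
  of \<open>u_h\<close> to \<open>u\<close> in mean square keeps the supremum of its norm away from zero
  (\<open>discrete_solution_bounded_below\<close>). Otherwise \<open>u\<close> vanishes on the whole box by analyticity
  (\<open>analytic_identity\<close>), although the density may live on a small part of it; then the load vectors
  and all counts vanish.

  All this uses that energy norm and diffusion form behave like a norm and a bilinear form. Weak derivatives
  are chosen representatives, so linearity holds almost everywhere and rests on their uniqueness, the
  fundamental lemma of the calculus of variations (\<open>weakly_zero_imp_AE_zero\<close>).
\<close>

section \<open>Smooth cut-off functions\<close>

text \<open>For \<open>p = 1\<close> this is the standard flat function \<open>exp (- 1 / t)\<close>, extended by zero; the polynomial
  factor makes the family closed under differentiation.\<close>

definition flat_step :: "real poly \<Rightarrow> real \<Rightarrow> real" where
  "flat_step p t = (if t > 0 then poly p (1 / t) * exp (- (1 / t)) else 0)"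

lemma poly_times_exp_minus_tendsto_0:
  fixes p :: "real poly"
  shows "((\<lambda>x. poly p x * exp (- x)) \<longlongrightarrow> 0) at_top"
proof -
  have "((\<lambda>x. \<Sum>i\<le>degree p. coeff p i * (x ^ i / exp x)) \<longlongrightarrow> (\<Sum>i\<le>degree p. coeff p i * 0)) at_top"
    by (intro tendsto_sum tendsto_mult tendsto_const tendsto_power_div_exp_0)
  moreover have "(\<lambda>x. \<Sum>i\<le>degree p. coeff p i * (x ^ i / exp x)) = (\<lambda>x. poly p x * exp (- x))"
    by (auto simp: poly_altdef sum_distrib_right exp_minus divide_inverse mult.assoc)
  ultimately show ?thesis by simp
qed

text \<open>Away from \<open>0\<close> this is the product rule in the variable \<open>1 / t\<close>; at \<open>0\<close> the difference quotient is
  again a polynomial in \<open>1 / t\<close> times \<open>exp (- 1 / t)\<close>, which tends to \<open>0\<close>.\<close>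

lemma flat_step_has_derivative:
  "(flat_step p has_real_derivative flat_step (monom 1 2 * (p - pderiv p)) t) (at t)"
proof -
  consider "t > 0" | "t < 0" | "t = 0" by linarith
  then show ?thesis
  proof cases
    case 1
    have "((\<lambda>t. poly p (1 / t) * exp (- (1 / t))) has_real_derivative
        flat_step (monom 1 2 * (p - pderiv p)) t) (at t)"
      using 1 unfolding flat_step_def
      by (auto intro!: derivative_eq_intros simp: poly_monom field_simps power2_eq_square)
    then show ?thesis
      by (rule DERIV_cong_ev[THEN iffD1, rotated -1])
         (use 1 in \<open>auto simp: flat_step_def eventually_nhds intro!: exI[of _ "{0<..}"]\<close>)
  next
    case 2
    have "((\<lambda>t. 0) has_real_derivative flat_step (monom 1 2 * (p - pderiv p)) t) (at t)"
      using 2 by (auto simp: flat_step_def)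
    then show ?thesis
      by (rule DERIV_cong_ev[THEN iffD1, rotated -1])
         (use 2 in \<open>auto simp: flat_step_def eventually_nhds intro!: exI[of _ "{..<0}"]\<close>)
  next
    case 3
    have "((\<lambda>t. flat_step p t / t) \<longlongrightarrow> 0) (at_right 0)"
    proof -
      have "((\<lambda>x. poly (pCons 0 p) x * exp (- x)) \<longlongrightarrow> 0) at_top"
        by (rule poly_times_exp_minus_tendsto_0)
      from filterlim_compose[OF this filterlim_inverse_at_top_right]
      have "((\<lambda>t. poly (pCons 0 p) (inverse t) * exp (- inverse t)) \<longlongrightarrow> 0) (at_right 0)" .
      then show ?thesis
        by (rule Lim_transform_eventually)
           (auto simp: eventually_at_right_field flat_step_def field_simps intro!: exI[of _ 1])
    qed
    moreover have "((\<lambda>t. flat_step p t / t) \<longlongrightarrow> 0) (at_left 0)"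
      by (rule tendsto_eventually) (auto simp: eventually_at_left_field flat_step_def intro!: exI[of _ "-1"])
    ultimately have "((\<lambda>t. flat_step p t / t) \<longlongrightarrow> 0) (at 0)"
      by (simp add: filterlim_split_at)
    then show ?thesis
      using 3 by (simp add: DERIV_def flat_step_def)
  qed
qed

text \<open>This algebra is stable under partial differentiation, so that its members have partial derivatives
  of every order without any Leibniz formula for higher derivatives.\<close>

inductive_set cutoff_algebra :: "('a::euclidean_space \<Rightarrow> real) set" where
  ridge: "(\<lambda>x. flat_step p (x \<bullet> v + c)) \<in> cutoff_algebra"
| const: "(\<lambda>x. k) \<in> cutoff_algebra"
| add: "f \<in> cutoff_algebra \<Longrightarrow> g \<in> cutoff_algebra \<Longrightarrow> (\<lambda>x. f x + g x) \<in> cutoff_algebra"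
| mult: "f \<in> cutoff_algebra \<Longrightarrow> g \<in> cutoff_algebra \<Longrightarrow> (\<lambda>x. f x * g x) \<in> cutoff_algebra"

lemma cutoff_algebra_has_derivative:
  assumes "f \<in> cutoff_algebra"
  shows "\<exists>f'. (\<forall>x. (f has_derivative f' x) (at x)) \<and> (\<forall>b. (\<lambda>x. f' x b) \<in> cutoff_algebra)"
  using assms
proof induction
  case (ridge p v c)
  define q where "q = monom 1 2 * (p - pderiv p)"
  have "((\<lambda>x. flat_step p (x \<bullet> v + c)) has_derivative
      (\<lambda>h. flat_step q (x \<bullet> v + c) * (h \<bullet> v))) (at x)" for x
  proof -
    have 1: "((\<lambda>x. x \<bullet> v + c) has_derivative (\<lambda>h. h \<bullet> v)) (at x)"
      by (auto intro!: derivative_eq_intros)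
    have 2: "(flat_step p has_derivative (*) (flat_step q (x \<bullet> v + c))) (at (x \<bullet> v + c))"
      using flat_step_has_derivative[of p "x \<bullet> v + c"] by (simp add: has_field_derivative_def q_def)
    show ?thesis
      using has_derivative_compose[OF 1 2] by (simp add: o_def)
  qed
  moreover have "(\<lambda>x. flat_step q (x \<bullet> v + c) * (b \<bullet> v)) \<in> cutoff_algebra" for b
    by (intro cutoff_algebra.intros)
  ultimately show ?case
    by (intro exI[of _ "\<lambda>x h. flat_step q (x \<bullet> v + c) * (h \<bullet> v)"]) auto
next
  case (const k)
  show ?case
    by (intro exI[of _ "\<lambda>x h. 0"]) (auto intro: cutoff_algebra.intros)
next
  case (add f g)
  then obtain f' g' where "\<And>x. (f has_derivative f' x) (at x)" "\<And>b. (\<lambda>x. f' x b) \<in> cutoff_algebra"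
    "\<And>x. (g has_derivative g' x) (at x)" "\<And>b. (\<lambda>x. g' x b) \<in> cutoff_algebra" by metis
  then show ?case
    by (intro exI[of _ "\<lambda>x h. f' x h + g' x h"]) (auto intro!: cutoff_algebra.intros derivative_intros)
next
  case (mult f g)
  then obtain f' g' where "\<And>x. (f has_derivative f' x) (at x)" "\<And>b. (\<lambda>x. f' x b) \<in> cutoff_algebra"
    "\<And>x. (g has_derivative g' x) (at x)" "\<And>b. (\<lambda>x. g' x b) \<in> cutoff_algebra" by metis
  with mult.hyps show ?case
    by (intro exI[of _ "\<lambda>x h. f x * g' x h + f' x h * g x"])
       (auto intro!: cutoff_algebra.intros derivative_intros)
qed

lemma partials_cutoff_algebra:
  assumes "f \<in> cutoff_algebra"
  shows "partials bs f \<in> cutoff_algebra"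
proof (induction bs)
  case (Cons b bs)
  then obtain f' where f': "\<And>x. (partials bs f has_derivative f' x) (at x)"
    "\<And>b. (\<lambda>x. f' x b) \<in> cutoff_algebra"
    using cutoff_algebra_has_derivative by metis
  then have "frechet_derivative (partials bs f) (at x) = f' x" for x
    using frechet_derivative_at by metis
  then show ?case using f'(2) by simp
qed (use assms in simp)

lemma cutoff_algebra_smooth:
  assumes "f \<in> cutoff_algebra"
  shows "partials bs f differentiable (at x)"
  using cutoff_algebra_has_derivative[OF partials_cutoff_algebra[OF assms, of bs]]
  unfolding differentiable_def by blast

lemma cutoff_algebra_prod:
  assumes "finite I" "\<And>i. i \<in> I \<Longrightarrow> f i \<in> cutoff_algebra"
  shows "(\<lambda>x. \<Prod>i\<in>I. f i x) \<in> cutoff_algebra"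
  using assms by (induction I) (auto intro: cutoff_algebra.intros)

text \<open>As \<open>k\<close> grows, these smooth functions with values in \<open>[0, 1]\<close>, supported in the box, converge pointwise
  to its indicator function.\<close>

definition box_cutoff :: "real \<Rightarrow> 'a::euclidean_space \<Rightarrow> 'a \<Rightarrow> 'a \<Rightarrow> real" where
  "box_cutoff k p q x =
     (\<Prod>b\<in>Basis. flat_step 1 (k * (x \<bullet> b - p \<bullet> b)) * flat_step 1 (k * (q \<bullet> b - x \<bullet> b)))"

lemma box_cutoff_nonzero_iff:
  assumes "0 < k"
  shows "box_cutoff k p q x \<noteq> 0 \<longleftrightarrow> x \<in> box p q"
  using assms by (auto simp: box_cutoff_def flat_step_def mem_box zero_less_mult_iff)

lemma flat_step_1_bounds: "0 \<le> flat_step 1 t" "flat_step 1 t \<le> 1"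
  by (auto simp: flat_step_def)

lemma box_cutoff_bounds: "0 \<le> box_cutoff k p q x" "box_cutoff k p q x \<le> 1"
  unfolding box_cutoff_def
  by (auto intro!: prod_nonneg prod_le_1 mult_nonneg_nonneg mult_le_one flat_step_1_bounds)

lemma box_cutoff_in_algebra: "box_cutoff k p q \<in> cutoff_algebra"
proof -
  have "(\<lambda>x. \<Prod>b\<in>Basis. flat_step 1 (x \<bullet> (k *\<^sub>R b) + (- k * (p \<bullet> b))) *
      flat_step 1 (x \<bullet> (- k *\<^sub>R b) + k * (q \<bullet> b))) \<in> cutoff_algebra"
    by (intro cutoff_algebra_prod cutoff_algebra.intros finite_Basis)
  then show ?thesis
    by (simp add: box_cutoff_def[abs_def] algebra_simps)
qed

lemma box_cutoff_test_function:
  assumes "0 < k" "cbox p q \<subseteq> D"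
  shows "box_cutoff k p q \<in> test_functions D"
proof -
  have "closure {x. box_cutoff k p q x \<noteq> 0} \<subseteq> cbox p q"
    using assms(1) by (intro closure_minimal) (auto simp: box_cutoff_nonzero_iff intro: box_subset_cbox[THEN subsetD])
  moreover from this have "compact (closure {x. box_cutoff k p q x \<noteq> 0})"
    by (metis bounded_cbox bounded_subset closed_closure compact_eq_bounded_closed)
  ultimately show ?thesis
    using assms(2) by (auto simp: test_functions_def intro: cutoff_algebra_smooth[OF box_cutoff_in_algebra])
qed

lemma flat_step_1_scale_tendsto:
  "(\<lambda>k. flat_step 1 (real (Suc k) * t)) \<longlonglongrightarrow> (if t > 0 then 1 else 0)"
proof (cases "t > 0")
  case True
  have "(\<lambda>k. exp (- (inverse (real (Suc k)) * (1 / t)))) \<longlonglongrightarrow> exp (- (0 * (1 / t)))"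
    by (intro tendsto_intros LIMSEQ_inverse_real_of_nat)
  moreover have "flat_step 1 (real (Suc k) * t) = exp (- (inverse (real (Suc k)) * (1 / t)))" for k
  proof -
    have "0 < real (Suc k) * t" using True by simp
    then show ?thesis by (simp add: flat_step_def divide_inverse mult.commute)
  qed
  ultimately show ?thesis using True by simp
next
  case False
  then have "flat_step 1 (real (Suc k) * t) = 0" for k
    by (auto simp: flat_step_def zero_less_mult_iff)
  with False show ?thesis by simp
qed

lemma box_cutoff_tendsto_indicator:
  "(\<lambda>k. box_cutoff (real (Suc k)) p q x) \<longlonglongrightarrow> indicator (box p q) x"
proof -
  have "(\<lambda>k. box_cutoff (real (Suc k)) p q x) \<longlonglongrightarrow>
     (\<Prod>b\<in>Basis. (if x \<bullet> b - p \<bullet> b > 0 then 1 else 0) * (if q \<bullet> b - x \<bullet> b > 0 then 1 else 0))"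
    unfolding box_cutoff_def by (intro tendsto_prod tendsto_mult flat_step_1_scale_tendsto)
  also have "(\<Prod>b\<in>Basis. (if x \<bullet> b - p \<bullet> b > 0 then 1 else 0) * (if q \<bullet> b - x \<bullet> b > 0 then 1 else 0))
     = (\<Prod>b\<in>Basis. if p \<bullet> b < x \<bullet> b \<and> x \<bullet> b < q \<bullet> b then 1 else (0::real))"
    by (intro prod.cong) auto
  also have "\<dots> = indicator (box p q) x"
    by (auto simp: indicator_def mem_box)
  finally show ?thesis .
qed

lemma continuous_on_partials:
  assumes "\<phi> \<in> test_functions D" "bs \<in> lists Basis"
  shows "continuous_on S (partials bs \<phi>)"
proof -
  have "\<forall>x. partials bs \<phi> differentiable (at x)"
    using assms by (auto simp: test_functions_def)
  then show ?thesis
    by (intro continuous_at_imp_continuous_on) (auto intro: differentiable_imp_continuous_within)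
qed

text \<open>The fundamental lemma of the calculus of variations. Testing with the cut-off functions of a box and
  passing to the limit shows that the integral of \<open>g\<close> over every box inside \<open>D\<close> vanishes; by Lebesgue
  differentiation \<open>g\<close> is almost everywhere the limit of its averages over small cubes, all of which
  are zero.\<close>

lemma weakly_zero_imp_AE_zero:
  fixes D :: "'a::euclidean_space set" and g :: "'a \<Rightarrow> real"
  assumes D: "open D" and g: "integrable (lebesgue_on D) g"
    and zero: "\<And>\<phi>. \<phi> \<in> test_functions D \<Longrightarrow> (LINT x|lebesgue_on D. g x * \<phi> x) = 0"
  shows "AE x in lebesgue_on D. g x = 0"
proof -
  have Dm: "D \<in> sets lebesgue" using D by simp
  have int_box: "integral (cbox p q) g = 0" if pq: "cbox p q \<subseteq> D" for p q
  proof -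
    have "(\<lambda>k. LINT x|lebesgue_on D. g x * box_cutoff (real (Suc k)) p q x)
       \<longlonglongrightarrow> (LINT x|lebesgue_on D. g x * indicator (box p q) x)"
    proof (rule integral_dominated_convergence[where w = "\<lambda>x. \<bar>g x\<bar>"])
      show "(\<lambda>x. g x * indicator (box p q) x) \<in> borel_measurable (lebesgue_on D)"
        using g by (intro borel_measurable_times borel_measurable_indicator')
           (auto simp: borel_measurable_integrable sets_restrict_space_iff Dm Int_def[symmetric])
      have "box_cutoff (real (Suc k)) p q \<in> borel_measurable (lebesgue_on D)" for k
        using continuous_on_partials[OF box_cutoff_test_function[of "real (Suc k)" p q D], of "[]"] pq
        by (intro continuous_imp_measurable_on_sets_lebesgue Dm) auto
      then show "(\<lambda>x. g x * box_cutoff (real (Suc k)) p q x) \<in> borel_measurable (lebesgue_on D)" for k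
        using g by (intro borel_measurable_times) (auto simp: borel_measurable_integrable)
      show "AE x in lebesgue_on D. (\<lambda>k. g x * box_cutoff (real (Suc k)) p q x)
          \<longlonglongrightarrow> g x * indicator (box p q) x"
        by (intro AE_I2 tendsto_intros box_cutoff_tendsto_indicator)
      show "AE x in lebesgue_on D. norm (g x * box_cutoff (real (Suc k)) p q x) \<le> \<bar>g x\<bar>" for k
        using box_cutoff_bounds[of "real (Suc k)" p q] by (intro AE_I2) (auto simp: abs_mult intro: mult_left_le)
    qed (use g in auto)
    then have "(LINT x|lebesgue_on D. g x * indicator (box p q) x) = 0"
      using zero[OF box_cutoff_test_function[OF _ pq]] by (simp add: LIMSEQ_const_iff)
    then have *: "(LINT x:box p q|lebesgue_on D. g x) = 0"
      by (simp add: set_lebesgue_integral_def mult.commute)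
    have sub: "box p q \<subseteq> D" using pq box_subset_cbox by blast
    have "(LINT x|lebesgue_on (box p q). g x) = 0"
    proof -
      have "(LINT x:D|lebesgue. indicator (box p q) x *\<^sub>R g x) = 0"
        using * Dm by (simp add: set_lebesgue_integral_def integral_restrict_space)
      moreover have "(\<lambda>x. indicator D x *\<^sub>R indicator (box p q) x *\<^sub>R g x) = (\<lambda>x. indicator (box p q) x *\<^sub>R g x)"
        by (intro ext) (use sub in \<open>auto split: split_indicator\<close>)
      ultimately have "(LINT x|lebesgue. indicator (box p q) x *\<^sub>R g x) = 0"
        by (simp only: set_lebesgue_integral_def)
      then show ?thesis
        by (simp add: integral_restrict_space)
    qed
    moreover have "integrable (lebesgue_on (box p q)) g"
    proof -
      have "set_integrable lebesgue D g"
        using g Dm by (simp add: set_integrable_def integrable_restrict_space)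
      then have "set_integrable lebesgue (box p q) g"
        by (rule set_integrable_subset) (use sub in auto)
      then show ?thesis
        by (simp add: set_integrable_def integrable_restrict_space)
    qed
    ultimately show ?thesis
      by (metis integral_open_interval lebesgue_integral_eq_integral lmeasurable_box fmeasurableD)
  qed
  let ?g = "\<lambda>x. if x \<in> D then g x else 0"
  have "integrable lebesgue (\<lambda>x. indicator D x *\<^sub>R g x)"
    using g Dm by (simp add: integrable_restrict_space)
  moreover have "(\<lambda>x. indicator D x *\<^sub>R g x) = ?g"
    by (intro ext) (auto split: split_indicator)
  ultimately have abs: "?g absolutely_integrable_on UNIV"
    by (simp add: set_integrable_def)
  then have "?g integrable_on cbox a b" for a b
    using integrable_on_subcbox set_lebesgue_integral_eq_integral(1) by blast
  then obtain N where N: "negligible N"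
    "\<And>x e. x \<notin> N \<Longrightarrow> 0 < e \<Longrightarrow> \<exists>d>0. \<forall>h. 0 < h \<and> h < d \<longrightarrow>
        norm (integral (cbox x (x + h *\<^sub>R One)) ?g /\<^sub>R h ^ DIM('a) - ?g x) < e"
    using integrable_ccontinuous_explicit[of ?g] by blast
  have "g x = 0" if x: "x \<in> D" "x \<notin> N" for x
  proof (rule ccontr)
    assume "g x \<noteq> 0"
    with N(2)[OF x(2), of "\<bar>g x\<bar>"] obtain d where d: "d > 0"
      "\<And>h. 0 < h \<Longrightarrow> h < d \<Longrightarrow>
        norm (integral (cbox x (x + h *\<^sub>R One)) ?g /\<^sub>R h ^ DIM('a) - ?g x) < \<bar>g x\<bar>" by auto
    obtain e where e: "e > 0" "cball x e \<subseteq> D"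
      using D x(1) open_contains_cball by blast
    \<comment> \<open>The cube of side \<open>h\<close> has diameter at most \<open>DIM('a) * h\<close>, which must not exceed \<open>e\<close>.\<close>
    define h where "h = min (d / 2) (e / DIM('a))"
    have h: "0 < h" "h < d" "h * DIM('a) \<le> e"
      using d(1) e(1) by (auto simp: h_def min_def field_simps)
    have "cbox x (x + h *\<^sub>R One) \<subseteq> cball x e"
    proof
      fix y assume y: "y \<in> cbox x (x + h *\<^sub>R One)"
      have "norm (y - x) \<le> (\<Sum>b\<in>Basis. \<bar>(y - x) \<bullet> b\<bar>)" by (rule norm_le_l1)
      also have "\<dots> \<le> (\<Sum>b\<in>(Basis::'a set). h)"
        using y by (intro sum_mono) (auto simp: mem_box inner_diff_left inner_add_left)
      also have "\<dots> \<le> e" using h(3) by (simp add: mult.commute)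
      finally show "y \<in> cball x e" by (simp add: dist_norm norm_minus_commute)
    qed
    with e(2) have sub: "cbox x (x + h *\<^sub>R One) \<subseteq> D" by blast
    then have "integral (cbox x (x + h *\<^sub>R One)) ?g = integral (cbox x (x + h *\<^sub>R One)) g"
      by (intro integral_cong) auto
    with int_box[OF sub] d(2)[OF h(1,2)] x(1) show False by simp
  qed
  then have "AE x in lebesgue. x \<in> D \<longrightarrow> g x = 0"
    using N(1) by (intro AE_I'[of N]) (auto simp: negligible_iff_null_sets)
  then show ?thesis
    using Dm by (simp add: AE_restrict_space_iff)
qed

section \<open>Integration by parts\<close>

lemma integral_translation_lborel:
  fixes F :: "'a::euclidean_space \<Rightarrow> real"
  assumes [measurable]: "F \<in> borel_measurable borel"
  shows "(LINT x|lborel. F (c + x)) = (LINT x|lborel. F x)"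
proof -
  have "(LINT x|lborel. F x) = (LINT x|distr lborel borel ((+) c). F x)"
    by (simp add: lborel_distr_plus)
  also have "\<dots> = (LINT x|lborel. F (c + x))"
    by (subst integral_distr) auto
  finally show ?thesis by simp
qed

text \<open>The difference quotients of \<open>F\<close> in direction \<open>b\<close> have integral zero because Lebesgue measure is
  translation invariant. By the mean value theorem they are bounded on a fixed ball and vanish outside
  it, so the integral passes to their limit, the directional derivative.\<close>

lemma integral_directional_derivative_eq_0:
  fixes F :: "'a::euclidean_space \<Rightarrow> real"
  assumes F: "\<And>x. (F has_derivative F' x) (at x)"
    and cont: "continuous_on UNIV (\<lambda>x. F' x b)"
    and supp: "bounded {x. F x \<noteq> 0}"
  shows "integrable lborel (\<lambda>x. F' x b) \<and> (LINT x|lborel. F' x b) = 0"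
proof -
  have contF: "continuous_on UNIV F"
    using F by (meson continuous_at_imp_continuous_on has_derivative_continuous)
  have [measurable]: "F \<in> borel_measurable borel" "(\<lambda>x. F' x b) \<in> borel_measurable borel"
    using contF cont by (auto intro: borel_measurable_continuous_onI)
  have line: "((\<lambda>s. F (x + s *\<^sub>R b)) has_real_derivative F' (x + s *\<^sub>R b) b) (at s)" for x s
  proof -
    have "((\<lambda>s. x + s *\<^sub>R b) has_derivative (\<lambda>r. r *\<^sub>R b)) (at s)"
      by (auto intro!: derivative_eq_intros)
    from has_derivative_compose[OF this F]
    have "((\<lambda>s. F (x + s *\<^sub>R b)) has_derivative (\<lambda>r. F' (x + s *\<^sub>R b) (r *\<^sub>R b))) (at s)" .
    moreover have "(\<lambda>r. F' (x + s *\<^sub>R b) (r *\<^sub>R b)) = (*) (F' (x + s *\<^sub>R b) b)"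
      using linear_cmul[OF has_derivative_linear[OF F[of "x + s *\<^sub>R b"]]] by (auto simp: mult.commute)
    ultimately show ?thesis
      by (simp add: has_field_derivative_def)
  qed
  obtain R where R: "\<And>x. F x \<noteq> 0 \<Longrightarrow> norm x \<le> R"
    using supp by (auto simp: bounded_iff)
  define S where "S = cball (0::'a) (R + norm b)"
  obtain K where K: "\<And>x. x \<in> S \<Longrightarrow> \<bar>F' x b\<bar> \<le> K"
  proof -
    have "compact ((\<lambda>x. F' x b) ` S)"
      unfolding S_def by (intro compact_continuous_image continuous_on_subset[OF cont]) auto
    then show ?thesis using that
      by (meson compact_imp_bounded bounded_real imageI)
  qed
  define t where "t k = inverse (real (Suc k))" for k
  have t: "0 < t k" "t k \<le> 1" "t \<longlonglongrightarrow> 0" for k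
    unfolding t_def using LIMSEQ_inverse_real_of_nat by (simp_all add: inverse_le_1_iff del: of_nat_Suc)
  define Q where "Q k x = (F (t k *\<^sub>R b + x) - F x) / t k" for k x
  have Q_lim: "(\<lambda>k. Q k x) \<longlonglongrightarrow> F' x b" for x
  proof -
    have "((\<lambda>s. F (x + s *\<^sub>R b)) has_real_derivative F' x b) (at 0)"
      using line[of x 0] by simp
    then have "((\<lambda>s. (F (x + s *\<^sub>R b) - F x) / s) \<longlongrightarrow> F' x b) (at 0)"
      by (simp add: DERIV_def)
    moreover have "filterlim t (at 0) sequentially"
      unfolding filterlim_at using t(1,3) by (auto intro!: always_eventually simp: less_imp_neq[symmetric])
    ultimately have "(\<lambda>k. (F (x + t k *\<^sub>R b) - F x) / t k) \<longlonglongrightarrow> F' x b"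
      by (rule filterlim_compose)
    then show ?thesis
      by (simp add: Q_def add.commute)
  qed
  have Q_bound: "\<bar>Q k x\<bar> \<le> K * indicator S x" for k x
  proof (cases "x \<in> S")
    case False
    then have "norm x > R + norm b" by (auto simp: S_def)
    moreover have "norm x \<le> norm (t k *\<^sub>R b + x) + norm (t k *\<^sub>R b)"
      using norm_triangle_ineq4[of "t k *\<^sub>R b + x" "t k *\<^sub>R b"] by simp
    moreover have "norm (t k *\<^sub>R b) \<le> norm b"
      using t(1,2)[of k] by (simp add: mult_left_le_one_le)
    ultimately have "\<not> norm x \<le> R" "\<not> norm (t k *\<^sub>R b + x) \<le> R"
      using norm_ge_zero[of b] by linarith+
    then have "F x = 0" "F (t k *\<^sub>R b + x) = 0"
      using R by blast+
    with False show ?thesis by (simp add: Q_def)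
  next
    case True
    show ?thesis
    proof (cases "F x = 0 \<and> F (x + t k *\<^sub>R b) = 0")
      case True
      have "0 \<le> K" using K[OF \<open>x \<in> S\<close>] by simp
      with True show ?thesis by (simp add: Q_def add.commute)
    next
      case False
      have near: "norm (x + s *\<^sub>R b) \<le> R + norm b" if s: "0 \<le> s" "s \<le> t k" for s
      proof (cases "F x = 0")
        case True
        with False have "norm (x + t k *\<^sub>R b) \<le> R" using R by auto
        moreover have "norm (x + s *\<^sub>R b) \<le> norm (x + t k *\<^sub>R b) + norm ((t k - s) *\<^sub>R b)"
        proof -
          have "x + s *\<^sub>R b = (x + t k *\<^sub>R b) - (t k - s) *\<^sub>R b" by (simp add: algebra_simps)
          then show ?thesis using norm_triangle_ineq4 by metis
        qed
        moreover have "norm ((t k - s) *\<^sub>R b) \<le> norm b"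
          using s t(1,2)[of k] by (simp add: mult_left_le_one_le)
        ultimately show ?thesis by linarith
      next
        case False
        then have "norm x \<le> R" using R by auto
        moreover have "norm (s *\<^sub>R b) \<le> norm b"
          using s t(1,2)[of k] by (simp add: mult_left_le_one_le)
        ultimately show ?thesis
          using norm_triangle_ineq[of x "s *\<^sub>R b"] by linarith
      qed
      obtain s where s: "0 < s" "s < t k"
        "F (x + t k *\<^sub>R b) - F (x + 0 *\<^sub>R b) = (t k - 0) * F' (x + s *\<^sub>R b) b"
        using MVT2[OF t(1)[of k], of "\<lambda>s. F (x + s *\<^sub>R b)" "\<lambda>s. F' (x + s *\<^sub>R b) b"] line by blast
      then have "Q k x = F' (x + s *\<^sub>R b) b"
        using t(1)[of k] by (simp add: Q_def add.commute)
      moreover have "x + s *\<^sub>R b \<in> S"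
        using near[of s] s by (simp add: S_def)
      ultimately show ?thesis using K \<open>x \<in> S\<close> by simp
    qed
  qed
  have Fint: "integrable lborel F"
  proof -
    have "integrable lborel (\<lambda>x. indicator S x *\<^sub>R F x)"
      unfolding S_def by (intro borel_integrable_compact continuous_on_subset[OF contF]) auto
    moreover have "(\<lambda>x. indicator S x *\<^sub>R F x) = F"
    proof
      fix x
      have "x \<in> S" if "F x \<noteq> 0"
        using R[OF that] norm_ge_zero[of b] unfolding S_def mem_cball_0 by linarith
      then show "indicator S x *\<^sub>R F x = F x" by (cases "F x = 0") auto
    qed
    ultimately show ?thesis by simp
  qed
  have Q_int: "(LINT x|lborel. Q k x) = 0" for k
  proof -
    have "integrable lborel (\<lambda>x. F (t k *\<^sub>R b + x))"
    proof -
      have "integrable (distr lborel borel ((+) (t k *\<^sub>R b))) F"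
        using Fint by (simp add: lborel_distr_plus)
      then show ?thesis by (subst (asm) integrable_distr_eq) auto
    qed
    then show ?thesis
      unfolding Q_def using Fint integral_translation_lborel[of F "t k *\<^sub>R b"] by simp
  qed
  have w: "integrable lborel (\<lambda>x. K * indicator S x)"
    unfolding S_def by (intro integrable_mult_right integrable_real_indicator) (simp_all only: emeasure_lborel_cball_finite sets_lborel borel_closed closed_cball)
  have Qm: "Q k \<in> borel_measurable lborel" for k
    unfolding Q_def by measurable
  have m: "(\<lambda>x. F' x b) \<in> borel_measurable lborel" by simp
  have lim: "AE x in lborel. (\<lambda>k. Q k x) \<longlonglongrightarrow> F' x b"
    using Q_lim by simp
  have bnd: "AE x in lborel. norm (Q k x) \<le> K * indicator S x" for k
    using Q_bound by simp
  have "integrable lborel (\<lambda>x. F' x b)"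
    by (rule integrable_dominated_convergence[OF m Qm w lim bnd])
  moreover have "(\<lambda>k. LINT x|lborel. Q k x) \<longlonglongrightarrow> (LINT x|lborel. F' x b)"
    by (rule integral_dominated_convergence[OF m Qm w lim bnd])
  ultimately show ?thesis using Q_int by (simp add: LIMSEQ_const_iff)
qed

text \<open>The product rule applied to \<open>\<phi> * \<psi>\<close>, whose derivative integrates to zero over the whole space. It
  says that the classical partial derivative of a test function is also its weak derivative.\<close>

lemma test_function_partial_weak_deriv:
  fixes D :: "'a::euclidean_space set"
  assumes D: "open D" and \<phi>: "\<phi> \<in> test_functions D" and \<psi>: "\<psi> \<in> test_functions D" and b: "b \<in> Basis"
  shows "(LINT x|lebesgue_on D. \<phi> x * partials [b] \<psi> x) = - (LINT x|lebesgue_on D. partials [b] \<phi> x * \<psi> x)"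
proof -
  have d: "(f has_derivative frechet_derivative f (at x)) (at x)" if "f \<in> test_functions D" for f x
  proof -
    have "partials [] f differentiable (at x)"
      using that unfolding test_functions_def by blast
    then show ?thesis by (simp add: frechet_derivative_works)
  qed
  have zero: "f x = 0" if "f \<in> test_functions D" "x \<notin> D" for f x
    using that closure_subset[of "{x. f x \<noteq> 0}"] by (auto simp: test_functions_def)
  have dzero: "partials [b] f x = 0" if f: "f \<in> test_functions D" "x \<notin> D" for f x
  proof -
    let ?C = "closure {x. f x \<noteq> 0}"
    have x: "x \<in> - ?C" using f by (auto simp: test_functions_def)
    have vanish: "0 = f y" if "y \<in> - ?C" for y
      using that closure_subset[of "{x. f x \<noteq> 0}"] by auto
    have "(f has_derivative (\<lambda>h. 0)) (at x)"
      by (rule has_derivative_transform_within_open[OF has_derivative_const _ x vanish]) auto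
    then have "frechet_derivative f (at x) = (\<lambda>h. 0)"
      by (rule frechet_derivative_at[symmetric])
    then show ?thesis by simp
  qed
  have cont: "continuous_on UNIV f" "continuous_on UNIV (partials [b] f)" if "f \<in> test_functions D" for f
    using continuous_on_partials[OF that, of "[]" UNIV] continuous_on_partials[OF that, of "[b]" UNIV] b by auto
  have prod_int: "integrable lborel (\<lambda>x. f x * g x)"
    if "f \<in> test_functions D" "continuous_on UNIV g" for f g :: "'a \<Rightarrow> real"
  proof -
    have "compact (closure {x. f x \<noteq> 0})" using that(1) by (auto simp: test_functions_def)
    then have "integrable lborel (\<lambda>x. indicator (closure {x. f x \<noteq> 0}) x *\<^sub>R (f x * g x))"
      by (intro borel_integrable_compact continuous_on_mult continuous_on_subset[OF that(2)]
          continuous_on_subset[OF cont(1)[OF that(1)]]) auto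
    moreover have "(\<lambda>x. indicator (closure {x. f x \<noteq> 0}) x *\<^sub>R (f x * g x)) = (\<lambda>x. f x * g x)"
      using closure_subset[of "{x. f x \<noteq> 0}"] by (auto simp: indicator_def fun_eq_iff)
    ultimately show ?thesis by simp
  qed
  have to_D: "(LINT x|lebesgue_on D. F x) = (LINT x|lborel. F x)"
    if "\<And>x. x \<notin> D \<Longrightarrow> F x = 0" "continuous_on UNIV F" for F :: "'a \<Rightarrow> real"
  proof -
    have "(LINT x|lebesgue_on D. F x) = (LINT x|lebesgue. indicator D x *\<^sub>R F x)"
      using D by (simp add: integral_restrict_space)
    also have "(\<lambda>x. indicator D x *\<^sub>R F x) = F"
      using that(1) by (intro ext) (auto split: split_indicator)
    also have "(LINT x|lebesgue. F x) = (LINT x|lborel. F x)"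
      using that(2) by (intro integral_completion) (simp add: borel_measurable_continuous_onI)
    finally show ?thesis .
  qed
  have "((\<lambda>x. \<phi> x * \<psi> x) has_derivative
      (\<lambda>h. \<phi> x * frechet_derivative \<psi> (at x) h + frechet_derivative \<phi> (at x) h * \<psi> x)) (at x)" for x
    by (intro has_derivative_mult d \<phi> \<psi>)
  moreover have "continuous_on UNIV (\<lambda>x. \<phi> x * frechet_derivative \<psi> (at x) b + frechet_derivative \<phi> (at x) b * \<psi> x)"
    using cont[OF \<phi>] cont[OF \<psi>] by (auto intro!: continuous_intros)
  moreover have "bounded {x. \<phi> x * \<psi> x \<noteq> 0}"
  proof (rule bounded_subset)
    show "bounded (closure {x. \<phi> x \<noteq> 0})"
      using \<phi> by (auto simp: test_functions_def compact_imp_bounded)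
  qed (use closure_subset[of "{x. \<phi> x \<noteq> 0}"] in auto)
  ultimately have "(LINT x|lborel. \<phi> x * frechet_derivative \<psi> (at x) b + frechet_derivative \<phi> (at x) b * \<psi> x) = 0"
    using integral_directional_derivative_eq_0[of "\<lambda>x. \<phi> x * \<psi> x"
      "\<lambda>x h. \<phi> x * frechet_derivative \<psi> (at x) h + frechet_derivative \<phi> (at x) h * \<psi> x" b] by blast
  moreover have "integrable lborel (\<lambda>x. \<phi> x * frechet_derivative \<psi> (at x) b)"
    using prod_int[OF \<phi> cont(2)[OF \<psi>]] by simp
  moreover have "integrable lborel (\<lambda>x. frechet_derivative \<phi> (at x) b * \<psi> x)"
    using prod_int[OF \<psi> cont(2)[OF \<phi>]] by (simp add: mult.commute)
  ultimately have "(LINT x|lborel. \<phi> x * partials [b] \<psi> x) = - (LINT x|lborel. partials [b] \<phi> x * \<psi> x)"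
    by simp
  moreover have "(LINT x|lebesgue_on D. \<phi> x * partials [b] \<psi> x) = (LINT x|lborel. \<phi> x * partials [b] \<psi> x)"
    using zero[OF \<phi>] cont(1)[OF \<phi>] cont(2)[OF \<psi>] by (intro to_D) (auto intro!: continuous_intros)
  moreover have "(LINT x|lebesgue_on D. partials [b] \<phi> x * \<psi> x) = (LINT x|lborel. partials [b] \<phi> x * \<psi> x)"
    using zero[OF \<psi>] cont(1)[OF \<psi>] cont(2)[OF \<phi>] by (intro to_D) (auto intro!: continuous_intros)
  ultimately show ?thesis by simp
qed

section \<open>Calculus of weak derivatives\<close>

locale bounded_open_set =
  fixes D :: "'a::euclidean_space set"
  assumes open_D: "open D" and bounded_D: "bounded D"
begin

lemma D_lmeasurable: "D \<in> lmeasurable"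
  using bounded_D open_D by (simp add: lmeasurable_open)

lemma D_sets: "D \<in> sets lebesgue"
  using D_lmeasurable by (rule fmeasurableD)

lemma finite_measure_D: "finite_measure (lebesgue_on D)"
  by (rule finite_measure_lebesgue_on[OF D_lmeasurable])

lemma L2_space_measurable [measurable_dest]: "v \<in> L2_space D \<Longrightarrow> v \<in> borel_measurable (lebesgue_on D)"
  by (simp add: L2_space_def)

lemma L2_space_integrable_square: "v \<in> L2_space D \<Longrightarrow> integrable (lebesgue_on D) (\<lambda>x. (v x)\<^sup>2)"
  by (simp add: L2_space_def)

lemma L2_space_integrable_mult:
  assumes v: "v \<in> L2_space D" and w: "w \<in> L2_space D"
  shows "integrable (lebesgue_on D) (\<lambda>x. v x * w x)"
proof (rule Bochner_Integration.integrable_bound)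
  show "integrable (lebesgue_on D) (\<lambda>x. (v x)\<^sup>2 + (w x)\<^sup>2)"
    using v w by (intro Bochner_Integration.integrable_add L2_space_integrable_square)
  show "(\<lambda>x. v x * w x) \<in> borel_measurable (lebesgue_on D)"
    using v w by (intro borel_measurable_times L2_space_measurable)
  have "\<bar>a * b\<bar> \<le> a\<^sup>2 + b\<^sup>2" for a b :: real
  proof -
    have "2 * (\<bar>a\<bar> * \<bar>b\<bar>) \<le> a\<^sup>2 + b\<^sup>2"
      using sum_squares_bound[of "\<bar>a\<bar>" "\<bar>b\<bar>"] by (simp add: mult.assoc)
    moreover have "0 \<le> \<bar>a\<bar> * \<bar>b\<bar>" by simp
    ultimately show ?thesis unfolding abs_mult by linarith
  qed
  then show "AE x in lebesgue_on D. norm (v x * w x) \<le> norm ((v x)\<^sup>2 + (w x)\<^sup>2)"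
    by (intro AE_I2) simp
qed

lemma continuous_in_L2_space:
  fixes f :: "'a \<Rightarrow> real"
  assumes "continuous_on UNIV f"
  shows "f \<in> L2_space D"
proof -
  have m: "f \<in> borel_measurable (lebesgue_on D)"
    using assms by (intro continuous_imp_measurable_on_sets_lebesgue D_sets) (rule continuous_on_subset, auto)
  have "compact (f ` closure D)"
    using bounded_D by (intro compact_continuous_image continuous_on_subset[OF assms]) auto
  then obtain K where K: "\<And>x. x \<in> closure D \<Longrightarrow> \<bar>f x\<bar> \<le> K"
    by (meson compact_imp_bounded bounded_real imageI)
  have "integrable (lebesgue_on D) (\<lambda>x. (f x)\<^sup>2)"
  proof (rule finite_measure.integrable_const_bound[OF finite_measure_D])
    show "AE x in lebesgue_on D. norm ((f x)\<^sup>2) \<le> K\<^sup>2"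
    proof (rule AE_I2)
      fix x assume "x \<in> space (lebesgue_on D)"
      then have "\<bar>f x\<bar> \<le> K" using K closure_subset[of D] by auto
      then show "norm ((f x)\<^sup>2) \<le> K\<^sup>2"
        using abs_le_square_iff[of "f x" K] by auto
    qed
  qed (use m in measurable)
  with m show ?thesis by (simp add: L2_space_def)
qed

lemma L2_space_integrable:
  assumes "v \<in> L2_space D"
  shows "integrable (lebesgue_on D) v"
  using L2_space_integrable_mult[OF assms continuous_in_L2_space[of "\<lambda>x. 1"]] by simp

lemma L2_space_lincomb:
  assumes v: "v \<in> L2_space D" and w: "w \<in> L2_space D"
  shows "(\<lambda>x. v x + c * w x) \<in> L2_space D"
proof -
  have "integrable (lebesgue_on D) (\<lambda>x. (v x)\<^sup>2 + 2 * c * (v x * w x) + c\<^sup>2 * (w x)\<^sup>2)"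
    using v w by (intro Bochner_Integration.integrable_add integrable_mult_right
        L2_space_integrable_square L2_space_integrable_mult)
  moreover have "(\<lambda>x. (v x)\<^sup>2 + 2 * c * (v x * w x) + c\<^sup>2 * (w x)\<^sup>2) = (\<lambda>x. (v x + c * w x)\<^sup>2)"
    by (auto simp: power2_eq_square algebra_simps)
  moreover have "(\<lambda>x. v x + c * w x) \<in> borel_measurable (lebesgue_on D)"
    by (intro borel_measurable_add borel_measurable_times borel_measurable_const
        L2_space_measurable[OF v] L2_space_measurable[OF w])
  ultimately show ?thesis by (simp add: L2_space_def)
qed

lemma test_function_partials_L2:
  assumes "\<phi> \<in> test_functions D" "bs \<in> lists Basis"
  shows "partials bs \<phi> \<in> L2_space D"
  using continuous_in_L2_space continuous_on_partials[OF assms] by blast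

lemma test_function_L2: "\<phi> \<in> test_functions D \<Longrightarrow> \<phi> \<in> L2_space D"
  using test_function_partials_L2[of \<phi> "[]"] by simp

text \<open>Uniqueness makes the arbitrary choice in \<open>weak_deriv\<close> harmless: every linear identity between weak
  derivatives below holds almost everywhere because both sides are weak derivatives of one function.\<close>

lemma has_weak_deriv_unique:
  assumes "has_weak_deriv D bs v g" "has_weak_deriv D bs v g'"
  shows "AE x in lebesgue_on D. g x = g' x"
proof -
  have L2: "g \<in> L2_space D" "g' \<in> L2_space D" using assms by (auto simp: has_weak_deriv_def)
  have "AE x in lebesgue_on D. g x - g' x = 0"
  proof (rule weakly_zero_imp_AE_zero[OF open_D])
    show "integrable (lebesgue_on D) (\<lambda>x. g x - g' x)"
      using L2 by (intro Bochner_Integration.integrable_diff L2_space_integrable)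
  next
    fix \<phi> :: "'a \<Rightarrow> real" assume \<phi>: "\<phi> \<in> test_functions D"
    have "(LINT x|lebesgue_on D. v x * partials bs \<phi> x) = (-1) ^ length bs * (LINT x|lebesgue_on D. h x * \<phi> x)"
      if "has_weak_deriv D bs v h" for h
      using that \<phi> unfolding has_weak_deriv_def by blast
    from this[OF assms(1)] this[OF assms(2)]
    have "(-1) ^ length bs * (LINT x|lebesgue_on D. g x * \<phi> x) = (-1) ^ length bs * (LINT x|lebesgue_on D. g' x * \<phi> x)"
      by (rule trans[OF sym])
    then have "(LINT x|lebesgue_on D. g x * \<phi> x) = (LINT x|lebesgue_on D. g' x * \<phi> x)"
      by simp
    moreover have "integrable (lebesgue_on D) (\<lambda>x. g x * \<phi> x)" "integrable (lebesgue_on D) (\<lambda>x. g' x * \<phi> x)"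
      using L2 \<phi> by (auto intro: L2_space_integrable_mult test_function_L2)
    ultimately show "(LINT x|lebesgue_on D. (g x - g' x) * \<phi> x) = 0"
      by (simp add: left_diff_distrib)
  qed
  then show ?thesis by eventually_elim simp
qed

lemma has_weak_deriv_weak_deriv:
  assumes "has_weak_deriv D bs v g"
  shows "has_weak_deriv D bs v (weak_deriv D bs v)"
  unfolding weak_deriv_def by (rule someI[of "has_weak_deriv D bs v", OF assms])

lemma weak_deriv_AE_eq:
  assumes "has_weak_deriv D bs v g"
  shows "AE x in lebesgue_on D. weak_deriv D bs v x = g x"
  using has_weak_deriv_unique[OF has_weak_deriv_weak_deriv[OF assms] assms] .

lemma has_weak_deriv_lincomb:
  assumes v: "has_weak_deriv D bs v g" and w: "has_weak_deriv D bs w g'"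
    and L2: "v \<in> L2_space D" "w \<in> L2_space D" and bs: "bs \<in> lists Basis"
  shows "has_weak_deriv D bs (\<lambda>x. v x + c * w x) (\<lambda>x. g x + c * g' x)"
  unfolding has_weak_deriv_def
proof (intro conjI ballI)
  have g: "g \<in> L2_space D" "g' \<in> L2_space D" using v w by (auto simp: has_weak_deriv_def)
  then show "(\<lambda>x. g x + c * g' x) \<in> L2_space D" by (rule L2_space_lincomb)
  fix \<phi> assume \<phi>: "\<phi> \<in> test_functions D"
  have split: "(LINT x|lebesgue_on D. (p x + c * q x) * \<psi> x)
      = (LINT x|lebesgue_on D. p x * \<psi> x) + c * (LINT x|lebesgue_on D. q x * \<psi> x)"
    if "p \<in> L2_space D" "q \<in> L2_space D" "\<psi> \<in> L2_space D" for p q \<psi>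
  proof -
    have "(LINT x|lebesgue_on D. (p x + c * q x) * \<psi> x) = (LINT x|lebesgue_on D. p x * \<psi> x + c * (q x * \<psi> x))"
      by (simp add: algebra_simps)
    also have "\<dots> = (LINT x|lebesgue_on D. p x * \<psi> x) + (LINT x|lebesgue_on D. c * (q x * \<psi> x))"
      using that by (intro Bochner_Integration.integral_add integrable_mult_right L2_space_integrable_mult)
    finally show ?thesis by simp
  qed
  have "(LINT x|lebesgue_on D. (v x + c * w x) * partials bs \<phi> x)
     = (LINT x|lebesgue_on D. v x * partials bs \<phi> x) + c * (LINT x|lebesgue_on D. w x * partials bs \<phi> x)"
    by (rule split[OF L2 test_function_partials_L2[OF \<phi> bs]])
  also have "\<dots> = (-1) ^ length bs * (LINT x|lebesgue_on D. g x * \<phi> x)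
      + c * ((-1) ^ length bs * (LINT x|lebesgue_on D. g' x * \<phi> x))"
    using v w \<phi> by (simp add: has_weak_deriv_def)
  also have "\<dots> = (-1) ^ length bs * (LINT x|lebesgue_on D. (g x + c * g' x) * \<phi> x)"
    by (subst split[OF g test_function_L2[OF \<phi>]]) (simp add: algebra_simps)
  finally show "(LINT x|lebesgue_on D. (v x + c * w x) * partials bs \<phi> x)
      = (-1) ^ length bs * (LINT x|lebesgue_on D. (g x + c * g' x) * \<phi> x)" .
qed

lemma sobolev_L2: "v \<in> sobolev D k \<Longrightarrow> v \<in> L2_space D"
  by (simp add: sobolev_def)

lemma sobolev_weak_deriv:
  assumes "v \<in> sobolev D k" "bs \<in> lists Basis" "length bs \<le> k"
  shows "has_weak_deriv D bs v (weak_deriv D bs v)"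
  using assms has_weak_deriv_weak_deriv unfolding sobolev_def by blast

lemma weak_deriv_L2:
  assumes "v \<in> sobolev D k" "bs \<in> lists Basis" "length bs \<le> k"
  shows "weak_deriv D bs v \<in> L2_space D"
  using sobolev_weak_deriv[OF assms] by (simp add: has_weak_deriv_def)

lemma sobolev_lincomb:
  assumes "v \<in> sobolev D k" "w \<in> sobolev D k"
  shows "(\<lambda>x. v x + c * w x) \<in> sobolev D k"
  unfolding sobolev_def
proof (intro CollectI conjI ballI impI)
  show "(\<lambda>x. v x + c * w x) \<in> L2_space D"
    using assms by (intro L2_space_lincomb sobolev_L2)
  fix bs :: "'a list" assume "bs \<in> lists Basis" "length bs \<le> k"
  then show "\<exists>g. has_weak_deriv D bs (\<lambda>x. v x + c * w x) g"
    using assms has_weak_deriv_lincomb sobolev_weak_deriv sobolev_L2 by blast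
qed

lemma weak_deriv_lincomb:
  assumes "v \<in> sobolev D k" "w \<in> sobolev D k" "bs \<in> lists Basis" "length bs \<le> k"
  shows "AE x in lebesgue_on D.
    weak_deriv D bs (\<lambda>x. v x + c * w x) x = weak_deriv D bs v x + c * weak_deriv D bs w x"
  by (intro weak_deriv_AE_eq has_weak_deriv_lincomb sobolev_weak_deriv[of _ k] sobolev_L2[of _ k] assms)

lemma sobolev_1_weak_grad_lincomb:
  assumes "v \<in> sobolev D 1" "w \<in> sobolev D 1"
  shows "AE x in lebesgue_on D. weak_grad D (\<lambda>x. v x + c * w x) x = weak_grad D v x + c *\<^sub>R weak_grad D w x"
proof -
  have "AE x in lebesgue_on D. \<forall>b\<in>Basis.
    weak_deriv D [b] (\<lambda>x. v x + c * w x) x = weak_deriv D [b] v x + c * weak_deriv D [b] w x"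
    by (intro AE_finite_allI weak_deriv_lincomb[of _ 1] assms) auto
  then show ?thesis
    by eventually_elim (simp add: weak_grad_def scaleR_add_left sum.distrib scaleR_sum_right)
qed

text \<open>Membership in \<open>H01 D\<close> is a statement about \<open>v - \<phi>\<close> for test functions \<open>\<phi>\<close>. The norm of this
  difference is meaningful only if it has weak derivatives itself, which is where integration by parts
  enters.\<close>

lemma test_function_sobolev_1:
  assumes \<phi>: "\<phi> \<in> test_functions D"
  shows "\<phi> \<in> sobolev D 1"
  unfolding sobolev_def
proof (intro CollectI conjI ballI impI)
  show "\<phi> \<in> L2_space D" using \<phi> by (rule test_function_L2)
  fix bs :: "'a list" assume bs: "bs \<in> lists Basis" "length bs \<le> 1"
  have "has_weak_deriv D bs \<phi> (partials bs \<phi>)"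
  proof (cases bs)
    case Nil
    with \<phi> show ?thesis by (simp add: has_weak_deriv_def test_function_L2)
  next
    case (Cons b bs')
    with bs have b: "bs = [b]" "b \<in> Basis" by auto
    with test_function_partial_weak_deriv[OF open_D \<phi>] test_function_partials_L2[OF \<phi> bs(1)]
    show ?thesis by (simp add: has_weak_deriv_def)
  qed
  then show "\<exists>g. has_weak_deriv D bs \<phi> g" by blast
qed

lemma partials_lincomb:
  assumes \<phi>: "\<phi> \<in> test_functions D" and \<psi>: "\<psi> \<in> test_functions D" and bs: "bs \<in> lists Basis"
  shows "partials bs (\<lambda>x. \<phi> x + c * \<psi> x) = (\<lambda>x. partials bs \<phi> x + c * partials bs \<psi> x)"
  using bs
proof (induction bs)
  case (Cons b bs)
  then have IH: "partials bs (\<lambda>x. \<phi> x + c * \<psi> x) = (\<lambda>x. partials bs \<phi> x + c * partials bs \<psi> x)" by auto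
  have d: "(partials bs f has_derivative frechet_derivative (partials bs f) (at x)) (at x)"
    if "f \<in> test_functions D" for f x
    using that Cons.hyps unfolding test_functions_def by (auto simp: frechet_derivative_works[symmetric])
  have "((\<lambda>x. partials bs \<phi> x + c * partials bs \<psi> x) has_derivative
    (\<lambda>h. frechet_derivative (partials bs \<phi>) (at x) h + c * frechet_derivative (partials bs \<psi>) (at x) h)) (at x)" for x
    by (intro has_derivative_add has_derivative_mult_right d \<phi> \<psi>)
  then have "frechet_derivative (\<lambda>x. partials bs \<phi> x + c * partials bs \<psi> x) (at x) =
    (\<lambda>h. frechet_derivative (partials bs \<phi>) (at x) h + c * frechet_derivative (partials bs \<psi>) (at x) h)" for x
    by (rule frechet_derivative_at[symmetric])
  then show ?case by (simp add: IH)
qed simp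

lemma test_functions_lincomb:
  assumes \<phi>: "\<phi> \<in> test_functions D" and \<psi>: "\<psi> \<in> test_functions D"
  shows "(\<lambda>x. \<phi> x + c * \<psi> x) \<in> test_functions D"
proof -
  let ?C = "closure {x. \<phi> x \<noteq> 0} \<union> closure {x. \<psi> x \<noteq> 0}"
  have C: "compact ?C" "?C \<subseteq> D" using \<phi> \<psi> by (auto simp: test_functions_def)
  have sub: "closure {x. \<phi> x + c * \<psi> x \<noteq> 0} \<subseteq> ?C"
  proof (rule closure_minimal)
    show "{x. \<phi> x + c * \<psi> x \<noteq> 0} \<subseteq> ?C"
      using closure_subset[of "{x. \<phi> x \<noteq> 0}"] closure_subset[of "{x. \<psi> x \<noteq> 0}"] by fastforce
  qed (use C(1) compact_imp_closed in blast)
  moreover from this have "compact (closure {x. \<phi> x + c * \<psi> x \<noteq> 0})"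
    using C(1) by (meson bounded_subset closed_closure compact_eq_bounded_closed)
  moreover have "partials bs (\<lambda>x. \<phi> x + c * \<psi> x) differentiable (at x)" if bs: "bs \<in> lists Basis" for bs x
  proof -
    have "partials bs \<phi> differentiable (at x)" "partials bs \<psi> differentiable (at x)"
      using \<phi> \<psi> bs by (auto simp: test_functions_def)
    then show ?thesis by (simp add: partials_lincomb[OF \<phi> \<psi> bs] differentiable_add differentiable_mult)
  qed
  ultimately show ?thesis using C(2) unfolding test_functions_def by blast
qed

lemma zero_test_function: "(\<lambda>x. 0) \<in> test_functions D"
  using cutoff_algebra_smooth[OF cutoff_algebra.const[of 0]] by (auto simp: test_functions_def)

lemma L2_norm_sq: "(L2_norm D v)\<^sup>2 = (LINT x|lebesgue_on D. (v x)\<^sup>2)"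
  by (simp add: L2_norm_def)

lemma sobolev_norm_sq:
  "(sobolev_norm D k v)\<^sup>2 = (\<Sum>bs\<in>{bs \<in> lists Basis. length bs \<le> k}. (L2_norm D (weak_deriv D bs v))\<^sup>2)"
  by (simp add: sobolev_norm_def sum_nonneg)

text \<open>The crude constant \<open>2\<close> avoids Minkowski's inequality; it is enough for the limits in the definition of
  \<open>H01 D\<close>.\<close>

lemma sobolev_norm_lincomb:
  assumes v: "v \<in> sobolev D k" and w: "w \<in> sobolev D k"
  shows "(sobolev_norm D k (\<lambda>x. v x + c * w x))\<^sup>2 \<le> 2 * (sobolev_norm D k v)\<^sup>2 + 2 * c\<^sup>2 * (sobolev_norm D k w)\<^sup>2"
proof -
  have "(L2_norm D (weak_deriv D bs (\<lambda>x. v x + c * w x)))\<^sup>2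
      \<le> 2 * (L2_norm D (weak_deriv D bs v))\<^sup>2 + 2 * c\<^sup>2 * (L2_norm D (weak_deriv D bs w))\<^sup>2"
    if bs: "bs \<in> lists Basis" "length bs \<le> k" for bs
  proof -
    let ?v = "weak_deriv D bs v" and ?w = "weak_deriv D bs w"
    note L2 = weak_deriv_L2[OF v bs] weak_deriv_L2[OF w bs] weak_deriv_L2[OF sobolev_lincomb[OF v w] bs]
    let ?R = "\<lambda>x. 2 * (?v x)\<^sup>2 + 2 * c\<^sup>2 * (?w x)\<^sup>2"
    have "(L2_norm D (weak_deriv D bs (\<lambda>x. v x + c * w x)))\<^sup>2 \<le> (LINT x|lebesgue_on D. ?R x)"
      unfolding L2_norm_sq
    proof (rule integral_mono_AE)
      show "AE x in lebesgue_on D. (weak_deriv D bs (\<lambda>x. v x + c * w x) x)\<^sup>2 \<le> 2 * (?v x)\<^sup>2 + 2 * c\<^sup>2 * (?w x)\<^sup>2"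
        using weak_deriv_lincomb[OF v w bs, of c]
      proof eventually_elim
        case (elim x)
        have "(p + q)\<^sup>2 \<le> 2 * p\<^sup>2 + 2 * q\<^sup>2" for p q :: real
          using sum_squares_bound[of p q] by (simp add: power2_sum)
        from this[of "?v x" "c * ?w x"] show ?case by (simp add: elim power_mult_distrib)
      qed
    qed (use L2 in \<open>auto intro!: L2_space_integrable_square Bochner_Integration.integrable_add integrable_mult_right\<close>)
    also have "(LINT x|lebesgue_on D. ?R x) = 2 * (LINT x|lebesgue_on D. (?v x)\<^sup>2) + 2 * c\<^sup>2 * (LINT x|lebesgue_on D. (?w x)\<^sup>2)"
      using L2 by (simp add: L2_space_integrable_square)
    finally show ?thesis by (simp add: L2_norm_sq)
  qed
  then show ?thesis
    unfolding sobolev_norm_sq sum_distrib_left sum.distrib[symmetric]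
    by (intro sum_mono) auto
qed

lemma H01_sobolev: "v \<in> H01 D \<Longrightarrow> v \<in> sobolev D 1"
  by (simp add: H01_def)

text \<open>The same linear combination of approximating test functions approximates the linear combination.\<close>

lemma H01_lincomb:
  assumes v: "v \<in> H01 D" and w: "w \<in> H01 D"
  shows "(\<lambda>x. v x + c * w x) \<in> H01 D"
proof -
  obtain \<phi> \<psi> where \<phi>: "\<And>k. \<phi> k \<in> test_functions D" "(\<lambda>k. sobolev_norm D 1 (\<lambda>x. v x - \<phi> k x)) \<longlonglongrightarrow> 0"
    and \<psi>: "\<And>k. \<psi> k \<in> test_functions D" "(\<lambda>k. sobolev_norm D 1 (\<lambda>x. w x - \<psi> k x)) \<longlonglongrightarrow> 0"
    using v w by (auto simp: H01_def)
  let ?\<chi> = "\<lambda>k x. \<phi> k x + c * \<psi> k x"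
  have diff: "(\<lambda>x. p x - q x) \<in> sobolev D 1" if "p \<in> sobolev D 1" "q \<in> sobolev D 1" for p q
    using sobolev_lincomb[OF that, of "-1"] by simp
  let ?B = "\<lambda>k. 2 * (sobolev_norm D 1 (\<lambda>x. v x - \<phi> k x))\<^sup>2
      + 2 * c\<^sup>2 * (sobolev_norm D 1 (\<lambda>x. w x - \<psi> k x))\<^sup>2"
  have bound: "(sobolev_norm D 1 (\<lambda>x. v x + c * w x - ?\<chi> k x))\<^sup>2 \<le> ?B k" for k
    using sobolev_norm_lincomb[OF diff[OF H01_sobolev[OF v] test_function_sobolev_1[OF \<phi>(1)[of k]]]
        diff[OF H01_sobolev[OF w] test_function_sobolev_1[OF \<psi>(1)[of k]]], of c]
    by (simp add: algebra_simps)
  have "?B \<longlonglongrightarrow> 2 * 0\<^sup>2 + 2 * c\<^sup>2 * 0\<^sup>2"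
    by (intro tendsto_intros \<phi>(2) \<psi>(2))
  then have "?B \<longlonglongrightarrow> 0" by simp
  then have "(\<lambda>k. (sobolev_norm D 1 (\<lambda>x. v x + c * w x - ?\<chi> k x))\<^sup>2) \<longlonglongrightarrow> 0"
    by (rule tendsto_sandwich[OF always_eventually always_eventually tendsto_const, rotated 2])
      (simp_all only: bound zero_le_power2 simp_thms)
  then have "(\<lambda>k. sqrt ((sobolev_norm D 1 (\<lambda>x. v x + c * w x - ?\<chi> k x))\<^sup>2)) \<longlonglongrightarrow> sqrt 0"
    by (rule tendsto_real_sqrt)
  then have "(\<lambda>k. sobolev_norm D 1 (\<lambda>x. v x + c * w x - ?\<chi> k x)) \<longlonglongrightarrow> 0"
    by (simp add: tendsto_rabs_zero_iff)
  moreover have "?\<chi> k \<in> test_functions D" for k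
    by (intro test_functions_lincomb \<phi> \<psi>)
  ultimately show ?thesis
    using sobolev_lincomb[OF H01_sobolev[OF v] H01_sobolev[OF w]] unfolding H01_def
    by (auto intro!: exI[of _ ?\<chi>])
qed

lemma zero_H01: "(\<lambda>x. 0) \<in> H01 D"
proof -
  have z: "(\<lambda>x. 0) \<in> sobolev D 1" by (rule test_function_sobolev_1[OF zero_test_function])
  have "sobolev_norm D 1 (\<lambda>x. 0) = 0"
  proof -
    have "AE x in lebesgue_on D. weak_deriv D bs (\<lambda>x. 0) x = 0" for bs
      by (rule weak_deriv_AE_eq) (simp add: has_weak_deriv_def continuous_in_L2_space)
    then have "AE x in lebesgue_on D. (weak_deriv D bs (\<lambda>x. 0) x)\<^sup>2 = 0" for bs
      by eventually_elim simp
    then have "(LINT x|lebesgue_on D. (weak_deriv D bs (\<lambda>x. 0) x)\<^sup>2) = 0" for bs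
      by (rule integral_eq_zero_AE)
    then show ?thesis by (simp add: sobolev_norm_def L2_norm_sq)
  qed
  then show ?thesis
    using z zero_test_function unfolding H01_def by (auto intro!: exI[of _ "\<lambda>k x. 0"])
qed

lemma H01_add: "v \<in> H01 D \<Longrightarrow> w \<in> H01 D \<Longrightarrow> (\<lambda>x. v x + w x) \<in> H01 D"
  using H01_lincomb[of v w 1] by simp

lemma H01_diff: "v \<in> H01 D \<Longrightarrow> w \<in> H01 D \<Longrightarrow> (\<lambda>x. v x - w x) \<in> H01 D"
  using H01_lincomb[of v w "-1"] by simp

lemma H01_scale: "v \<in> H01 D \<Longrightarrow> (\<lambda>x. c * v x) \<in> H01 D"
  using H01_lincomb[OF zero_H01, of v c] by simp

lemma H01_sum:
  assumes "\<And>i. i \<in> I \<Longrightarrow> v i \<in> H01 D"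
  shows "(\<lambda>x. \<Sum>i\<in>I. v i x) \<in> H01 D"
  using assms by (induction I rule: infinite_finite_induct) (auto intro: H01_add zero_H01)

end

section \<open>The diffusion form on the energy space\<close>

context bounded_open_set
begin

text \<open>Boundedness may fail on a null set, which still makes all integrals in the diffusion form finite.\<close>

definition bounded_coeff :: "('a \<Rightarrow> real) \<Rightarrow> bool" where
  "bounded_coeff k \<longleftrightarrow> k \<in> borel_measurable (lebesgue_on D) \<and> (\<exists>K. AE x in lebesgue_on D. \<bar>k x\<bar> \<le> K)"

lemma bounded_coeff_const: "bounded_coeff (\<lambda>x. c)"
  by (auto simp: bounded_coeff_def)

lemma weak_grad_inner:
  "weak_grad D v x \<bullet> weak_grad D w x = (\<Sum>b\<in>Basis. weak_deriv D [b] v x * weak_deriv D [b] w x)"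
proof -
  have "weak_grad D u x \<bullet> b = weak_deriv D [b] u x" if "b \<in> Basis" for u b
    using that by (simp add: weak_grad_def inner_sum_left_Basis)
  then show ?thesis
    by (subst euclidean_inner) (intro sum.cong, auto)
qed

lemma diffusion_integrable:
  assumes k: "bounded_coeff k" and v: "v \<in> sobolev D 1" and w: "w \<in> sobolev D 1"
  shows "integrable (lebesgue_on D) (\<lambda>x. k x * (weak_grad D v x \<bullet> weak_grad D w x))"
proof -
  obtain K where K: "AE x in lebesgue_on D. \<bar>k x\<bar> \<le> K" using k by (auto simp: bounded_coeff_def)
  have int: "integrable (lebesgue_on D) (\<lambda>x. weak_grad D v x \<bullet> weak_grad D w x)"
    unfolding weak_grad_inner
    by (intro Bochner_Integration.integrable_sum L2_space_integrable_mult weak_deriv_L2[OF v] weak_deriv_L2[OF w]) auto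
  show ?thesis
  proof (rule Bochner_Integration.integrable_bound)
    show "integrable (lebesgue_on D) (\<lambda>x. K * (weak_grad D v x \<bullet> weak_grad D w x))"
      using int by (rule integrable_mult_right)
    show "(\<lambda>x. k x * (weak_grad D v x \<bullet> weak_grad D w x)) \<in> borel_measurable (lebesgue_on D)"
      using k borel_measurable_integrable[OF int] unfolding bounded_coeff_def by (intro borel_measurable_times) auto
    show "AE x in lebesgue_on D. norm (k x * (weak_grad D v x \<bullet> weak_grad D w x))
        \<le> norm (K * (weak_grad D v x \<bullet> weak_grad D w x))"
      using K by eventually_elim (auto simp: abs_mult intro!: mult_right_mono)
  qed
qed

lemma diffusion_form_commute: "diffusion_form D k v w = diffusion_form D k w v"
  by (simp add: diffusion_form_def inner_commute)

lemma diffusion_form_lincomb_left: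
  assumes k: "bounded_coeff k" and v: "v \<in> sobolev D 1" and w: "w \<in> sobolev D 1" and z: "z \<in> sobolev D 1"
  shows "diffusion_form D k (\<lambda>x. v x + c * w x) z = diffusion_form D k v z + c * diffusion_form D k w z"
proof -
  have "diffusion_form D k (\<lambda>x. v x + c * w x) z = (LINT x|lebesgue_on D.
      k x * (weak_grad D v x \<bullet> weak_grad D z x) + c * (k x * (weak_grad D w x \<bullet> weak_grad D z x)))"
    unfolding diffusion_form_def
  proof (rule integral_cong_AE)
    show "AE x in lebesgue_on D. k x * (weak_grad D (\<lambda>x. v x + c * w x) x \<bullet> weak_grad D z x)
      = k x * (weak_grad D v x \<bullet> weak_grad D z x) + c * (k x * (weak_grad D w x \<bullet> weak_grad D z x))"
      using sobolev_1_weak_grad_lincomb[OF v w, of c]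
      by eventually_elim (simp add: inner_add_left algebra_simps)
    show "(\<lambda>x. k x * (weak_grad D (\<lambda>x. v x + c * w x) x \<bullet> weak_grad D z x)) \<in> borel_measurable (lebesgue_on D)"
      by (rule borel_measurable_integrable[OF diffusion_integrable[OF k sobolev_lincomb[OF v w] z]])
    show "(\<lambda>x. k x * (weak_grad D v x \<bullet> weak_grad D z x) + c * (k x * (weak_grad D w x \<bullet> weak_grad D z x)))
        \<in> borel_measurable (lebesgue_on D)"
      by (intro borel_measurable_integrable Bochner_Integration.integrable_add integrable_mult_right diffusion_integrable k v w z)
  qed
  also have "\<dots> = (LINT x|lebesgue_on D. k x * (weak_grad D v x \<bullet> weak_grad D z x))
      + (LINT x|lebesgue_on D. c * (k x * (weak_grad D w x \<bullet> weak_grad D z x)))"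
    by (intro Bochner_Integration.integral_add integrable_mult_right diffusion_integrable k v w z)
  finally show ?thesis by (simp add: diffusion_form_def)
qed

lemma diffusion_form_lincomb_right:
  assumes "bounded_coeff k" "v \<in> sobolev D 1" "w \<in> sobolev D 1" "z \<in> sobolev D 1"
  shows "diffusion_form D k z (\<lambda>x. v x + c * w x) = diffusion_form D k z v + c * diffusion_form D k z w"
  using diffusion_form_lincomb_left[OF assms, of c] by (simp add: diffusion_form_commute[of k z])

lemma sobolev_zero: "(\<lambda>x. 0) \<in> sobolev D 1"
  by (rule H01_sobolev[OF zero_H01])

lemma sobolev_scale: "v \<in> sobolev D 1 \<Longrightarrow> (\<lambda>x. c * v x) \<in> sobolev D 1"
  using sobolev_lincomb[OF sobolev_zero, of v c] by simp

lemma sobolev_add: "v \<in> sobolev D 1 \<Longrightarrow> w \<in> sobolev D 1 \<Longrightarrow> (\<lambda>x. v x + w x) \<in> sobolev D 1"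
  using sobolev_lincomb[of v 1 w 1] by simp

lemma sobolev_diff: "v \<in> sobolev D 1 \<Longrightarrow> w \<in> sobolev D 1 \<Longrightarrow> (\<lambda>x. v x - w x) \<in> sobolev D 1"
  using sobolev_lincomb[of v 1 w "-1"] by simp

lemma sobolev_sum:
  assumes "\<And>i. i \<in> I \<Longrightarrow> v i \<in> sobolev D 1"
  shows "(\<lambda>x. \<Sum>i\<in>I. v i x) \<in> sobolev D 1"
  using assms by (induction I rule: infinite_finite_induct) (auto intro: sobolev_add sobolev_zero simp del: One_nat_def)

lemma diffusion_form_zero_left: "bounded_coeff k \<Longrightarrow> z \<in> sobolev D 1 \<Longrightarrow> diffusion_form D k (\<lambda>x. 0) z = 0"
  using diffusion_form_lincomb_left[of k "\<lambda>x. 0" "\<lambda>x. 0" z 1] sobolev_zero by simp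

lemma diffusion_form_add_left:
  assumes "bounded_coeff k" "v \<in> sobolev D 1" "w \<in> sobolev D 1" "z \<in> sobolev D 1"
  shows "diffusion_form D k (\<lambda>x. v x + w x) z = diffusion_form D k v z + diffusion_form D k w z"
  using diffusion_form_lincomb_left[OF assms, of 1] by simp

lemma diffusion_form_diff_left:
  assumes "bounded_coeff k" "v \<in> sobolev D 1" "w \<in> sobolev D 1" "z \<in> sobolev D 1"
  shows "diffusion_form D k (\<lambda>x. v x - w x) z = diffusion_form D k v z - diffusion_form D k w z"
  using diffusion_form_lincomb_left[OF assms, of "-1"] by simp

lemma diffusion_form_scale_left:
  assumes "bounded_coeff k" "w \<in> sobolev D 1" "z \<in> sobolev D 1"
  shows "diffusion_form D k (\<lambda>x. c * w x) z = c * diffusion_form D k w z"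
  using diffusion_form_lincomb_left[of k "\<lambda>x. 0" w z c] diffusion_form_zero_left assms sobolev_zero by simp

lemma diffusion_form_sum_left:
  assumes k: "bounded_coeff k" and v: "\<And>i. i \<in> I \<Longrightarrow> v i \<in> sobolev D 1" and z: "z \<in> sobolev D 1"
  shows "diffusion_form D k (\<lambda>x. \<Sum>i\<in>I. c i * v i x) z = (\<Sum>i\<in>I. c i * diffusion_form D k (v i) z)"
  using v
proof (induction I rule: infinite_finite_induct)
  case (insert i I)
  have "(\<lambda>x. \<Sum>i\<in>I. c i * v i x) \<in> sobolev D 1"
    using insert.prems by (intro sobolev_sum sobolev_scale) auto
  then have "diffusion_form D k (\<lambda>x. (\<Sum>i\<in>I. c i * v i x) + c i * v i x) z
      = diffusion_form D k (\<lambda>x. \<Sum>i\<in>I. c i * v i x) z + c i * diffusion_form D k (v i) z"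
    using insert.prems by (intro diffusion_form_lincomb_left k z) auto
  then show ?case using insert by (simp add: add.commute)
qed (use k z in \<open>simp_all add: diffusion_form_zero_left\<close>)

definition H01_inner :: "('a \<Rightarrow> real) \<Rightarrow> ('a \<Rightarrow> real) \<Rightarrow> real" where
  "H01_inner v w = diffusion_form D (\<lambda>x. 1) v w"

lemma H01_inner_self: "H01_inner v v = (H01_norm D v)\<^sup>2"
  by (simp add: H01_inner_def diffusion_form_def H01_norm_def power2_norm_eq_inner)

lemma H01_norm_nonneg: "0 \<le> H01_norm D v"
  by (simp add: H01_norm_def)

lemmas H01_inner_rules =
  diffusion_form_lincomb_left[OF bounded_coeff_const[of 1], folded H01_inner_def]
  diffusion_form_lincomb_right[OF bounded_coeff_const[of 1], folded H01_inner_def]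

lemma H01_norm_lincomb_sq:
  assumes v: "v \<in> sobolev D 1" and w: "w \<in> sobolev D 1"
  shows "(H01_norm D (\<lambda>x. v x + c * w x))\<^sup>2 = (H01_norm D v)\<^sup>2 + 2 * c * H01_inner v w + c\<^sup>2 * (H01_norm D w)\<^sup>2"
proof -
  have "H01_inner w v = H01_inner v w" by (simp add: H01_inner_def diffusion_form_commute)
  then show ?thesis
    using v w unfolding H01_inner_self[symmetric]
    by (simp add: H01_inner_rules sobolev_lincomb algebra_simps power2_eq_square)
qed

lemma quadratic_nonneg_imp_discriminant:
  fixes a b c :: real
  assumes nonneg: "\<And>t. 0 \<le> a + 2 * t * b + t\<^sup>2 * c" and "0 \<le> c"
  shows "b\<^sup>2 \<le> a * c"
proof (cases "c = 0")
  case True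
  have "b = 0"
  proof (rule ccontr)
    assume "b \<noteq> 0"
    then have "2 * (- (a + 1) / (2 * b)) * b = - (a + 1)" by (simp add: field_simps)
    then show False using nonneg[of "- (a + 1) / (2 * b)"] True by simp
  qed
  with True show ?thesis by simp
next
  case False
  then show ?thesis
    using nonneg[of "- b / c"] \<open>0 \<le> c\<close> by (simp add: field_simps power2_eq_square)
qed

text \<open>The square of \<open>H01_norm D (v + t w)\<close> is a nonnegative quadratic polynomial in \<open>t\<close>.\<close>

lemma H01_Cauchy_Schwarz:
  assumes v: "v \<in> sobolev D 1" and w: "w \<in> sobolev D 1"
  shows "\<bar>H01_inner v w\<bar> \<le> H01_norm D v * H01_norm D w"
proof -
  have "0 \<le> (H01_norm D v)\<^sup>2 + 2 * t * H01_inner v w + t\<^sup>2 * (H01_norm D w)\<^sup>2" for t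
    unfolding H01_norm_lincomb_sq[OF v w, symmetric] by simp
  then have "(H01_inner v w)\<^sup>2 \<le> (H01_norm D v)\<^sup>2 * (H01_norm D w)\<^sup>2"
    by (rule quadratic_nonneg_imp_discriminant) simp
  then have "\<bar>H01_inner v w\<bar>\<^sup>2 \<le> (H01_norm D v * H01_norm D w)\<^sup>2" by (simp add: power_mult_distrib)
  then show ?thesis
    by (rule power2_le_imp_le) (simp add: H01_norm_nonneg)
qed

lemma H01_norm_triangle:
  assumes v: "v \<in> sobolev D 1" and w: "w \<in> sobolev D 1"
  shows "H01_norm D (\<lambda>x. v x + w x) \<le> H01_norm D v + H01_norm D w"
proof (rule power2_le_imp_le)
  have "(H01_norm D (\<lambda>x. v x + w x))\<^sup>2 = (H01_norm D v)\<^sup>2 + 2 * H01_inner v w + (H01_norm D w)\<^sup>2"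
    using H01_norm_lincomb_sq[OF v w, of 1] by simp
  also have "\<dots> \<le> (H01_norm D v + H01_norm D w)\<^sup>2"
    using H01_Cauchy_Schwarz[OF v w] by (simp add: power2_sum)
  finally show "(H01_norm D (\<lambda>x. v x + w x))\<^sup>2 \<le> (H01_norm D v + H01_norm D w)\<^sup>2" .
qed (simp add: H01_norm_nonneg)

lemma H01_norm_scale:
  assumes "v \<in> sobolev D 1"
  shows "H01_norm D (\<lambda>x. c * v x) = \<bar>c\<bar> * H01_norm D v"
proof -
  have "H01_inner (\<lambda>x. c * v x) (\<lambda>x. c * v x) = c * H01_inner v (\<lambda>x. c * v x)"
    unfolding H01_inner_def
    by (rule diffusion_form_scale_left[OF bounded_coeff_const assms sobolev_scale[OF assms]])
  also have "H01_inner v (\<lambda>x. c * v x) = H01_inner (\<lambda>x. c * v x) v"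
    unfolding H01_inner_def by (rule diffusion_form_commute)
  also have "H01_inner (\<lambda>x. c * v x) v = c * H01_inner v v"
    unfolding H01_inner_def by (rule diffusion_form_scale_left[OF bounded_coeff_const assms assms])
  finally have "(H01_norm D (\<lambda>x. c * v x))\<^sup>2 = (\<bar>c\<bar> * H01_norm D v)\<^sup>2"
    by (simp add: H01_inner_self power2_eq_square)
  then show ?thesis
    by (rule power2_eq_imp_eq) (simp_all add: H01_norm_nonneg)
qed

lemma H01_norm_diff_commute:
  assumes "v \<in> sobolev D 1" "w \<in> sobolev D 1"
  shows "H01_norm D (\<lambda>x. v x - w x) = H01_norm D (\<lambda>x. w x - v x)"
  using H01_norm_scale[OF sobolev_diff[OF assms], of "-1"] by simp

lemma H01_norm_triangle_diff:
  assumes v: "v \<in> sobolev D 1" and w: "w \<in> sobolev D 1"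
  shows "\<bar>H01_norm D v - H01_norm D w\<bar> \<le> H01_norm D (\<lambda>x. v x - w x)"
  using H01_norm_triangle[OF sobolev_diff[OF v w] w] H01_norm_triangle[OF sobolev_diff[OF w v] v]
    H01_norm_diff_commute[OF v w] by simp

lemma H01_norm_sum_le:
  assumes "finite I" "\<And>i. i \<in> I \<Longrightarrow> v i \<in> sobolev D 1"
  shows "H01_norm D (\<lambda>x. \<Sum>i\<in>I. v i x) \<le> (\<Sum>i\<in>I. H01_norm D (v i))"
  using assms
proof (induction I)
  case empty
  show ?case using H01_norm_scale[OF sobolev_zero, of 0] by simp
next
  case (insert i I)
  have "H01_norm D (\<lambda>x. v i x + (\<Sum>i\<in>I. v i x)) \<le> H01_norm D (v i) + H01_norm D (\<lambda>x. \<Sum>i\<in>I. v i x)"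
    using insert by (intro H01_norm_triangle sobolev_sum) auto
  with insert show ?case by simp
qed

lemma H01_norm_zero: "H01_norm D (\<lambda>x. 0) = 0"
  using H01_norm_scale[OF sobolev_zero, of 0] by simp

lemma diffusion_form_null:
  assumes k: "bounded_coeff k" and v: "v \<in> sobolev D 1" "H01_norm D v = 0"
  shows "diffusion_form D k v z = 0"
proof -
  have "integrable (lebesgue_on D) (\<lambda>x. (norm (weak_grad D v x))\<^sup>2)"
    using diffusion_integrable[OF bounded_coeff_const v(1) v(1), of 1] by (simp add: power2_norm_eq_inner)
  moreover have "(LINT x|lebesgue_on D. (norm (weak_grad D v x))\<^sup>2) = 0"
    using v(2) by (simp add: H01_norm_def)
  ultimately have "AE x in lebesgue_on D. (norm (weak_grad D v x))\<^sup>2 = 0"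
    by (subst (asm) integral_nonneg_eq_0_iff_AE) auto
  then have "AE x in lebesgue_on D. k x * (weak_grad D v x \<bullet> weak_grad D z x) = 0"
    by eventually_elim simp
  then show ?thesis unfolding diffusion_form_def by (rule integral_eq_zero_AE)
qed

end

section \<open>Analytic dependence on the parameter\<close>

definition complex_point :: "real ^ 'n \<Rightarrow> complex ^ 'n" where
  "complex_point y = (\<chi> n. of_real (y $ n))"

lemma param_box_eq_cbox: "param_box = cbox (- 1) (1 :: real ^ 'n::finite)"
  by (auto simp: param_box_def mem_box_cart)

lemma compact_param_box: "compact (param_box :: (real ^ 'n::finite) set)"
  by (simp add: param_box_eq_cbox)

lemma convex_param_box: "convex (param_box :: (real ^ 'n::finite) set)"
  by (simp add: param_box_eq_cbox)

lemma of_real_in_bernstein_region: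
  assumes "x \<in> {-1..1}" "1 \<le> \<gamma>"
  shows "of_real x \<in> bernstein_region \<gamma>"
proof -
  have "(cis (arccos x) + inverse (cis (arccos x))) / 2 = of_real x"
    using assms(1) by (simp add: complex_eq_iff cis_inverse cos_arccos)
  then show ?thesis
    using assms(2) unfolding bernstein_region_def
    by (intro CollectI exI[of _ "cis (arccos x)"]) (simp add: norm_cis)
qed

lemma complex_point_in_polyellipse:
  assumes "y \<in> param_box" "\<And>n. 1 < \<gamma> n"
  shows "complex_point y $ n \<in> bernstein_region (\<gamma> n)"
  using assms by (auto simp: complex_point_def param_box_def intro!: of_real_in_bernstein_region less_imp_le)

lemma norm_complex_point: "norm (complex_point y) = norm (y :: real ^ 'n::finite)"
  by (simp add: complex_point_def norm_vec_def)

lemma complex_point_diff: "complex_point (y - z) = complex_point y - complex_point (z :: real ^ 'n::finite)"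
  by (intro Finite_Cartesian_Product.vec_eq_iff[THEN iffD2] allI) (simp add: complex_point_def)

lemma complex_point_inject [simp]: "complex_point y = complex_point z \<longleftrightarrow> y = (z :: real ^ 'n::finite)"
proof -
  have "complex_point y = complex_point z \<longleftrightarrow> norm (complex_point (y - z)) = 0"
    by (simp add: complex_point_diff)
  then show ?thesis by (simp add: norm_complex_point)
qed

context bounded_open_set
begin

lemma H01_complex_ReIm:
  assumes "v \<in> H01_complex D"
  shows "(\<lambda>x. Re (v x)) \<in> sobolev D 1" "(\<lambda>x. Im (v x)) \<in> sobolev D 1"
  using assms H01_sobolev unfolding H01_complex_def by blast+

lemma H01_norm_Re_le: "H01_norm D (\<lambda>x. Re (v x)) \<le> H01_complex_norm D v"
  unfolding H01_complex_norm_def by (rule real_sqrt_sum_squares_ge1)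

lemma H01_norm_Im_le: "H01_norm D (\<lambda>x. Im (v x)) \<le> H01_complex_norm D v"
  unfolding H01_complex_norm_def by (rule real_sqrt_sum_squares_ge2)

lemma H01_complex_norm_nonneg: "0 \<le> H01_complex_norm D v"
  by (simp add: H01_complex_norm_def)

lemma H01_complex_diff: "v \<in> H01_complex D \<Longrightarrow> w \<in> H01_complex D \<Longrightarrow> (\<lambda>x. v x - w x) \<in> H01_complex D"
  by (auto simp: H01_complex_def intro: H01_diff)

lemma H01_complex_scale: "v \<in> H01_complex D \<Longrightarrow> (\<lambda>x. c * v x) \<in> H01_complex D"
  by (auto simp: H01_complex_def intro!: H01_diff H01_add H01_scale)

lemma H01_complex_sum:
  assumes "\<And>i. i \<in> I \<Longrightarrow> v i \<in> H01_complex D"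
  shows "(\<lambda>x. \<Sum>i\<in>I. v i x) \<in> H01_complex D"
  using assms by (auto simp: H01_complex_def intro!: H01_sum)

text \<open>Pairing with a fixed real \<open>\<psi>\<close> is complex linear and bounded. It turns maps that are holomorphic with
  values in the complexified energy space into scalar holomorphic functions.\<close>

definition pairing :: "('a \<Rightarrow> real) \<Rightarrow> ('a \<Rightarrow> complex) \<Rightarrow> complex" where
  "pairing \<psi> v = Complex (H01_inner (\<lambda>x. Re (v x)) \<psi>) (H01_inner (\<lambda>x. Im (v x)) \<psi>)"

lemma pairing_diff:
  assumes \<psi>: "\<psi> \<in> sobolev D 1" and v: "v \<in> H01_complex D" and w: "w \<in> H01_complex D"
  shows "pairing \<psi> (\<lambda>x. v x - w x) = pairing \<psi> v - pairing \<psi> w"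
  using diffusion_form_diff_left[OF bounded_coeff_const H01_complex_ReIm(1)[OF v] H01_complex_ReIm(1)[OF w] \<psi>]
    diffusion_form_diff_left[OF bounded_coeff_const H01_complex_ReIm(2)[OF v] H01_complex_ReIm(2)[OF w] \<psi>]
  by (simp add: pairing_def H01_inner_def complex_eq_iff)

lemma pairing_scale:
  assumes \<psi>: "\<psi> \<in> sobolev D 1" and v: "v \<in> H01_complex D"
  shows "pairing \<psi> (\<lambda>x. c * v x) = c * pairing \<psi> v"
proof -
  note ReIm = H01_complex_ReIm[OF v]
  have scale: "H01_inner (\<lambda>x. r * p x) \<psi> = r * H01_inner p \<psi>" if "p \<in> sobolev D 1" for r p
    unfolding H01_inner_def by (rule diffusion_form_scale_left[OF bounded_coeff_const that \<psi>])
  have "H01_inner (\<lambda>x. Re c * Re (v x) - Im c * Im (v x)) \<psi>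
      = Re c * H01_inner (\<lambda>x. Re (v x)) \<psi> - Im c * H01_inner (\<lambda>x. Im (v x)) \<psi>"
    using diffusion_form_diff_left[OF bounded_coeff_const sobolev_scale[OF ReIm(1), of "Re c"]
        sobolev_scale[OF ReIm(2), of "Im c"] \<psi>, of 1] ReIm
    by (simp add: H01_inner_def[symmetric] scale)
  moreover have "H01_inner (\<lambda>x. Re c * Im (v x) + Im c * Re (v x)) \<psi>
      = Re c * H01_inner (\<lambda>x. Im (v x)) \<psi> + Im c * H01_inner (\<lambda>x. Re (v x)) \<psi>"
    using diffusion_form_add_left[OF bounded_coeff_const sobolev_scale[OF ReIm(2), of "Re c"]
        sobolev_scale[OF ReIm(1), of "Im c"] \<psi>, of 1] ReIm
    by (simp add: H01_inner_def[symmetric] scale)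
  ultimately show ?thesis
    by (simp add: pairing_def complex_eq_iff)
qed

lemma pairing_sum:
  assumes \<psi>: "\<psi> \<in> sobolev D 1" and "finite I" and v: "\<And>i. i \<in> I \<Longrightarrow> v i \<in> H01_complex D"
  shows "pairing \<psi> (\<lambda>x. \<Sum>i\<in>I. v i x) = (\<Sum>i\<in>I. pairing \<psi> (v i))"
  using assms(2,3)
proof (induction I)
  case empty
  then show ?case using \<psi>
    by (simp add: pairing_def H01_inner_def diffusion_form_zero_left bounded_coeff_const complex_eq_iff)
next
  case (insert i I)
  have vi: "v i \<in> H01_complex D" and vI: "(\<lambda>x. \<Sum>i\<in>I. v i x) \<in> H01_complex D"
    using insert.prems by (auto intro: H01_complex_sum)
  have "pairing \<psi> (\<lambda>x. v i x - (- 1) * (\<Sum>i\<in>I. v i x)) = pairing \<psi> (v i) - pairing \<psi> (\<lambda>x. (-1) * (\<Sum>i\<in>I. v i x))"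
    by (rule pairing_diff[OF \<psi> vi H01_complex_scale[OF vI]])
  also have "pairing \<psi> (\<lambda>x. (-1) * (\<Sum>i\<in>I. v i x)) = (-1) * pairing \<psi> (\<lambda>x. \<Sum>i\<in>I. v i x)"
    by (rule pairing_scale[OF \<psi> vI])
  finally show ?case using insert by simp
qed

lemma norm_pairing_le:
  assumes \<psi>: "\<psi> \<in> sobolev D 1" and v: "v \<in> H01_complex D"
  shows "norm (pairing \<psi> v) \<le> H01_complex_norm D v * H01_norm D \<psi>"
proof -
  have sq: "(H01_inner p \<psi>)\<^sup>2 \<le> (H01_norm D p)\<^sup>2 * (H01_norm D \<psi>)\<^sup>2" if "p \<in> sobolev D 1" for p
    using power_mono[OF H01_Cauchy_Schwarz[OF that \<psi>] abs_ge_zero, of 2] by (simp add: power_mult_distrib)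
  have "(norm (pairing \<psi> v))\<^sup>2 \<le> (H01_complex_norm D v * H01_norm D \<psi>)\<^sup>2"
    using sq[OF H01_complex_ReIm(1)[OF v]] sq[OF H01_complex_ReIm(2)[OF v]]
    by (simp add: pairing_def cmod_power2 H01_complex_norm_def power_mult_distrib algebra_simps)
  then show ?thesis
    by (rule power2_le_imp_le) (simp add: H01_complex_norm_nonneg H01_norm_nonneg)
qed

text \<open>The increment is the sum of a remainder of order \<open>o(norm (\<zeta> - z))\<close> and of a complex linear combination
  of the partial derivatives with coefficients at most \<open>norm (\<zeta> - z)\<close>.\<close>

lemma H01_holomorphic_on_Re_continuous:
  fixes w :: "complex ^ 'n::finite \<Rightarrow> 'a \<Rightarrow> complex"
  assumes hol: "H01_holomorphic_on D U w" and z: "z \<in> U"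
  shows "((\<lambda>\<zeta>. H01_norm D (\<lambda>x. Re (w \<zeta> x) - Re (w z x))) \<longlongrightarrow> 0) (at z)"
proof -
  have U: "open U" and wU: "\<And>\<zeta>. \<zeta> \<in> U \<Longrightarrow> w \<zeta> \<in> H01_complex D"
    using hol by (auto simp: H01_holomorphic_on_def)
  obtain g where g: "\<And>n. g n \<in> H01_complex D"
    and lim: "((\<lambda>\<zeta>. H01_complex_norm D (\<lambda>x. w \<zeta> x - w z x - (\<Sum>n\<in>UNIV. (\<zeta> $ n - z $ n) * g n x))
               / norm (\<zeta> - z)) \<longlongrightarrow> 0) (at z)"
    using hol z unfolding H01_holomorphic_on_def by blast
  define R where "R \<zeta> x = w \<zeta> x - w z x - (\<Sum>n\<in>UNIV. (\<zeta> $ n - z $ n) * g n x)" for \<zeta> x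
  define G where "G = (\<Sum>n\<in>UNIV. H01_norm D (\<lambda>x. Re (g n x)) + H01_norm D (\<lambda>x. Im (g n x)))"
  have bound: "H01_norm D (\<lambda>x. Re (w \<zeta> x) - Re (w z x)) \<le>
      H01_complex_norm D (R \<zeta>) / norm (\<zeta> - z) * norm (\<zeta> - z) + norm (\<zeta> - z) * G"
    if \<zeta>: "\<zeta> \<in> U" "\<zeta> \<noteq> z" for \<zeta>
  proof -
    define S where "S n x = (Re (\<zeta> $ n - z $ n) * Re (g n x) + (- Im (\<zeta> $ n - z $ n)) * Im (g n x))" for n x
    note gs = H01_complex_ReIm[OF g]
    have Ss: "S n \<in> sobolev D 1" for n
      unfolding S_def by (intro sobolev_add sobolev_scale gs)
    have R: "R \<zeta> \<in> H01_complex D"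
      unfolding R_def by (intro H01_complex_diff H01_complex_sum H01_complex_scale wU \<zeta> z g)
    have S_le: "H01_norm D (S n) \<le> norm (\<zeta> - z) * (H01_norm D (\<lambda>x. Re (g n x)) + H01_norm D (\<lambda>x. Im (g n x)))" for n
    proof -
      have c: "\<bar>Re (\<zeta> $ n - z $ n)\<bar> \<le> norm (\<zeta> - z)" "\<bar>- Im (\<zeta> $ n - z $ n)\<bar> \<le> norm (\<zeta> - z)"
        using order_trans[OF abs_Re_le_cmod Finite_Cartesian_Product.norm_nth_le[of "\<zeta> - z" n]]
          order_trans[OF abs_Im_le_cmod Finite_Cartesian_Product.norm_nth_le[of "\<zeta> - z" n]] by simp_all
      have "H01_norm D (S n) \<le> H01_norm D (\<lambda>x. Re (\<zeta> $ n - z $ n) * Re (g n x))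
          + H01_norm D (\<lambda>x. (- Im (\<zeta> $ n - z $ n)) * Im (g n x))"
        unfolding S_def by (intro H01_norm_triangle sobolev_scale gs)
      also have "\<dots> = \<bar>Re (\<zeta> $ n - z $ n)\<bar> * H01_norm D (\<lambda>x. Re (g n x)) + \<bar>- Im (\<zeta> $ n - z $ n)\<bar> * H01_norm D (\<lambda>x. Im (g n x))"
        by (simp only: H01_norm_scale[OF gs(1)] H01_norm_scale[OF gs(2)])
      also have "\<dots> \<le> norm (\<zeta> - z) * H01_norm D (\<lambda>x. Re (g n x)) + norm (\<zeta> - z) * H01_norm D (\<lambda>x. Im (g n x))"
        by (intro add_mono mult_right_mono c H01_norm_nonneg)
      finally show ?thesis by (simp add: algebra_simps)
    qed
    have "(\<lambda>x. Re (w \<zeta> x) - Re (w z x)) = (\<lambda>x. Re (R \<zeta> x) + (\<Sum>n\<in>UNIV. S n x))"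
    proof
      fix x
      have "(\<Sum>n\<in>UNIV. Re ((\<zeta> $ n - z $ n) * g n x)) = (\<Sum>n\<in>UNIV. S n x)"
        by (intro sum.cong) (simp_all add: S_def algebra_simps)
      then show "Re (w \<zeta> x) - Re (w z x) = Re (R \<zeta> x) + (\<Sum>n\<in>UNIV. S n x)"
        by (simp only: R_def minus_complex.sel Re_sum)
    qed
    then have "H01_norm D (\<lambda>x. Re (w \<zeta> x) - Re (w z x)) = H01_norm D (\<lambda>x. Re (R \<zeta> x) + (\<Sum>n\<in>UNIV. S n x))"
      by (rule arg_cong)
    also have "\<dots> \<le> H01_norm D (\<lambda>x. Re (R \<zeta> x)) + H01_norm D (\<lambda>x. \<Sum>n\<in>UNIV. S n x)"
      by (intro H01_norm_triangle sobolev_sum Ss H01_complex_ReIm R)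
    also have "H01_norm D (\<lambda>x. Re (R \<zeta> x)) \<le> H01_complex_norm D (R \<zeta>)" by (rule H01_norm_Re_le)
    also have "H01_norm D (\<lambda>x. \<Sum>n\<in>UNIV. S n x) \<le> (\<Sum>n\<in>UNIV. H01_norm D (S n))"
      by (intro H01_norm_sum_le Ss) auto
    also have "\<dots> \<le> norm (\<zeta> - z) * G"
      unfolding G_def sum_distrib_left by (intro sum_mono S_le)
    finally show ?thesis using \<zeta> by simp
  qed
  have "((\<lambda>\<zeta>. H01_complex_norm D (R \<zeta>) / norm (\<zeta> - z) * norm (\<zeta> - z) + norm (\<zeta> - z) * G)
      \<longlongrightarrow> 0 * norm (z - z) + norm (z - z) * G) (at z)"
    using lim unfolding R_def by (intro tendsto_intros)
  then have lim2: "((\<lambda>\<zeta>. H01_complex_norm D (R \<zeta>) / norm (\<zeta> - z) * norm (\<zeta> - z) + norm (\<zeta> - z) * G) \<longlongrightarrow> 0) (at z)"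
    by simp
  have "\<forall>\<^sub>F \<zeta> in at z. \<zeta> \<in> U \<and> \<zeta> \<noteq> z"
    using U z by (auto simp: eventually_at_topological)
  then have "\<forall>\<^sub>F \<zeta> in at z. norm (H01_norm D (\<lambda>x. Re (w \<zeta> x) - Re (w z x)))
      \<le> H01_complex_norm D (R \<zeta>) / norm (\<zeta> - z) * norm (\<zeta> - z) + norm (\<zeta> - z) * G"
    by eventually_elim (use bound H01_norm_nonneg in auto)
  then show ?thesis by (rule Lim_null_comparison[OF _ lim2])
qed

lemma extension_agrees:
  assumes v: "v \<in> H01_complex D" and w: "w \<in> H01 D"
    and eq: "H01_complex_norm D (\<lambda>x. v x - of_real (w x)) = 0"
  shows "H01_norm D (\<lambda>x. Re (v x) - w x) = 0" "H01_norm D (\<lambda>x. Im (v x)) = 0"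
  using H01_norm_Re_le[of "\<lambda>x. v x - of_real (w x)"] H01_norm_Im_le[of "\<lambda>x. v x - of_real (w x)"] eq
    H01_norm_nonneg[of "\<lambda>x. Re (v x) - w x"] H01_norm_nonneg[of "\<lambda>x. Im (v x)"] by auto

lemma pairing_extension:
  assumes v: "v \<in> H01_complex D" and w: "w \<in> H01 D" and \<psi>: "\<psi> \<in> sobolev D 1"
    and eq: "H01_complex_norm D (\<lambda>x. v x - of_real (w x)) = 0"
  shows "pairing \<psi> v = of_real (H01_inner w \<psi>)"
proof -
  have wc: "(\<lambda>x. of_real (w x)) \<in> H01_complex D"
    using w zero_H01 by (simp add: H01_complex_def)
  have "pairing \<psi> v - pairing \<psi> (\<lambda>x. of_real (w x)) = pairing \<psi> (\<lambda>x. v x - of_real (w x))"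
    by (rule pairing_diff[OF \<psi> v wc, symmetric])
  also have "\<dots> = 0"
    using norm_pairing_le[OF \<psi> H01_complex_diff[OF v wc]] eq by simp
  finally have "pairing \<psi> v = pairing \<psi> (\<lambda>x. of_real (w x))" by simp
  also have "\<dots> = of_real (H01_inner w \<psi>)"
    using \<psi> by (simp add: pairing_def H01_inner_def diffusion_form_zero_left bounded_coeff_const complex_eq_iff)
  finally show ?thesis .
qed

lemma analytic_extension_complex_point:
  fixes w :: "real ^ 'n::finite \<Rightarrow> 'a \<Rightarrow> real"
  assumes "has_analytic_extension D \<gamma> w"
  shows "\<exists>U v. {z. \<forall>n. z $ n \<in> bernstein_region (\<gamma> n)} \<subseteq> U \<and> H01_holomorphic_on D U v \<and>
    (\<forall>y\<in>param_box. H01_complex_norm D (\<lambda>x. v (complex_point y) x - of_real (w y x)) = 0)"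
  using assms unfolding has_analytic_extension_def complex_point_def .

text \<open>Continuity of the parametrized energy norm gives measurability in the parameter, closedness of zero
  sets and the comparison of pointwise values with essential suprema.\<close>

lemma analytic_extension_continuous:
  fixes w :: "real ^ 'n::finite \<Rightarrow> 'a \<Rightarrow> real"
  assumes ext: "has_analytic_extension D \<gamma> w" and \<gamma>: "\<And>n. 1 < \<gamma> n"
    and w: "\<And>y. y \<in> param_box \<Longrightarrow> w y \<in> H01 D"
  shows "continuous_on param_box (\<lambda>y. H01_norm D (w y))"
proof -
  obtain U v where U: "{z. \<forall>n. z $ n \<in> bernstein_region (\<gamma> n)} \<subseteq> U" and hol: "H01_holomorphic_on D U v"
    and eq: "\<And>y. y \<in> param_box \<Longrightarrow> H01_complex_norm D (\<lambda>x. v (complex_point y) x - of_real (w y x)) = 0"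
    using analytic_extension_complex_point[OF ext] by blast
  have pU: "complex_point y \<in> U" if "y \<in> param_box" for y
  proof -
    have "\<forall>n. complex_point y $ n \<in> bernstein_region (\<gamma> n)"
      using that \<gamma> by (blast intro: complex_point_in_polyellipse)
    then show ?thesis using U by blast
  qed
  have vU: "v z \<in> H01_complex D" if "z \<in> U" for z using hol that by (auto simp: H01_holomorphic_on_def)
  have norm_eq: "H01_norm D (w y) = H01_norm D (\<lambda>x. Re (v (complex_point y) x))" if y: "y \<in> param_box" for y
    using H01_norm_triangle_diff[OF H01_complex_ReIm(1)[OF vU[OF pU[OF y]]] H01_sobolev[OF w[OF y]]]
      extension_agrees(1)[OF vU[OF pU[OF y]] w[OF y] eq[OF y]] by simp
  have "continuous_on param_box (\<lambda>y. H01_norm D (\<lambda>x. Re (v (complex_point y) x)))"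
    unfolding continuous_on_def
  proof
    fix y :: "real ^ 'n" assume y: "y \<in> param_box"
    let ?f = "\<lambda>y. H01_norm D (\<lambda>x. Re (v (complex_point y) x))"
    have "filterlim complex_point (at (complex_point y)) (at y within param_box)"
      unfolding filterlim_at
    proof
      show "\<forall>\<^sub>F x in at y within param_box. complex_point x \<in> UNIV \<and> complex_point x \<noteq> complex_point y"
        unfolding eventually_at by (rule exI[of _ 1]) auto
      have "(complex_point \<longlongrightarrow> complex_point y) (at y)"
        unfolding LIM_def by (auto simp: dist_norm complex_point_diff[symmetric] norm_complex_point)
      then show "(complex_point \<longlongrightarrow> complex_point y) (at y within param_box)"
        by (rule tendsto_within_subset) simp
    qed
    from filterlim_compose[OF H01_holomorphic_on_Re_continuous[OF hol pU[OF y]] this]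
    have lim: "((\<lambda>y'. H01_norm D (\<lambda>x. Re (v (complex_point y') x) - Re (v (complex_point y) x))) \<longlongrightarrow> 0) (at y within param_box)" .
    have "\<forall>\<^sub>F y' in at y within param_box. norm (?f y' - ?f y) \<le> H01_norm D (\<lambda>x. Re (v (complex_point y') x) - Re (v (complex_point y) x))"
      unfolding eventually_at
      by (rule exI[of _ 1]) (auto intro!: H01_norm_triangle_diff H01_complex_ReIm vU pU y)
    then have "((\<lambda>y'. ?f y' - ?f y) \<longlongrightarrow> 0) (at y within param_box)"
      by (rule Lim_null_comparison[OF _ lim])
    then show "(?f \<longlongrightarrow> ?f y) (at y within param_box)"
      by (rule LIM_zero_cancel)
  qed
  then show ?thesis by (rule continuous_on_eq) (simp add: norm_eq)
qed

text \<open>Restricting to a complex line replaces holomorphy in several variables by the one-variable notion, for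
  which the identity theorem is available.\<close>

lemma pairing_holomorphic_on_line:
  fixes w :: "complex ^ 'n::finite \<Rightarrow> 'a \<Rightarrow> complex"
  assumes hol: "H01_holomorphic_on D U w" and \<psi>: "\<psi> \<in> sobolev D 1" and d: "d \<noteq> 0"
    and t0: "z0 + (\<chi> n. t0 * d $ n) \<in> U"
  shows "(\<lambda>t. pairing \<psi> (w (z0 + (\<chi> n. t * d $ n)))) field_differentiable (at t0)"
proof -
  define p where "p t = z0 + (\<chi> n. t * d $ n)" for t :: complex
  have pd: "p t - p s = (\<chi> n. (t - s) * d $ n)" for t s
    by (intro Finite_Cartesian_Product.vec_eq_iff[THEN iffD2] allI) (simp add: p_def algebra_simps)
  have norm_pd: "norm (p t - p s) = norm (t - s) * norm d" for t s
    unfolding pd by (simp add: norm_vec_def norm_mult L2_set_right_distrib)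
  have U: "open U" and wU: "\<And>\<zeta>. \<zeta> \<in> U \<Longrightarrow> w \<zeta> \<in> H01_complex D"
    using hol by (auto simp: H01_holomorphic_on_def)
  have z: "p t0 \<in> U" using t0 by (simp add: p_def)
  obtain g where g: "\<And>n. g n \<in> H01_complex D"
    and lim: "((\<lambda>\<zeta>. H01_complex_norm D (\<lambda>x. w \<zeta> x - w (p t0) x - (\<Sum>n\<in>UNIV. (\<zeta> $ n - p t0 $ n) * g n x))
               / norm (\<zeta> - p t0)) \<longlongrightarrow> 0) (at (p t0))"
    using hol z unfolding H01_holomorphic_on_def by blast
  define R where "R \<zeta> x = w \<zeta> x - w (p t0) x - (\<Sum>n\<in>UNIV. (\<zeta> $ n - p t0 $ n) * g n x)" for \<zeta> x
  define L where "L = (\<Sum>n\<in>UNIV. d $ n * pairing \<psi> (g n))"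
  have p_cont: "(p \<longlongrightarrow> p t0) (at t0)"
  proof -
    have "((\<lambda>t. norm (t - t0) * norm d) \<longlongrightarrow> norm (t0 - t0) * norm d) (at t0)" by (intro tendsto_intros)
    then have "((\<lambda>t. norm (p t - p t0)) \<longlongrightarrow> 0) (at t0)" by (simp add: norm_pd)
    then show ?thesis by (rule LIM_zero_cancel[OF tendsto_norm_zero_cancel])
  qed
  have p_lim: "filterlim p (at (p t0)) (at t0)"
    unfolding filterlim_at
  proof
    have "p t \<noteq> p t0" if "t \<noteq> t0" for t
      using norm_pd[of t t0] that d by auto
    then show "\<forall>\<^sub>F t in at t0. p t \<in> UNIV \<and> p t \<noteq> p t0"
      unfolding eventually_at by (intro exI[of _ 1]) auto
  qed (rule p_cont)
  from filterlim_compose[OF lim p_lim]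
  have lim2: "((\<lambda>t. H01_complex_norm D (R (p t)) / norm (p t - p t0)) \<longlongrightarrow> 0) (at t0)"
    unfolding R_def .
  have "((\<lambda>t. H01_complex_norm D (R (p t)) / norm (p t - p t0) * (norm d * H01_norm D \<psi>)) \<longlongrightarrow> 0 * (norm d * H01_norm D \<psi>)) (at t0)"
    by (intro tendsto_mult_right lim2)
  then have lim3: "((\<lambda>t. H01_complex_norm D (R (p t)) / norm (p t - p t0) * (norm d * H01_norm D \<psi>)) \<longlongrightarrow> 0) (at t0)"
    by simp
  have quot: "norm ((pairing \<psi> (w (p t)) - pairing \<psi> (w (p t0))) / (t - t0) - L)
      \<le> H01_complex_norm D (R (p t)) / norm (p t - p t0) * (norm d * H01_norm D \<psi>)"
    if t: "p t \<in> U" "t \<noteq> t0" for t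
  proof -
    have sumH: "(\<lambda>x. \<Sum>n\<in>UNIV. (p t $ n - p t0 $ n) * g n x) \<in> H01_complex D"
      by (intro H01_complex_sum H01_complex_scale g)
    have RH: "R (p t) \<in> H01_complex D"
      unfolding R_def by (intro H01_complex_diff sumH wU t z)
    have "pairing \<psi> (\<lambda>x. \<Sum>n\<in>UNIV. (p t $ n - p t0 $ n) * g n x) = (t - t0) * L"
    proof -
      have "p t $ n - p t0 $ n = (t - t0) * d $ n" for n
        using arg_cong[OF pd[of t t0], of "\<lambda>v. v $ n"] by simp
      then show ?thesis
        using \<psi> g by (simp add: pairing_sum H01_complex_scale pairing_scale L_def sum_distrib_left mult.assoc)
    qed
    then have "pairing \<psi> (R (p t)) = pairing \<psi> (w (p t)) - pairing \<psi> (w (p t0)) - (t - t0) * L"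
      unfolding R_def using pairing_diff[OF \<psi> H01_complex_diff[OF wU[OF t(1)] wU[OF z]] sumH]
        pairing_diff[OF \<psi> wU[OF t(1)] wU[OF z]] by simp
    then have "(pairing \<psi> (w (p t)) - pairing \<psi> (w (p t0))) / (t - t0) - L = pairing \<psi> (R (p t)) / (t - t0)"
      using t(2) by (simp add: field_simps)
    also have "norm \<dots> \<le> H01_complex_norm D (R (p t)) * H01_norm D \<psi> / norm (t - t0)"
      unfolding norm_divide by (intro divide_right_mono norm_pairing_le \<psi> RH) simp
    also have "\<dots> = H01_complex_norm D (R (p t)) / norm (p t - p t0) * (norm d * H01_norm D \<psi>)"
      using d t(2) by (simp add: norm_pd)
    finally show ?thesis .
  qed
  have "\<forall>\<^sub>F t in at t0. p t \<in> U"
    using p_cont U z by (rule topological_tendstoD)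
  moreover have "\<forall>\<^sub>F t in at t0. t \<noteq> t0" by (simp add: eventually_neq_at_within)
  ultimately have "\<forall>\<^sub>F t in at t0. norm ((pairing \<psi> (w (p t)) - pairing \<psi> (w (p t0))) / (t - t0) - L)
      \<le> H01_complex_norm D (R (p t)) / norm (p t - p t0) * (norm d * H01_norm D \<psi>)"
    by eventually_elim (use quot in auto)
  then have "((\<lambda>t. (pairing \<psi> (w (p t)) - pairing \<psi> (w (p t0))) / (t - t0) - L) \<longlongrightarrow> 0) (at t0)"
    by (rule Lim_null_comparison[OF _ lim3])
  then have "((\<lambda>t. (pairing \<psi> (w (p t)) - pairing \<psi> (w (p t0))) / (t - t0)) \<longlongrightarrow> L) (at t0)"
    by (rule LIM_zero_cancel)
  then have "((\<lambda>t. pairing \<psi> (w (p t))) has_field_derivative L) (at t0)"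
    by (simp add: has_field_derivative_iff)
  then show ?thesis
    unfolding p_def field_differentiable_def by blast
qed

text \<open>Pair the solution on the segment from \<open>y0\<close> to \<open>y0 + d\<close> with \<open>w y0\<close> itself. This holomorphic function of one
  variable has infinitely many zeros in a compact interval, so it vanishes identically; its value at
  \<open>0\<close> is the square of the norm of \<open>w y0\<close>.\<close>

lemma analytic_zero_along_ray:
  fixes w :: "real ^ 'n::finite \<Rightarrow> 'a \<Rightarrow> real"
  assumes ext: "has_analytic_extension D \<gamma> w" and \<gamma>: "\<And>n. 1 < \<gamma> n"
    and w: "\<And>y. y \<in> param_box \<Longrightarrow> w y \<in> H01 D"
    and y0: "y0 \<in> param_box" "y0 + d \<in> param_box"
    and T: "infinite T" "T \<subseteq> {0..1}" "\<And>t. t \<in> T \<Longrightarrow> H01_norm D (w (y0 + t *\<^sub>R d)) = 0"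
  shows "H01_norm D (w y0) = 0"
proof (cases "d = 0")
  case True
  with T show ?thesis using infinite_imp_nonempty by fastforce
next
  case False
  obtain U v where U: "{z. \<forall>n. z $ n \<in> bernstein_region (\<gamma> n)} \<subseteq> U" and hol: "H01_holomorphic_on D U v"
    and eq: "\<And>y. y \<in> param_box \<Longrightarrow> H01_complex_norm D (\<lambda>x. v (complex_point y) x - of_real (w y x)) = 0"
    using analytic_extension_complex_point[OF ext] by blast
  have pU: "complex_point y \<in> U" if "y \<in> param_box" for y
  proof -
    have "\<forall>n. complex_point y $ n \<in> bernstein_region (\<gamma> n)"
      using that \<gamma> by (blast intro: complex_point_in_polyellipse)
    then show ?thesis using U by blast
  qed
  have vU: "v z \<in> H01_complex D" if "z \<in> U" for z using hol that by (auto simp: H01_holomorphic_on_def)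
  define p where "p t = complex_point y0 + (\<chi> n. t * complex_point d $ n)" for t :: complex
  define \<psi> where "\<psi> = w y0"
  have \<psi>: "\<psi> \<in> sobolev D 1" unfolding \<psi>_def by (rule H01_sobolev[OF w[OF y0(1)]])
  have d0: "complex_point d \<noteq> 0" using False norm_complex_point[of d] by auto
  have p_real: "p (of_real t) = complex_point (y0 + t *\<^sub>R d)" for t
    by (intro Finite_Cartesian_Product.vec_eq_iff[THEN iffD2] allI) (simp add: p_def complex_point_def)
  have seg: "y0 + t *\<^sub>R d \<in> param_box" if "t \<in> {0..1}" for t
  proof -
    have "(1 - t) *\<^sub>R y0 + t *\<^sub>R (y0 + d) \<in> param_box"
      using that y0 convex_param_box by (intro convexD) auto
    then show ?thesis by (simp add: algebra_simps)
  qed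
  define W where "W = p -` U"
  have "continuous_on UNIV p"
    unfolding p_def by (intro continuous_intros continuous_on_vec_lambda)
  then have W: "open W"
    unfolding W_def using hol by (intro open_vimage) (auto simp: H01_holomorphic_on_def)
  define I where "I = complex_of_real ` {0..1}"
  have I: "I \<subseteq> W" using seg pU by (auto simp: I_def W_def p_real)
  have conI: "connected I" unfolding I_def by (intro connected_continuous_image continuous_intros) auto
  have compI: "compact I" unfolding I_def by (intro compact_continuous_image continuous_intros) auto
  define C where "C = connected_component_set W 0"
  have C: "open C" "connected C" "C \<subseteq> W"
    unfolding C_def by (simp_all add: open_connected_component W connected_component_subset)
  have "0 \<in> I" by (auto simp: I_def)
  then have IC: "I \<subseteq> C"
    unfolding C_def by (rule connected_component_maximal[OF _ conI I])
  define G where "G t = pairing \<psi> (v (p t))" for t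
  have holG: "G holomorphic_on C"
    unfolding holomorphic_on_def
  proof
    fix t assume "t \<in> C"
    then have "p t \<in> U" using C(3) by (auto simp: W_def)
    then have "G field_differentiable (at t)"
      unfolding G_def p_def using pairing_holomorphic_on_line[OF hol \<psi> d0] by blast
    then show "G field_differentiable (at t within C)"
      by (rule field_differentiable_at_within)
  qed
  have G_real: "G (of_real t) = of_real (H01_inner (w (y0 + t *\<^sub>R d)) \<psi>)" if "t \<in> {0..1}" for t
    unfolding G_def p_real by (rule pairing_extension[OF vU[OF pU] w \<psi> eq]) (use seg[OF that] in auto)
  have "inj_on complex_of_real T" by (simp add: inj_on_def)
  then have "infinite (complex_of_real ` T)" using T(1) finite_imageD by blast
  moreover have TI: "complex_of_real ` T \<subseteq> I" using T(2) by (auto simp: I_def)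
  ultimately obtain \<xi> where \<xi>: "\<xi> \<in> I" "\<xi> islimpt (complex_of_real ` T)"
    using compI unfolding compact_eq_Bolzano_Weierstrass by blast
  have "G 0 = 0"
  proof (rule analytic_continuation[OF holG C(1,2)])
    show "complex_of_real ` T \<subseteq> C" using TI IC by blast
    show "\<xi> \<in> C" using \<xi>(1) IC by blast
    show "\<xi> islimpt complex_of_real ` T" by (rule \<xi>(2))
    show "0 \<in> C" using IC by (auto simp: I_def)
    fix z assume "z \<in> complex_of_real ` T"
    then obtain t where t: "t \<in> T" "z = of_real t" by auto
    then have t01: "t \<in> {0..1}" using T(2) by auto
    have "\<bar>H01_inner (w (y0 + t *\<^sub>R d)) \<psi>\<bar> \<le> 0"
      using H01_Cauchy_Schwarz[OF H01_sobolev[OF w[OF seg[OF t01]]] \<psi>] T(3)[OF t(1)] by simp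
    then show "G z = 0" using G_real[OF t01] t(2) by simp
  qed
  then have "H01_inner \<psi> \<psi> = 0" using G_real[of 0] by (simp add: \<psi>_def)
  then show ?thesis by (simp add: H01_inner_self \<psi>_def)
qed

end

text \<open>Infinitely many dilates of \<open>E\<close> about \<open>y0\<close>, by factors between \<open>1\<close> and \<open>2\<close>, lie in one ball, and each has at
  least the positive measure of \<open>E\<close>. So some point lies in infinitely many of them (the upper limit of
  the sets has positive measure), and the ray through this point meets \<open>E\<close> infinitely often.\<close>

lemma ray_meets_infinitely_often:
  fixes E :: "'b::euclidean_space set"
  assumes E: "closed E" "bounded E" "\<not> negligible E"
  shows "\<exists>d T. infinite T \<and> T \<subseteq> {0..1} \<and> y0 + d \<in> E \<and> (\<forall>t\<in>T. y0 + t *\<^sub>R d \<in> E)"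
proof -
  \<comment> \<open>These numbers decrease, so that all ratios to an earlier one stay in \<open>[0, 1]\<close>.\<close>
  define t where "t k = (1 + inverse (real (Suc k))) / 2" for k
  have t: "0 < t k" "t k \<le> 1" "1 / 2 < t k" for k
    by (auto simp: t_def divide_simps)
  have t_less: "t k < t j" if "j < k" for j k
  proof -
    have "inverse (real (Suc k)) < inverse (real (Suc j))"
      using that by (intro less_imp_inverse_less) auto
    then show ?thesis by (simp add: t_def)
  qed
  define F where "F k = {p. y0 + t k *\<^sub>R p \<in> E}" for k
  have F_closed: "closed (F k)" for k
  proof -
    have "F k = (\<lambda>p. y0 + t k *\<^sub>R p) -` E" by (auto simp: F_def)
    then show ?thesis using E(1) by (auto intro!: continuous_closed_vimage continuous_intros)
  qed
  obtain B where B: "\<And>x. x \<in> E \<Longrightarrow> norm x \<le> B" using E(2) by (auto simp: bounded_iff)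
  have F_bound: "norm p \<le> 2 * (B + norm y0)" if "p \<in> F k" for p k
  proof -
    have "norm (y0 + t k *\<^sub>R p) \<le> B" using that B by (auto simp: F_def)
    then have "t k * norm p \<le> B + norm y0"
      using norm_triangle_ineq2[of "t k *\<^sub>R p" "- y0"] t(1)[of k] by (simp add: add.commute)
    then have "2 * (t k * norm p) \<le> 2 * (B + norm y0)" by simp
    moreover have "1 * norm p \<le> (2 * t k) * norm p"
      using t(3)[of k] by (intro mult_right_mono) auto
    ultimately show ?thesis by (simp add: mult.assoc)
  qed
  define \<mu> where "\<mu> = emeasure lebesgue E"
  have \<mu>: "\<mu> > 0"
    using E(1,3) by (auto simp: \<mu>_def negligible_iff_null_sets null_sets_def zero_less_iff_neq_zero)
  have F_meas: "\<mu> \<le> emeasure lebesgue (F k)" for k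
  proof -
    have "F k = (\<lambda>x. (1 / t k) *\<^sub>R x + (- (1 / t k) *\<^sub>R y0)) ` E"
    proof safe
      fix p assume "p \<in> F k"
      then show "p \<in> (\<lambda>x. (1 / t k) *\<^sub>R x + (- (1 / t k) *\<^sub>R y0)) ` E"
        using t(1)[of k] by (intro image_eqI[of _ _ "y0 + t k *\<^sub>R p"]) (auto simp: F_def scaleR_add_right)
    next
      fix x assume "x \<in> E"
      moreover have "y0 + t k *\<^sub>R ((1 / t k) *\<^sub>R x + (- (1 / t k) *\<^sub>R y0)) = x"
        using t(1)[of k] by (simp add: scaleR_diff_right)
      ultimately show "(1 / t k) *\<^sub>R x + (- (1 / t k) *\<^sub>R y0) \<in> F k"
        by (simp only: F_def mem_Collect_eq)
    qed
    then have "emeasure lebesgue (F k) = \<bar>1 / t k\<bar> ^ DIM('b) * \<mu>"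
      by (simp only: emeasure_lebesgue_affine \<mu>_def)
    moreover have "1 \<le> \<bar>1 / t k\<bar> ^ DIM('b)"
      using t(1,2)[of k] by (intro one_le_power) simp
    ultimately show ?thesis
      using mult_right_mono[of 1 "ennreal (\<bar>1 / t k\<bar> ^ DIM('b))" \<mu>] by (simp add: ennreal_ge_1)
  qed
  define H where "H n = (\<Union>k\<in>{n..}. F k)" for n
  have H_sets: "H n \<in> sets lebesgue" for n
    unfolding H_def using F_closed by (intro sets.countable_UN'') auto
  have "decseq H" unfolding decseq_def H_def by (intro allI impI UN_mono) auto
  moreover have "emeasure lebesgue (H n) \<noteq> \<infinity>" for n
  proof -
    have "H n \<subseteq> cball 0 (2 * (B + norm y0))" using F_bound by (auto simp: H_def)
    then have "emeasure lebesgue (H n) \<le> emeasure lebesgue (cball 0 (2 * (B + norm y0)) :: 'b set)"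
      by (intro emeasure_mono) auto
    also have "\<dots> < \<infinity>" using emeasure_lborel_cball_finite by simp
    finally show ?thesis by simp
  qed
  ultimately have "(INF n. emeasure lebesgue (H n)) = emeasure lebesgue (\<Inter>n. H n)"
    using H_sets by (intro INF_emeasure_decseq) auto
  moreover have "\<mu> \<le> (INF n. emeasure lebesgue (H n))"
  proof (rule INF_greatest)
    fix n
    have "emeasure lebesgue (F n) \<le> emeasure lebesgue (H n)"
      using H_sets by (intro emeasure_mono) (auto simp: H_def)
    then show "\<mu> \<le> emeasure lebesgue (H n)" using F_meas order_trans by blast
  qed
  ultimately have "emeasure lebesgue (\<Inter>n. H n) \<noteq> 0" using \<mu> by auto
  then have "(\<Inter>n. H n) \<noteq> {}" by (intro notI) simp
  then obtain p where p: "p \<in> (\<Inter>n. H n)" by blast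
  define K where "K = {k. p \<in> F k}"
  have "\<exists>k\<ge>n. k \<in> K" for n using p by (auto simp: H_def K_def)
  then have K: "infinite K" by (simp add: infinite_nat_iff_unbounded_le)
  then obtain k0 where k0: "k0 \<in> K" using infinite_imp_nonempty by blast
  define K' where "K' = {k \<in> K. k0 < k}"
  have "K \<subseteq> K' \<union> {..k0}" by (auto simp: K'_def)
  then have "finite K" if "finite K'"
    by (rule finite_subset) (use that in simp)
  with K have K': "infinite K'" by blast
  show ?thesis
  proof (intro exI[of _ "t k0 *\<^sub>R p"] exI[of _ "(\<lambda>k. t k / t k0) ` K'"] conjI ballI)
    have "inj_on (\<lambda>k. t k / t k0) K'"
    proof (rule inj_onI)
      fix a b assume "t a / t k0 = t b / t k0"
      then have "t a = t b" using t(1)[of k0] by simp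
      then show "a = b" using t_less[of a b] t_less[of b a] by (cases a b rule: linorder_cases) auto
    qed
    then show "infinite ((\<lambda>k. t k / t k0) ` K')" using K' by (simp add: finite_image_iff)
    show "(\<lambda>k. t k / t k0) ` K' \<subseteq> {0..1}"
    proof safe
      fix k assume "k \<in> K'"
      then have "t k < t k0" by (simp add: K'_def t_less)
      then show "t k / t k0 \<in> {0..1}"
        using t(1)[of k] t(1)[of k0] by simp
    qed
    show "y0 + t k0 *\<^sub>R p \<in> E" using k0 by (auto simp: K_def F_def)
    fix s assume "s \<in> (\<lambda>k. t k / t k0) ` K'"
    then show "y0 + s *\<^sub>R t k0 *\<^sub>R p \<in> E"
      using t(1)[of k0] by (auto simp: K'_def K_def F_def)
  qed
qed

context bounded_open_set
begin

text \<open>An identity theorem in several variables: a zero set of positive measure is met infinitely often by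
  some ray from any given point \<open>y0\<close>.\<close>

lemma analytic_identity:
  fixes w :: "real ^ 'n::finite \<Rightarrow> 'a \<Rightarrow> real"
  assumes ext: "has_analytic_extension D \<gamma> w" and \<gamma>: "\<And>n. 1 < \<gamma> n"
    and w: "\<And>y. y \<in> param_box \<Longrightarrow> w y \<in> H01 D"
    and pos: "\<not> negligible {y \<in> param_box. H01_norm D (w y) = 0}"
    and y0: "y0 \<in> param_box"
  shows "H01_norm D (w y0) = 0"
proof -
  define E where "E = {y \<in> param_box. H01_norm D (w y) = 0}"
  have closed: "closed E"
    unfolding E_def
    by (rule continuous_closed_preimage_constant[OF analytic_extension_continuous[OF ext \<gamma> w]
          compact_imp_closed[OF compact_param_box]])
  have bounded: "bounded E"
    unfolding E_def by (rule bounded_subset[OF compact_imp_bounded[OF compact_param_box]]) auto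
  have "\<not> negligible E" unfolding E_def by (rule pos)
  from ray_meets_infinitely_often[OF closed bounded this, of y0]
  obtain d T where T: "infinite T" "T \<subseteq> {0..1}" "y0 + d \<in> E" "\<forall>t\<in>T. y0 + t *\<^sub>R d \<in> E"
    by (elim exE conjE)
  have d: "y0 + d \<in> param_box" using T(3) by (simp add: E_def)
  have "H01_norm D (w (y0 + t *\<^sub>R d)) = 0" if "t \<in> T" for t
    using bspec[OF T(4) that] by (simp add: E_def)
  from analytic_zero_along_ray[OF ext \<gamma> w y0 d T(1,2) this] show ?thesis .
qed

end

section \<open>Condition numbers of coercive matrices\<close>

lemma scalar_prod_real:
  "v \<in> carrier_vec n \<Longrightarrow> w \<in> carrier_vec n \<Longrightarrow> scalar_prod v w = (\<Sum>i<n. vec_index v i * vec_index w i)"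
  by (auto simp: scalar_prod_def atLeast0LessThan)

lemma vec_norm_L2_set: "v \<in> carrier_vec n \<Longrightarrow> vec_norm v = L2_set (vec_index v) {..<n}"
  by (simp add: vec_norm_def scalar_prod_real[of v n v] L2_set_def power2_eq_square)

lemma vec_norm_nonneg: "v \<in> carrier_vec n \<Longrightarrow> 0 \<le> vec_norm v"
  by (simp add: vec_norm_L2_set)

lemma scalar_prod_self: "v \<in> carrier_vec n \<Longrightarrow> scalar_prod v v = (vec_norm v)\<^sup>2"
  by (simp add: vec_norm_L2_set L2_set_def scalar_prod_real[of v n v] sum_nonneg power2_eq_square)

lemma vec_norm_eq_0_iff: "v \<in> carrier_vec n \<Longrightarrow> vec_norm v = 0 \<longleftrightarrow> v = 0\<^sub>v n"
  by (auto simp: vec_norm_L2_set L2_set_eq_0_iff Matrix.vec_eq_iff)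

lemma vec_norm_smult: "v \<in> carrier_vec n \<Longrightarrow> vec_norm (c \<cdot>\<^sub>v v) = \<bar>c\<bar> * vec_norm v"
  by (simp add: vec_norm_L2_set L2_set_def power_mult_distrib sum_distrib_left[symmetric] real_sqrt_mult)

lemma scalar_prod_Cauchy_Schwarz:
  assumes v: "v \<in> carrier_vec n" and w: "w \<in> carrier_vec n"
  shows "\<bar>scalar_prod v w\<bar> \<le> vec_norm v * vec_norm w"
proof -
  have "\<bar>scalar_prod v w\<bar> \<le> (\<Sum>i<n. \<bar>vec_index v i\<bar> * \<bar>vec_index w i\<bar>)"
    unfolding scalar_prod_real[OF v w] abs_mult[symmetric] by (rule sum_abs)
  also have "\<dots> \<le> vec_norm v * vec_norm w"
    unfolding vec_norm_L2_set[OF v] vec_norm_L2_set[OF w] by (rule L2_set_mult_ineq)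
  finally show ?thesis .
qed

text \<open>The factor \<open>n\<^sup>2\<close> is far from sharp. Only a bound is needed that depends on the size of the entries, since it
  serves to show that a supremum of condition numbers is finite.\<close>

lemma vec_norm_mult_mat_le:
  assumes A: "A \<in> carrier_mat n n" and C: "\<And>i j. i < n \<Longrightarrow> j < n \<Longrightarrow> \<bar>A $$ (i, j)\<bar> \<le> C" and v: "v \<in> carrier_vec n"
  shows "vec_norm (A *\<^sub>v v) \<le> real n * real n * C * vec_norm v"
proof -
  have Av: "A *\<^sub>v v \<in> carrier_vec n" using A v by (rule mult_mat_vec_carrier)
  have entry: "\<bar>vec_index (A *\<^sub>v v) i\<bar> \<le> real n * C * vec_norm v" if i: "i < n" for i
  proof -
    have C0: "0 \<le> C" using C[OF i i] by linarith
    have "vec_index (A *\<^sub>v v) i = (\<Sum>j<n. A $$ (i, j) * vec_index v j)"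
      using A v i by (simp add: scalar_prod_def atLeast0LessThan)
    also have "\<bar>\<dots>\<bar> \<le> (\<Sum>j<n. \<bar>A $$ (i, j) * vec_index v j\<bar>)" by (rule sum_abs)
    also have "\<dots> \<le> (\<Sum>j<n. C * vec_norm v)"
    proof (rule sum_mono)
      fix j assume j: "j \<in> {..<n}"
      have "\<bar>vec_index v j\<bar> \<le> L2_set (\<lambda>j. \<bar>vec_index v j\<bar>) {..<n}"
        by (rule member_le_L2_set[OF _ j]) simp
      then have "\<bar>vec_index v j\<bar> \<le> vec_norm v"
        using v by (simp add: vec_norm_L2_set L2_set_def)
      with C[OF i] j C0 show "\<bar>A $$ (i, j) * vec_index v j\<bar> \<le> C * vec_norm v"
        unfolding abs_mult by (intro mult_mono) auto
    qed
    finally show ?thesis by simp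
  qed
  have "vec_norm (A *\<^sub>v v) \<le> (\<Sum>i<n. \<bar>vec_index (A *\<^sub>v v) i\<bar>)"
    unfolding vec_norm_L2_set[OF Av] by (rule L2_set_le_sum_abs)
  also have "\<dots> \<le> (\<Sum>i<n. real n * C * vec_norm v)"
    by (intro sum_mono entry) auto
  finally show ?thesis by simp
qed

lemma mat_norm_le:
  assumes A: "A \<in> carrier_mat n n" and K: "0 \<le> K" "\<And>v. v \<in> carrier_vec n \<Longrightarrow> vec_norm (A *\<^sub>v v) \<le> K * vec_norm v"
  shows "mat_norm A \<le> K"
  unfolding mat_norm_def
proof (rule cSup_least)
  have "vec_norm (0\<^sub>v n) \<le> 1"
    using vec_norm_eq_0_iff[of "0\<^sub>v n :: real Matrix.vec" n] by simp
  then have "vec_norm (A *\<^sub>v 0\<^sub>v n) \<in> {vec_norm (A *\<^sub>v v) | v. v \<in> carrier_vec (dim_col A) \<and> vec_norm v \<le> 1}"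
    using A by (intro CollectI exI[of _ "0\<^sub>v n"]) auto
  then show "{vec_norm (A *\<^sub>v v) | v. v \<in> carrier_vec (dim_col A) \<and> vec_norm v \<le> 1} \<noteq> {}" by blast
  fix r assume "r \<in> {vec_norm (A *\<^sub>v v) | v. v \<in> carrier_vec (dim_col A) \<and> vec_norm v \<le> 1}"
  then obtain v where v: "r = vec_norm (A *\<^sub>v v)" "v \<in> carrier_vec n" "vec_norm v \<le> 1" using A by auto
  then show "r \<le> K" using K(2)[OF v(2)] mult_left_mono[OF v(3) K(1)] by simp
qed

lemma mat_norm_bound:
  assumes A: "A \<in> carrier_mat n n" and v: "v \<in> carrier_vec n"
  shows "vec_norm (A *\<^sub>v v) \<le> mat_norm A * vec_norm v"
proof (cases "v = 0\<^sub>v n")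
  case True
  have "A *\<^sub>v 0\<^sub>v n = 0\<^sub>v n" using A by auto
  then show ?thesis using True vec_norm_eq_0_iff[of "0\<^sub>v n :: real Matrix.vec" n] by simp
next
  case False
  define C where "C = (\<Sum>i<n. \<Sum>j<n. \<bar>A $$ (i, j)\<bar>)"
  have C: "\<bar>A $$ (i, j)\<bar> \<le> C" if "i < n" "j < n" for i j
  proof -
    have "\<bar>A $$ (i, j)\<bar> \<le> (\<Sum>j<n. \<bar>A $$ (i, j)\<bar>)"
      using that member_le_sum[of j "{..<n}" "\<lambda>j. \<bar>A $$ (i, j)\<bar>"] by simp
    also have "\<dots> \<le> C"
      unfolding C_def using that member_le_sum[of i "{..<n}" "\<lambda>i. \<Sum>j<n. \<bar>A $$ (i, j)\<bar>"] by (simp add: sum_nonneg)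
    finally show ?thesis .
  qed
  have C0: "0 \<le> C" unfolding C_def by (intro sum_nonneg) auto
  let ?S = "{vec_norm (A *\<^sub>v v) | v. v \<in> carrier_vec (dim_col A) \<and> vec_norm v \<le> 1}"
  have "bdd_above ?S"
  proof (rule bdd_aboveI[where M = "real n * real n * C"])
    fix r assume "r \<in> ?S"
    then obtain w where w: "r = vec_norm (A *\<^sub>v w)" "w \<in> carrier_vec n" "vec_norm w \<le> 1" using A by auto
    have "r \<le> real n * real n * C * vec_norm w"
      unfolding w(1) by (rule vec_norm_mult_mat_le[OF A C w(2)])
    also have "\<dots> \<le> real n * real n * C * 1"
      using w(3) C0 by (intro mult_left_mono) auto
    finally show "r \<le> real n * real n * C" by simp
  qed
  moreover define w where "w = (1 / vec_norm v) \<cdot>\<^sub>v v"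
  have pos: "0 < vec_norm v" using False vec_norm_eq_0_iff[OF v] vec_norm_nonneg[OF v] by simp
  have w: "w \<in> carrier_vec n" "vec_norm w = 1"
    using v pos by (auto simp: w_def vec_norm_smult)
  ultimately have "vec_norm (A *\<^sub>v w) \<le> mat_norm A"
    unfolding mat_norm_def using A by (intro cSup_upper) auto
  moreover have "A *\<^sub>v w = (1 / vec_norm v) \<cdot>\<^sub>v (A *\<^sub>v v)"
    unfolding w_def by (rule mult_mat_vec[OF A v])
  moreover have "A *\<^sub>v v \<in> carrier_vec n" using A v by (rule mult_mat_vec_carrier)
  ultimately show ?thesis
    using pos by (simp add: vec_norm_smult field_simps)
qed

text \<open>This identifies the value of \<open>mat_inverse\<close>, computed by Gauss-Jordan elimination, as a right inverse.\<close>

lemma invertible_if_injective: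
  fixes A :: "real mat"
  assumes A: "A \<in> carrier_mat n n" and inj: "\<And>v. v \<in> carrier_vec n \<Longrightarrow> A *\<^sub>v v = 0\<^sub>v n \<Longrightarrow> v = 0\<^sub>v n"
  shows "the (mat_inverse A) \<in> carrier_mat n n" "A * the (mat_inverse A) = 1\<^sub>m n"
proof -
  have "det A \<noteq> 0" using inj det_0_iff_vec_prod_zero_field[OF A] by blast
  then have "A \<in> Units (ring_mat TYPE(real) n ())" by (rule det_non_zero_imp_unit[OF A])
  then obtain B where "mat_inverse A = Some B" using mat_inverse(1)[OF A, of "()"] by (cases "mat_inverse A") auto
  with mat_inverse(2)[OF A this]
  show "the (mat_inverse A) \<in> carrier_mat n n" "A * the (mat_inverse A) = 1\<^sub>m n" by auto
qed

text \<open>With \<open>x\<close> the solution of \<open>A x = v\<close>, coercivity and the Cauchy-Schwarz inequality give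
  \<open>l * |x|\<^sup>2 \<le> x \<cdot> v \<le> |x| * |v|\<close>.\<close>

lemma coercive_mat_inverse_bound:
  fixes A :: "real mat"
  assumes A: "A \<in> carrier_mat n n" and l: "0 < l"
    and coercive: "\<And>v. v \<in> carrier_vec n \<Longrightarrow> l * (vec_norm v)\<^sup>2 \<le> scalar_prod v (A *\<^sub>v v)"
  shows "the (mat_inverse A) \<in> carrier_mat n n" "A * the (mat_inverse A) = 1\<^sub>m n"
    "mat_norm (the (mat_inverse A)) \<le> 1 / l"
proof -
  have inj: "v = 0\<^sub>v n" if v: "v \<in> carrier_vec n" "A *\<^sub>v v = 0\<^sub>v n" for v
  proof -
    have "l * (vec_norm v)\<^sup>2 \<le> 0" using coercive[OF v(1)] v by simp
    then have "vec_norm v = 0" using l by (simp add: mult_le_0_iff)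
    then show ?thesis using vec_norm_eq_0_iff[OF v(1)] by simp
  qed
  note B = invertible_if_injective[OF A inj]
  show "the (mat_inverse A) \<in> carrier_mat n n" "A * the (mat_inverse A) = 1\<^sub>m n" by (rule B, assumption+)+
  let ?B = "the (mat_inverse A)"
  note B = \<open>?B \<in> carrier_mat n n\<close> \<open>A * ?B = 1\<^sub>m n\<close>
  show "mat_norm ?B \<le> 1 / l"
  proof (rule mat_norm_le[OF B(1)])
    fix v :: "real Matrix.vec" assume v: "v \<in> carrier_vec n"
    have Bv: "?B *\<^sub>v v \<in> carrier_vec n" using B(1) v by (rule mult_mat_vec_carrier)
    have "A *\<^sub>v (?B *\<^sub>v v) = v"
      using assoc_mult_mat_vec[OF A B(1) v] B(2) v by simp
    then have "l * (vec_norm (?B *\<^sub>v v))\<^sup>2 \<le> scalar_prod (?B *\<^sub>v v) v"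
      using coercive[OF Bv] by simp
    also have "\<dots> \<le> vec_norm (?B *\<^sub>v v) * vec_norm v"
      using scalar_prod_Cauchy_Schwarz[OF Bv v] by linarith
    finally have *: "(l * vec_norm (?B *\<^sub>v v)) * vec_norm (?B *\<^sub>v v) \<le> vec_norm v * vec_norm (?B *\<^sub>v v)"
      by (simp add: power2_eq_square mult_ac)
    have "l * vec_norm (?B *\<^sub>v v) \<le> vec_norm v"
    proof (cases "vec_norm (?B *\<^sub>v v) = 0")
      case True
      then show ?thesis using vec_norm_nonneg[OF v] by simp
    next
      case False
      then show ?thesis using * vec_norm_nonneg[OF Bv] by simp
    qed
    then show "vec_norm (?B *\<^sub>v v) \<le> 1 / l * vec_norm v" using l by (simp add: field_simps)
  qed (use l in simp)
qed

text \<open>The lower bound is \<open>|e| = |A (B e)| \<le> |A| * |B|\<close> for a unit vector \<open>e\<close> and the inverse \<open>B\<close>.\<close>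

lemma cond_number_bounds:
  fixes A :: "real mat"
  assumes A: "A \<in> carrier_mat n n" and n: "1 \<le> n" and K: "0 \<le> K" and l: "0 < l"
    and bounded: "\<And>v. v \<in> carrier_vec n \<Longrightarrow> vec_norm (A *\<^sub>v v) \<le> K * vec_norm v"
    and coercive: "\<And>v. v \<in> carrier_vec n \<Longrightarrow> l * (vec_norm v)\<^sup>2 \<le> scalar_prod v (A *\<^sub>v v)"
  shows "1 \<le> cond_number A" "cond_number A \<le> K / l"
proof -
  let ?B = "the (mat_inverse A)"
  note B = coercive_mat_inverse_bound[OF A l coercive]
  have B1: "?B \<in> carrier_mat n n" and B2: "A * ?B = 1\<^sub>m n" and B3: "mat_norm ?B \<le> 1 / l"
    by (rule B, assumption)+
  define e :: "real Matrix.vec" where "e = unit_vec n 0"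
  have e: "e \<in> carrier_vec n" "vec_norm e = 1"
    using n by (auto simp: e_def vec_norm_def)
  have Be: "?B *\<^sub>v e \<in> carrier_vec n" using B1 e(1) by (rule mult_mat_vec_carrier)
  have Be_le: "vec_norm (?B *\<^sub>v e) \<le> mat_norm ?B" using mat_norm_bound[OF B1 e(1)] e(2) by simp
  have e_le: "1 \<le> mat_norm A * vec_norm (?B *\<^sub>v e)"
    using mat_norm_bound[OF A Be] assoc_mult_mat_vec[OF A B1 e(1)] B2 e by simp
  have "vec_norm (A *\<^sub>v e) \<le> mat_norm A" using mat_norm_bound[OF A e(1)] e(2) by simp
  then have A0: "0 \<le> mat_norm A"
    using vec_norm_nonneg[OF mult_mat_vec_carrier[OF A e(1)]] by linarith
  have B0: "0 \<le> mat_norm ?B" using Be_le vec_norm_nonneg[OF Be] by linarith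
  show "1 \<le> cond_number A"
    unfolding cond_number_def using e_le mult_left_mono[OF Be_le A0] by linarith
  have "cond_number A \<le> K * (1 / l)"
    unfolding cond_number_def using mat_norm_le[OF A K bounded] B3 A0 B0 K by (intro mult_mono) auto
  then show "cond_number A \<le> K / l" by simp
qed

section \<open>Galerkin matrices\<close>

context bounded_open_set
begin

lemma fe_function_H01:
  assumes "\<And>i. i < m \<Longrightarrow> \<phi> i \<in> H01 D"
  shows "fe_function m \<phi> v \<in> H01 D"
proof -
  have "(\<lambda>x. \<Sum>i<m. vec_index v i * \<phi> i x) \<in> H01 D"
    using assms by (intro H01_sum H01_scale) auto
  then show ?thesis by (simp add: fe_function_def[abs_def])
qed

lemma stiffness_matrix_carrier: "stiffness_matrix D k m \<phi> \<in> carrier_mat m m"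
  by (simp add: stiffness_matrix_def)

text \<open>This transfers boundedness and coercivity of the diffusion form to the Galerkin matrix.\<close>

lemma stiffness_matrix_form:
  assumes k: "bounded_coeff k" and \<phi>: "\<And>i. i < m \<Longrightarrow> \<phi> i \<in> H01 D"
    and v: "v \<in> carrier_vec m" and w: "w \<in> carrier_vec m"
  shows "scalar_prod v (stiffness_matrix D k m \<phi> *\<^sub>v w)
    = diffusion_form D k (fe_function m \<phi> w) (fe_function m \<phi> v)"
proof -
  have Aw: "stiffness_matrix D k m \<phi> *\<^sub>v w \<in> carrier_vec m"
    using stiffness_matrix_carrier w by (rule mult_mat_vec_carrier)
  have \<phi>s: "\<phi> i \<in> sobolev D 1" if "i \<in> {..<m}" for i using that \<phi> H01_sobolev by simp
  have fe: "fe_function m \<phi> u \<in> sobolev D 1" for u by (rule H01_sobolev[OF fe_function_H01[OF \<phi>]])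
  have left: "diffusion_form D k (fe_function m \<phi> u) z = (\<Sum>j<m. vec_index u j * diffusion_form D k (\<phi> j) z)"
    if "z \<in> sobolev D 1" for u z
    using diffusion_form_sum_left[where I = "{..<m}" and v = \<phi> and c = "vec_index u", OF k \<phi>s that] by (simp add: fe_function_def[abs_def])
  have "vec_index (stiffness_matrix D k m \<phi> *\<^sub>v w) i = diffusion_form D k (fe_function m \<phi> w) (\<phi> i)" if i: "i < m" for i
  proof -
    have "vec_index (stiffness_matrix D k m \<phi> *\<^sub>v w) i = (\<Sum>j<m. diffusion_form D k (\<phi> j) (\<phi> i) * vec_index w j)"
      using i w by (simp add: stiffness_matrix_def scalar_prod_def atLeast0LessThan)
    also have "\<dots> = diffusion_form D k (fe_function m \<phi> w) (\<phi> i)"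
      using left[OF \<phi>s, of i w] i by (simp add: mult.commute)
    finally show ?thesis .
  qed
  then have "scalar_prod v (stiffness_matrix D k m \<phi> *\<^sub>v w)
      = (\<Sum>i<m. vec_index v i * diffusion_form D k (\<phi> i) (fe_function m \<phi> w))"
    by (simp add: scalar_prod_real[OF v Aw] diffusion_form_commute[of k "fe_function m \<phi> w"])
  also have "\<dots> = diffusion_form D k (fe_function m \<phi> v) (fe_function m \<phi> w)"
    by (simp add: left[OF fe])
  finally show ?thesis by (simp add: diffusion_form_commute)
qed

text \<open>Equivalence of norms on a finite-dimensional space, by duality instead of compactness. Let \<open>G\<close> be the
  Gram matrix in the energy inner product and \<open>w = G\<^sup>-\<^sup>1 v\<close>. Then \<open>|v|\<^sup>2\<close> is the energy inner product of
  the functions with coefficients \<open>w\<close> and \<open>v\<close>, and the squared energy norm of the former is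
  \<open>w \<cdot> v \<le> |G\<^sup>-\<^sup>1| * |v|\<^sup>2\<close>.\<close>

lemma fe_norm_equivalence:
  assumes \<phi>: "\<And>i. i < m \<Longrightarrow> \<phi> i \<in> H01 D"
    and indep: "\<And>v. v \<in> carrier_vec m \<Longrightarrow> H01_norm D (fe_function m \<phi> v) = 0 \<Longrightarrow> v = 0\<^sub>v m"
  shows "\<exists>l>0. \<forall>v\<in>carrier_vec m. l * (vec_norm v)\<^sup>2 \<le> (H01_norm D (fe_function m \<phi> v))\<^sup>2"
proof -
  let ?G = "stiffness_matrix D (\<lambda>x. 1) m \<phi>"
  let ?fe = "fe_function m \<phi>"
  have G: "?G \<in> carrier_mat m m" by (rule stiffness_matrix_carrier)
  have form: "scalar_prod v (?G *\<^sub>v w) = H01_inner (?fe w) (?fe v)" if "v \<in> carrier_vec m" "w \<in> carrier_vec m" for v w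
    unfolding H01_inner_def by (rule stiffness_matrix_form[OF bounded_coeff_const \<phi> that])
  have fe: "?fe u \<in> sobolev D 1" for u by (rule H01_sobolev[OF fe_function_H01[OF \<phi>]])
  have inj: "v = 0\<^sub>v m" if v: "v \<in> carrier_vec m" "?G *\<^sub>v v = 0\<^sub>v m" for v
  proof -
    have "(H01_norm D (?fe v))\<^sup>2 = 0"
      using form[OF v(1) v(1)] v by (simp add: H01_inner_self)
    then show ?thesis using indep[OF v(1)] by simp
  qed
  let ?B = "the (mat_inverse ?G)"
  note B = invertible_if_injective[OF G inj]
  have B1: "?B \<in> carrier_mat m m" and B2: "?G * ?B = 1\<^sub>m m" by (rule B, assumption+)+
  define b where "b = max (mat_norm ?B) 1"
  have b: "0 < b" "mat_norm ?B \<le> b" by (auto simp: b_def)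
  have "(vec_norm v)\<^sup>2 \<le> b * (H01_norm D (?fe v))\<^sup>2" if v: "v \<in> carrier_vec m" for v
  proof (cases "vec_norm v = 0")
    case True
    then show ?thesis using b(1) by simp
  next
    case False
    then have pos: "0 < (vec_norm v)\<^sup>2" by simp
    define w where "w = ?B *\<^sub>v v"
    have w: "w \<in> carrier_vec m" unfolding w_def using B1 v by (rule mult_mat_vec_carrier)
    have Gw: "?G *\<^sub>v w = v" unfolding w_def using assoc_mult_mat_vec[OF G B1 v] B2 v by simp
    have "(H01_norm D (?fe w))\<^sup>2 = scalar_prod w v"
      using form[OF w w] by (simp add: Gw H01_inner_self)
    also have "\<dots> \<le> vec_norm w * vec_norm v" using scalar_prod_Cauchy_Schwarz[OF w v] by linarith
    also have "\<dots> \<le> (b * vec_norm v) * vec_norm v"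
    proof (rule mult_right_mono)
      have "vec_norm w \<le> mat_norm ?B * vec_norm v" unfolding w_def by (rule mat_norm_bound[OF B1 v])
      also have "\<dots> \<le> b * vec_norm v" using b(2) vec_norm_nonneg[OF v] by (rule mult_right_mono)
      finally show "vec_norm w \<le> b * vec_norm v" .
    qed (rule vec_norm_nonneg[OF v])
    finally have fw: "(H01_norm D (?fe w))\<^sup>2 \<le> b * (vec_norm v)\<^sup>2" by (simp add: power2_eq_square)
    have "(vec_norm v)\<^sup>2 = H01_inner (?fe w) (?fe v)"
      using form[OF v w] scalar_prod_self[OF v] by (simp add: Gw)
    also have "\<dots> \<le> H01_norm D (?fe w) * H01_norm D (?fe v)"
      using H01_Cauchy_Schwarz[OF fe fe, of w v] by linarith
    finally have "((vec_norm v)\<^sup>2)\<^sup>2 \<le> (H01_norm D (?fe w) * H01_norm D (?fe v))\<^sup>2"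
      by (intro power_mono) auto
    also have "\<dots> \<le> b * (vec_norm v)\<^sup>2 * (H01_norm D (?fe v))\<^sup>2"
      unfolding power_mult_distrib using fw by (rule mult_right_mono) simp
    finally have "(vec_norm v)\<^sup>2 * (vec_norm v)\<^sup>2 \<le> (vec_norm v)\<^sup>2 * (b * (H01_norm D (?fe v))\<^sup>2)"
      by (simp add: power2_eq_square mult_ac)
    then show ?thesis using pos by (simp only: mult_le_cancel_left_pos)
  qed
  then have "1 / b * (vec_norm v)\<^sup>2 \<le> (H01_norm D (?fe v))\<^sup>2" if "v \<in> carrier_vec m" for v
    using that b(1) by (simp add: field_simps)
  then show ?thesis using b(1) by (intro exI[of _ "1 / b"]) auto
qed

end

section \<open>The number of sparse grid points\<close>

lemma finite_cc_points: "finite (cc_points l)"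
  by (simp add: cc_points_def)

lemma card_cc_points_le: "1 \<le> l \<Longrightarrow> card (cc_points l) \<le> cc_size l"
  unfolding cc_points_def using card_image_le[of "{1..cc_size l}" "\<lambda>j. - cos (pi * (real j - 1) / (real (cc_size l) - 1))"]
  by (auto simp: cc_size_def)

lemma cc_points_bounds: "x \<in> cc_points l \<Longrightarrow> x \<in> {-1..1}"
  by (auto simp: cc_points_def split: if_splits)

lemma card_vec_box:
  fixes S :: "'n::finite \<Rightarrow> real set"
  assumes "\<And>n. finite (S n)"
  shows "finite {y :: real ^ 'n. \<forall>n. y $ n \<in> S n}" "card {y :: real ^ 'n. \<forall>n. y $ n \<in> S n} = (\<Prod>n\<in>UNIV. card (S n))"
proof -
  have bij: "bij_betw vec_nth {y :: real ^ 'n. \<forall>n. y $ n \<in> S n} (PiE UNIV S)"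
    by (rule bij_betw_byWitness[where f' = vec_lambda]) (auto simp: PiE_def Pi_def)
  show "finite {y :: real ^ 'n. \<forall>n. y $ n \<in> S n}"
    using bij_betw_finite[OF bij] assms by (simp add: finite_PiE)
  show "card {y :: real ^ 'n. \<forall>n. y $ n \<in> S n} = (\<Prod>n\<in>UNIV. card (S n))"
    using bij_betw_same_card[OF bij] by (simp add: card_PiE)
qed

definition level_vectors :: "nat \<Rightarrow> ('n::finite \<Rightarrow> nat) set" where
  "level_vectors L = {l. (\<forall>n. 1 \<le> l n) \<and> (\<Sum>n\<in>UNIV. l n - 1) = L}"

text \<open>Listing the components minus one embeds the level vectors into the lists of \<open>CARD('n)\<close> natural numbers
  with sum \<open>L\<close>, which stars and bars counts.\<close>

lemma level_vectors_count:
  "finite (level_vectors L :: ('n::finite \<Rightarrow> nat) set)"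
  "card (level_vectors L :: ('n \<Rightarrow> nat) set) \<le> (L + CARD('n) - 1) choose L"
proof -
  obtain xs :: "'n list" where xs: "set xs = UNIV" "distinct xs"
    using finite_distinct_list[of "UNIV :: 'n set"] by auto
  have len: "length xs = CARD('n)" using xs distinct_card by metis
  let ?f = "\<lambda>l :: 'n \<Rightarrow> nat. map (\<lambda>n. l n - 1) xs"
  let ?T = "{ks :: nat list. length ks = CARD('n) \<and> sum_list ks = L}"
  have inj: "inj_on ?f (level_vectors L)"
  proof (rule inj_onI)
    fix l l' :: "'n \<Rightarrow> nat"
    assume l: "l \<in> level_vectors L" "l' \<in> level_vectors L" "?f l = ?f l'"
    have "l n = l' n" for n
    proof -
      have "l n - 1 = l' n - 1" using l(3) xs(1) by auto
      moreover have "1 \<le> l n" "1 \<le> l' n" using l(1,2) by (auto simp: level_vectors_def)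
      ultimately show ?thesis by linarith
    qed
    then show "l = l'" by (rule ext)
  qed
  have sub: "?f ` level_vectors L \<subseteq> ?T"
    using xs len by (auto simp: level_vectors_def sum_list_distinct_conv_sum_set)
  have "finite {ks :: nat list. set ks \<subseteq> {..L} \<and> length ks = CARD('n)}"
    by (rule finite_lists_length_eq) simp
  then have fin: "finite ?T"
    by (rule finite_subset[rotated]) (auto dest: member_le_sum_list)
  show "finite (level_vectors L :: ('n \<Rightarrow> nat) set)"
    using inj finite_subset[OF sub fin] by (rule finite_imageD[rotated])
  show "card (level_vectors L :: ('n \<Rightarrow> nat) set) \<le> (L + CARD('n) - 1) choose L"
    using card_inj_on_le[OF inj sub fin] by (simp add: card_length_sum_list)
qed

lemma sparse_grid_level_vectors:
  "sparse_grid L = (\<Union>l\<in>level_vectors L. {y :: real ^ 'n::finite. \<forall>n. y $ n \<in> cc_points (l n)})"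
  by (simp add: sparse_grid_def level_vectors_def)

lemma sparse_grid_subset_param_box: "sparse_grid L \<subseteq> param_box"
  using cc_points_bounds by (fastforce simp: sparse_grid_level_vectors param_box_def)

text \<open>Equality holds at level \<open>2\<close>, which has \<open>3\<close> points.\<close>

lemma cc_size_le: "1 \<le> l \<Longrightarrow> real (cc_size l) \<le> 3 / 2 * 2 ^ (l - 1)"
proof (cases "l = 1")
  case False
  assume "1 \<le> l"
  define k where "k = l - 2"
  have k: "l = Suc (Suc k)" using False \<open>1 \<le> l\<close> unfolding k_def by linarith
  have "(1::real) \<le> 2 ^ k" by simp
  then show ?thesis by (simp add: cc_size_def k)
qed (simp add: cc_size_def)

text \<open>Each of the tensor grids whose union is the sparse grid has at most \<open>(3 / 2)\<^sup>N * 2\<^sup>L\<close> points.\<close>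

lemma card_sparse_grid_le:
  "real (card (sparse_grid L :: (real ^ 'n::finite) set))
     \<le> (3 / 2) ^ CARD('n) * 2 ^ L * real ((L + CARD('n) - 1) choose L)"
proof -
  let ?B = "\<lambda>l :: 'n \<Rightarrow> nat. {y :: real ^ 'n. \<forall>n. y $ n \<in> cc_points (l n)}"
  have box: "real (card (?B l)) \<le> (3 / 2) ^ CARD('n) * 2 ^ L" if l: "l \<in> level_vectors L" for l
  proof -
    have l1: "1 \<le> l n" for n using l by (auto simp: level_vectors_def)
    have "real (card (?B l)) = (\<Prod>n\<in>UNIV. real (card (cc_points (l n))))"
      by (simp add: card_vec_box(2) finite_cc_points)
    also have "\<dots> \<le> (\<Prod>n\<in>UNIV. 3 / 2 * 2 ^ (l n - 1))"
    proof (intro prod_mono conjI)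
      fix n
      have "real (card (cc_points (l n))) \<le> real (cc_size (l n))" using card_cc_points_le[OF l1] by simp
      with cc_size_le[OF l1[of n]] show "real (card (cc_points (l n))) \<le> 3 / 2 * 2 ^ (l n - 1)" by linarith
    qed simp
    also have "\<dots> = (3 / 2) ^ CARD('n) * 2 ^ (\<Sum>n\<in>UNIV. l n - 1)"
      unfolding prod.distrib power_sum by simp
    finally show ?thesis using l by (simp add: level_vectors_def)
  qed
  have "card (sparse_grid L :: (real ^ 'n) set) \<le> (\<Sum>l\<in>level_vectors L. card (?B l))"
    unfolding sparse_grid_level_vectors by (rule card_UN_le[OF level_vectors_count(1)])
  then have "real (card (sparse_grid L :: (real ^ 'n) set)) \<le> real (\<Sum>l\<in>level_vectors L. card (?B l))"
    by (rule of_nat_mono)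
  also have "\<dots> = (\<Sum>l\<in>level_vectors L. real (card (?B l)))" by (rule of_nat_sum)
  also have "\<dots> \<le> (\<Sum>l\<in>(level_vectors L :: ('n \<Rightarrow> nat) set). (3 / 2) ^ CARD('n) * 2 ^ L)"
    by (intro sum_mono box)
  also have "\<dots> = real (card (level_vectors L :: ('n \<Rightarrow> nat) set)) * ((3 / 2) ^ CARD('n) * 2 ^ L)" by simp
  also have "\<dots> \<le> real ((L + CARD('n) - 1) choose L) * ((3 / 2) ^ CARD('n) * 2 ^ L)"
    using level_vectors_count(2) by (intro mult_right_mono) auto
  finally show ?thesis by (simp add: mult_ac)
qed

text \<open>In the induction the quotient of consecutive terms is governed by \<open>(1 + 1 / (k + 1)) ^ (k + 1) \<le> e\<close>.\<close>

lemma power_le_exp_mult_fact: "real (Suc k) ^ k \<le> exp (real k) * fact k"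
proof (induction k)
  case (Suc k)
  have "real (Suc (Suc k)) ^ Suc k = real (Suc k) ^ Suc k * (1 + 1 / real (Suc k)) ^ Suc k"
  proof -
    have "real (Suc (Suc k)) = real (Suc k) * (1 + 1 / real (Suc k))" by (simp add: field_simps)
    then show ?thesis by (simp only: power_mult_distrib)
  qed
  also have "(1 + 1 / real (Suc k)) ^ Suc k \<le> exp (1 / real (Suc k)) ^ Suc k"
    by (intro power_mono exp_ge_add_one_self) auto
  also have "exp (1 / real (Suc k)) ^ Suc k = exp 1"
    by (simp only: exp_of_nat_mult[symmetric]) simp
  finally have "real (Suc (Suc k)) ^ Suc k \<le> real (Suc k) * real (Suc k) ^ k * exp 1"
    by simp
  also have "\<dots> \<le> real (Suc k) * (exp (real k) * fact k) * exp 1"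
    using Suc.IH by (intro mult_right_mono mult_left_mono) auto
  also have "\<dots> = exp (real (Suc k)) * fact (Suc k)"
    by (simp add: exp_add[symmetric] mult_ac)
  finally show ?case .
qed simp

lemma binomial_le_exp_bound:
  "real ((k + Suc m) choose m) \<le> (exp 1 * (1 + real k / real (Suc m))) ^ m"
proof -
  have "real ((k + Suc m) choose m) * fact m \<le> real (k + Suc m) ^ m"
    using of_nat_mono[OF binomial_fact_pow[of "k + Suc m" m], where 'a = real]
    by (simp only: of_nat_mult of_nat_fact of_nat_power)
  moreover have "real (Suc m) ^ m \<le> exp (real m) * fact m" by (rule power_le_exp_mult_fact)
  ultimately have "real ((k + Suc m) choose m) * fact m * real (Suc m) ^ m \<le> real (k + Suc m) ^ m * (exp (real m) * fact m)"
    by (intro mult_mono) auto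
  then have "real ((k + Suc m) choose m) * real (Suc m) ^ m \<le> real (k + Suc m) ^ m * exp (real m)"
    by (simp add: mult_ac)
  then have "real ((k + Suc m) choose m) \<le> real (k + Suc m) ^ m * exp (real m) / real (Suc m) ^ m"
    by (subst pos_le_divide_eq) auto
  also have "\<dots> = (exp 1 * (real (k + Suc m) / real (Suc m))) ^ m"
    by (simp add: power_mult_distrib power_divide exp_of_nat_mult[symmetric] mult.commute)
  also have "real (k + Suc m) / real (Suc m) = 1 + real k / real (Suc m)" by (simp add: field_simps)
  finally show ?thesis .
qed

text \<open>Linear interpolation between the values \<open>2 ^ k\<close> and \<open>2 ^ (k + 1)\<close> exceeds \<open>2 powr (k + t)\<close>; the factor
  \<open>4 / 3\<close> bounds this excess.\<close>

lemma interpolation_factor_le: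
  fixes t :: real
  assumes "0 \<le> t" "t \<le> 1"
  shows "1 + t \<le> 4 / 3 * 2 powr t"
proof -
  have "2 powr t = exp (t * ln 2)" by (simp add: powr_def)
  moreover have "1 + t * ln 2 \<le> exp (t * ln 2)" by (rule exp_ge_add_one_self)
  moreover have "t * (2 / 3) \<le> t * ln 2" using ln2_ge_two_thirds assms by (intro mult_left_mono) auto
  ultimately show ?thesis using assms by linarith
qed

text \<open>The factors \<open>(3 / 2)\<^sup>N\<close> of the point count and \<open>4 / 3\<close> of the interpolation together stay below
  \<open>2\<^sup>N\<close>, because one factor \<open>3 / 2\<close> absorbs \<open>4 / 3\<close> and the others are at most \<open>2\<close>.\<close>

lemma interpolated_grid_size_le:
  fixes L :: real
  assumes L: "0 \<le> L"
  shows "(1 - frac L) * real (card (sparse_grid (nat \<lfloor>L\<rfloor>) :: (real ^ 'n::finite) set))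
      + frac L * real (card (sparse_grid (nat \<lfloor>L\<rfloor> + 1) :: (real ^ 'n) set))
    \<le> 2 ^ CARD('n) * 2 powr L * (exp 1 * (1 + L / real CARD('n))) ^ (CARD('n) - 1)"
proof -
  define k where "k = nat \<lfloor>L\<rfloor>"
  define t where "t = frac L"
  define m where "m = CARD('n) - 1"
  have N: "CARD('n) = Suc m" by (simp add: m_def)
  have kL: "real k \<le> L" "L = real k + t" using L by (auto simp: k_def t_def frac_def)
  have t: "0 \<le> t" "t \<le> 1" by (auto simp: t_def frac_lt_1 less_imp_le)
  define b where "b = real ((k + Suc m) choose m)"
  have c1: "(k + Suc m - 1) choose k \<le> (k + Suc m) choose m"
  proof -
    have "(k + Suc m - 1) choose k = (k + m) choose m"
      using binomial_symmetric[of k "k + m"] by simp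
    also have "\<dots> \<le> (k + Suc m) choose m" by (rule binomial_right_mono) simp
    finally show ?thesis .
  qed
  have c2: "(k + 1 + Suc m - 1) choose (k + 1) = (k + Suc m) choose m"
    using binomial_symmetric[of "k + 1" "k + Suc m"] by simp
  have g1: "real (card (sparse_grid k :: (real ^ 'n) set)) \<le> (3 / 2) ^ Suc m * 2 ^ k * b"
  proof -
    have "real (card (sparse_grid k :: (real ^ 'n) set)) \<le> (3 / 2) ^ Suc m * 2 ^ k * real ((k + Suc m - 1) choose k)"
      using card_sparse_grid_le[where 'n = 'n, of k] by (simp only: N)
    also have "\<dots> \<le> (3 / 2) ^ Suc m * 2 ^ k * b"
      unfolding b_def using c1 by (intro mult_left_mono) auto
    finally show ?thesis .
  qed
  have g2: "real (card (sparse_grid (k + 1) :: (real ^ 'n) set)) \<le> (3 / 2) ^ Suc m * 2 ^ (k + 1) * b"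
    using card_sparse_grid_le[where 'n = 'n, of "k + 1"] unfolding N b_def c2 .
  have b_le: "b \<le> (exp 1 * (1 + L / real (Suc m))) ^ m"
  proof -
    have "b \<le> (exp 1 * (1 + real k / real (Suc m))) ^ m"
      unfolding b_def by (rule binomial_le_exp_bound)
    also have "\<dots> \<le> (exp 1 * (1 + L / real (Suc m))) ^ m"
      using kL(1) by (intro power_mono mult_left_mono add_mono divide_right_mono) auto
    finally show ?thesis .
  qed
  have factor: "(3 / 2) ^ Suc m * (2 ^ k * (1 + t)) \<le> 2 ^ Suc m * 2 powr L"
  proof -
    have "2 ^ k * (1 + t) \<le> 2 ^ k * (4 / 3 * 2 powr t)"
      using interpolation_factor_le[OF t] by (intro mult_left_mono) auto
    also have "\<dots> = 4 / 3 * 2 powr L" by (simp add: kL(2) powr_add powr_realpow)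
    finally have "(3 / 2) ^ Suc m * (2 ^ k * (1 + t)) \<le> (3 / 2) ^ Suc m * (4 / 3 * 2 powr L)"
      by (intro mult_left_mono) auto
    also have "\<dots> = 2 * (3 / 2) ^ m * 2 powr L" by simp
    also have "\<dots> \<le> 2 * 2 ^ m * 2 powr L"
      by (intro mult_left_mono mult_right_mono power_mono) auto
    finally show ?thesis by simp
  qed
  have "(1 - t) * real (card (sparse_grid k :: (real ^ 'n) set)) + t * real (card (sparse_grid (k + 1) :: (real ^ 'n) set))
      \<le> (1 - t) * ((3 / 2) ^ Suc m * 2 ^ k * b) + t * ((3 / 2) ^ Suc m * 2 ^ (k + 1) * b)"
    using t g1 g2 by (intro add_mono mult_left_mono) auto
  also have "\<dots> = (3 / 2) ^ Suc m * (2 ^ k * (1 + t)) * b"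
  proof -
    have "(1 - t) * (c * d * b) + t * (c * (d * 2) * b) = c * (d * (1 + t)) * b" for c d
      by (simp add: algebra_simps)
    from this[of "(3 / 2) ^ Suc m" "2 ^ k"] show ?thesis by (simp only: power_add power_one_right)
  qed
  also have "\<dots> \<le> 2 ^ Suc m * 2 powr L * (exp 1 * (1 + L / real (Suc m))) ^ m"
    by (rule mult_mono[OF factor b_le]) (simp_all add: b_def)
  finally show ?thesis
    by (simp only: k_def[symmetric] t_def[symmetric] m_def[symmetric] N diff_Suc_1)
qed

section \<open>Counting conjugate gradient iterations\<close>

text \<open>For \<open>K = 1\<close> the quotients are divisions by zero and the value is \<open>0\<close>, which matches the limit
  \<open>K \<rightarrow> 1\<close>.\<close>

lemma cg_rate_nonneg:
  fixes K :: real
  assumes "1 \<le> K"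
  shows "0 \<le> 1 / ln ((sqrt K + 1) / (sqrt K - 1))"
proof (cases "K = 1")
  case False
  with assms have "1 < sqrt K" by simp
  then have "1 \<le> (sqrt K + 1) / (sqrt K - 1)" by simp
  then show ?thesis by simp
qed simp

text \<open>With \<open>q\<close> the convergence factor for \<open>\<kappa>\<close>, the inequality \<open>\<kappa> \<le> K\<close> makes \<open>ln (1 / q)\<close> at least the
  logarithm in the statement, so that \<open>q\<close> raised to the given power is at most \<open>exp (- T)\<close>. For \<open>\<kappa> = 1\<close>
  the factor is \<open>0\<close>, all of whose powers vanish.\<close>

lemma cg_estimate_reached:
  fixes \<kappa> K E T \<tau> :: real
  assumes \<kappa>: "1 \<le> \<kappa>" "\<kappa> \<le> K" and E: "0 \<le> E" "2 * E \<le> \<tau> * exp T" and T: "0 \<le> T" and \<tau>: "0 < \<tau>"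
  shows "2 * ((sqrt \<kappa> - 1) / (sqrt \<kappa> + 1)) powr (T * (1 / ln ((sqrt K + 1) / (sqrt K - 1)))) * E \<le> \<tau>"
proof (cases "\<kappa> = 1")
  case True
  then show ?thesis using \<tau> by simp
next
  case False
  define s where "s = sqrt \<kappa>"
  define S where "S = sqrt K"
  have s: "1 < s" "s \<le> S" using \<kappa> False by (auto simp: s_def S_def)
  define \<Lambda> where "\<Lambda> = ln ((S + 1) / (S - 1))"
  have \<Lambda>: "0 < \<Lambda>" using s by (simp add: \<Lambda>_def)
  have "(S + 1) / (S - 1) \<le> (s + 1) / (s - 1)" using s by (simp add: divide_simps) (simp add: algebra_simps)
  then have "\<Lambda> \<le> ln ((s + 1) / (s - 1))" using s by (simp add: \<Lambda>_def)
  also have "\<dots> = - ln ((s - 1) / (s + 1))" using s by (simp add: ln_div)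
  finally have "T * (1 / \<Lambda>) * \<Lambda> \<le> T * (1 / \<Lambda>) * (- ln ((s - 1) / (s + 1)))"
    using T \<Lambda> by (intro mult_left_mono) auto
  then have "T * (1 / \<Lambda>) * ln ((s - 1) / (s + 1)) \<le> - T" using \<Lambda> by simp
  then have "((s - 1) / (s + 1)) powr (T * (1 / \<Lambda>)) \<le> exp (- T)"
    using s by (simp add: powr_def)
  then have "2 * ((s - 1) / (s + 1)) powr (T * (1 / \<Lambda>)) * E \<le> 2 * exp (- T) * E"
    using E(1) by (intro mult_right_mono mult_left_mono) auto
  also have "\<dots> = exp (- T) * (2 * E)" by simp
  also have "\<dots> \<le> exp (- T) * (\<tau> * exp T)" using E(2) by (intro mult_left_mono) auto
  also have "\<dots> = \<tau>" by (simp add: exp_minus)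
  finally show ?thesis by (simp add: s_def S_def \<Lambda>_def)
qed

lemma cg_iterations_le:
  assumes \<kappa>: "1 \<le> cond_number A" "cond_number A \<le> K"
    and E: "0 \<le> energy_norm A (c - c0)" "2 * energy_norm A (c - c0) \<le> \<tau> * exp T" and T: "0 \<le> T" and \<tau>: "0 < \<tau>"
  shows "cg_iterations A c c0 \<tau> \<le> T * (1 / ln ((sqrt K + 1) / (sqrt K - 1)))"
  unfolding cg_iterations_def
proof (rule cInf_lower)
  have "0 \<le> T * (1 / ln ((sqrt K + 1) / (sqrt K - 1)))"
    using \<kappa> T by (intro mult_nonneg_nonneg cg_rate_nonneg) auto
  then show "T * (1 / ln ((sqrt K + 1) / (sqrt K - 1))) \<in> {k. 0 \<le> k \<and>
     2 * ((sqrt (cond_number A) - 1) / (sqrt (cond_number A) + 1)) powr k * energy_norm A (c - c0) \<le> \<tau>}"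
    using cg_estimate_reached[OF \<kappa> E T \<tau>] by simp
qed (auto intro: bdd_belowI[of _ 0])

text \<open>The infimum of an empty set would be unspecified, so the estimate has to reach the tolerance for some
  index; any \<open>T\<close> with \<open>2 * E \<le> \<tau> * exp T\<close> provides such an index.\<close>

lemma cg_iterations_nonneg:
  assumes \<kappa>: "1 \<le> cond_number A" and E: "0 \<le> energy_norm A (c - c0)" and \<tau>: "0 < \<tau>"
  shows "0 \<le> cg_iterations A c c0 \<tau>"
  unfolding cg_iterations_def
proof (rule cInf_greatest)
  let ?E = "energy_norm A (c - c0)" and ?K = "cond_number A"
  define T where "T = 2 * ?E / \<tau>"
  have T: "0 \<le> T" using E \<tau> by (simp add: T_def)
  have "T \<le> exp T" using exp_ge_add_one_self[of T] by linarith
  then have "2 * ?E \<le> \<tau> * exp T" using \<tau> by (simp add: T_def field_simps)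
  from cg_estimate_reached[OF \<kappa> order_refl E this T \<tau>]
  have "T * (1 / ln ((sqrt ?K + 1) / (sqrt ?K - 1))) \<in> {k. 0 \<le> k \<and>
     2 * ((sqrt ?K - 1) / (sqrt ?K + 1)) powr k * ?E \<le> \<tau>}"
    using mult_nonneg_nonneg[OF T cg_rate_nonneg[OF \<kappa>]] by (intro CollectI conjI)
  then show "{k. 0 \<le> k \<and> 2 * ((sqrt ?K - 1) / (sqrt ?K + 1)) powr k * ?E \<le> \<tau>} \<noteq> {}" by blast
qed auto

text \<open>The second bound is the interpolated number of grid points times the iteration count for the largest
  condition number. The number \<open>T\<close> stands for any nonnegative upper bound of \<open>ln (2 * E / \<tau>)\<close> over the parameter box;
  writing it this way also covers \<open>E = 0\<close>.\<close>

lemma K_zero_bounds: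
  fixes A :: "real ^ 'n::finite \<Rightarrow> real mat"
  assumes \<kappa>: "\<And>y. y \<in> param_box \<Longrightarrow> 1 \<le> cond_number (A y)"
    and E: "\<And>y. y \<in> param_box \<Longrightarrow> 0 \<le> energy_norm (A y) (c y - 0\<^sub>v (dim_vec (c y)))"
    and \<tau>: "0 < \<tau>" and L: "0 \<le> L"
  shows "0 \<le> K_zero A c L \<tau>"
    and "\<lbrakk>\<And>y. y \<in> param_box \<Longrightarrow> cond_number (A y) \<le> K; 0 \<le> T;
      \<And>y. y \<in> param_box \<Longrightarrow> 2 * energy_norm (A y) (c y - 0\<^sub>v (dim_vec (c y))) \<le> \<tau> * exp T\<rbrakk> \<Longrightarrow>
      K_zero A c L \<tau> \<le> 2 ^ CARD('n) * 2 powr L * (exp 1 * (1 + L / real CARD('n))) ^ (CARD('n) - 1)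
        * (T * (1 / ln ((sqrt K + 1) / (sqrt K - 1))))"
proof -
  let ?it = "\<lambda>y. cg_iterations (A y) (c y) (0\<^sub>v (dim_vec (c y))) \<tau>"
  have box: "y \<in> param_box" if "y \<in> sparse_grid k" for y :: "real ^ 'n" and k
    using that sparse_grid_subset_param_box by blast
  have frac: "0 \<le> frac L" "0 \<le> 1 - frac L" using frac_lt_1[of L] by auto
  have "0 \<le> K_zero_level A c k \<tau>" for k
    unfolding K_zero_level_def by (intro sum_nonneg cg_iterations_nonneg \<kappa> E \<tau> box)
  then show "0 \<le> K_zero A c L \<tau>"
    unfolding K_zero_def using frac by simp
  assume K: "\<And>y. y \<in> param_box \<Longrightarrow> cond_number (A y) \<le> K" and T: "0 \<le> T"
    and ET: "\<And>y. y \<in> param_box \<Longrightarrow> 2 * energy_norm (A y) (c y - 0\<^sub>v (dim_vec (c y))) \<le> \<tau> * exp T"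
  define G where "G = T * (1 / ln ((sqrt K + 1) / (sqrt K - 1)))"
  have "(0 :: real ^ 'n) \<in> param_box" by (simp add: param_box_def)
  then have "1 \<le> K" using \<kappa> K order_trans by blast
  then have G: "0 \<le> G" unfolding G_def using T by (intro mult_nonneg_nonneg cg_rate_nonneg)
  have level: "K_zero_level A c k \<tau> \<le> real (card (sparse_grid k :: (real ^ 'n) set)) * G" for k
  proof -
    have "K_zero_level A c k \<tau> \<le> (\<Sum>y\<in>(sparse_grid k :: (real ^ 'n) set). G)"
      unfolding K_zero_level_def G_def
      by (intro sum_mono cg_iterations_le \<kappa> K E ET T \<tau> box)
    then show ?thesis by simp
  qed
  have "K_zero A c L \<tau> \<le> (1 - frac L) * (real (card (sparse_grid (nat \<lfloor>L\<rfloor>) :: (real ^ 'n) set)) * G)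
      + frac L * (real (card (sparse_grid (nat \<lfloor>L\<rfloor> + 1) :: (real ^ 'n) set)) * G)"
    unfolding K_zero_def using frac level by (intro add_mono mult_left_mono)
  also have "\<dots> = ((1 - frac L) * real (card (sparse_grid (nat \<lfloor>L\<rfloor>) :: (real ^ 'n) set))
      + frac L * real (card (sparse_grid (nat \<lfloor>L\<rfloor> + 1) :: (real ^ 'n) set))) * G"
    by (simp add: algebra_simps)
  also have "\<dots> \<le> 2 ^ CARD('n) * 2 powr L * (exp 1 * (1 + L / real CARD('n))) ^ (CARD('n) - 1) * G"
    using interpolated_grid_size_le[OF L, where 'n = 'n] G by (rule mult_right_mono)
  finally show "K_zero A c L \<tau> \<le> 2 ^ CARD('n) * 2 powr L * (exp 1 * (1 + L / real CARD('n))) ^ (CARD('n) - 1)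
        * (T * (1 / ln ((sqrt K + 1) / (sqrt K - 1))))"
    unfolding G_def .
qed

section \<open>The discrete solution over the parameter box\<close>

lemma param_box_sets: "(param_box :: (real ^ 'n::finite) set) \<in> sets lebesgue"
  by (simp add: param_box_eq_cbox)

text \<open>If a value exceeded the essential supremum, so would all values at nearby points of the box. These
  contain a nonempty open set, which is not negligible.\<close>

lemma H01_norm_le_Linf:
  fixes w :: "real ^ 'n::finite \<Rightarrow> 'a::euclidean_space \<Rightarrow> real"
  assumes cont: "continuous_on param_box (\<lambda>y. H01_norm D (w y))"
    and nonneg: "\<And>y. 0 \<le> H01_norm D (w y)" and y0: "y0 \<in> param_box"
  shows "H01_norm D (w y0) \<le> real_of_ereal (Linf_H01_norm D w)"
proof -
  let ?g = "\<lambda>y. H01_norm D (w y)"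
  define S where "S = Linf_H01_norm D w"
  have "?g \<in> borel_measurable (lebesgue_on param_box)"
    using cont param_box_sets by (rule continuous_imp_measurable_on_sets_lebesgue)
  then have meas: "(\<lambda>y. ereal (?g y)) \<in> borel_measurable (lebesgue_on param_box)"
    by (rule borel_measurable_ereal)
  have "compact (?g ` param_box)" by (rule compact_continuous_image[OF cont compact_param_box])
  then have "bounded (?g ` param_box)" by (rule compact_imp_bounded)
  then obtain B where "\<forall>r\<in>?g ` param_box. \<bar>r\<bar> \<le> B" unfolding bounded_real by blast
  then have B: "?g y \<le> B" if "y \<in> param_box" for y
    using that by (blast intro: abs_le_D1)
  have S_le: "S \<le> ereal B"
    unfolding S_def Linf_H01_norm_def by (rule esssup_I[OF meas]) (auto intro!: AE_I2 B)
  have ae: "AE y in lebesgue_on param_box. ereal (?g y) \<le> S"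
    unfolding S_def Linf_H01_norm_def by (rule esssup_AE)
  have ge: "ereal (?g y1) \<le> S" if y1: "y1 \<in> param_box" for y1
  proof (rule ccontr)
    assume "\<not> ereal (?g y1) \<le> S"
    then obtain r where r: "S < ereal r" "r < ?g y1"
      using ereal_dense2[of S "ereal (?g y1)"] by (auto simp: not_le)
    obtain d where d: "0 < d" "\<And>y. y \<in> param_box \<Longrightarrow> dist y y1 < d \<Longrightarrow> dist (?g y) (?g y1) < ?g y1 - r"
    proof -
      have "0 < ?g y1 - r" using r(2) by simp
      from cont[unfolded continuous_on_iff, rule_format, OF y1 this] show ?thesis using that by blast
    qed
    define V where "V = ball y1 d \<inter> box (- 1) (1 :: real ^ 'n)"
    have "0 \<in> box (- 1) (1 :: real ^ 'n)" by (simp add: mem_box_cart)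
    then have "box (- 1) (1 :: real ^ 'n) \<noteq> {}" by blast
    then have "y1 \<in> closure (box (- 1) (1 :: real ^ 'n))" using y1 by (simp add: closure_box param_box_eq_cbox)
    then obtain y where "y \<in> box (- 1) (1 :: real ^ 'n)" "dist y y1 < d"
      using d(1) unfolding closure_approachable by blast
    then have "y \<in> V" by (simp add: V_def dist_commute)
    then have "V \<noteq> {}" by blast
    moreover have "open V" unfolding V_def by (intro open_Int open_ball open_box)
    ultimately have "\<not> negligible V" using open_not_negligible by blast
    moreover have "negligible V"
    proof -
      have "AE y in lebesgue. y \<in> param_box \<longrightarrow> ereal (?g y) \<le> S"
        using ae by (subst (asm) AE_restrict_space_iff) (use param_box_sets in auto)
      then obtain N where N: "N \<in> null_sets lebesgue" "{y \<in> space lebesgue. \<not> (y \<in> param_box \<longrightarrow> ereal (?g y) \<le> S)} \<subseteq> N"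
        unfolding eventually_ae_filter by blast
      have "V \<subseteq> N"
      proof
        fix y assume y: "y \<in> V"
        then have yb: "y \<in> param_box" using box_subset_cbox by (auto simp: V_def param_box_eq_cbox)
        have "dist (?g y) (?g y1) < ?g y1 - r" using y by (intro d(2) yb) (simp add: V_def dist_commute)
        then have rg: "r < ?g y" by (auto simp: dist_real_def)
        have "S < ereal (?g y)" by (rule order.strict_trans[OF r(1)]) (simp add: rg)
        then show "y \<in> N" using N(2) yb by auto
      qed
      moreover have "negligible N" using N(1) by (simp add: negligible_iff_null_sets)
      ultimately show ?thesis using negligible_subset by blast
    qed
    ultimately show False by blast
  qed
  from ge[OF y0] S_le nonneg[of y0] have "ereal (real_of_ereal S) = S"
    by (cases S) auto
  then have "ereal (?g y0) \<le> ereal (real_of_ereal S)" using ge[OF y0] by (simp only:)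
  then show ?thesis by (simp only: ereal_less_eq(3) S_def)
qed

text \<open>The one-dimensional densities are measurable on \<open>[-1, 1]\<close> only, hence the detour over their extensions
  by zero, which agree with them on the box.\<close>

lemma measurable_density_weight:
  fixes \<rho> :: "'n::finite \<Rightarrow> real \<Rightarrow> real"
  assumes \<rho>: "\<And>n. set_borel_measurable borel {-1..1} (\<rho> n)"
  shows "(\<lambda>y. ennreal (\<Prod>n\<in>UNIV. \<rho> n (y $ n))) \<in> borel_measurable (lebesgue_on param_box)"
proof -
  have coord: "(\<lambda>y :: real ^ 'n. y $ n) \<in> borel_measurable (lebesgue_on param_box)" for n
    by (intro continuous_imp_measurable_on_sets_lebesgue param_box_sets continuous_intros)
  have "(\<lambda>y :: real ^ 'n. indicator {-1..1} (y $ n) *\<^sub>R \<rho> n (y $ n)) \<in> borel_measurable (lebesgue_on param_box)" for n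
    using measurable_compose[OF coord \<rho>[of n, unfolded set_borel_measurable_def]] by simp
  then have "(\<lambda>y :: real ^ 'n. ennreal (\<Prod>n\<in>UNIV. indicator {-1..1} (y $ n) *\<^sub>R \<rho> n (y $ n))) \<in> borel_measurable (lebesgue_on param_box)"
    by (intro measurable_compose[OF _ measurable_ennreal] borel_measurable_prod)
  then show ?thesis
    by (rule measurable_cong[THEN iffD1, rotated]) (auto simp: param_box_def intro!: arg_cong[where f = ennreal] prod.cong)
qed

lemma space_density_measure: "space (density_measure \<rho>) = (param_box :: (real ^ 'n::finite) set)"
  by (simp add: density_measure_def)

lemma AE_density_measureI:
  fixes \<rho> :: "'n::finite \<Rightarrow> real \<Rightarrow> real"
  assumes \<rho>: "\<And>n. set_borel_measurable borel {-1..1} (\<rho> n)"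
    and ae: "AE y in lebesgue_on param_box. P y"
  shows "AE y in density_measure \<rho>. P y"
  unfolding density_measure_def
proof (rule AE_completion)
  have "AE y in lebesgue_on param_box. 0 < ennreal (\<Prod>n\<in>UNIV. \<rho> n (y $ n)) \<longrightarrow> P y"
    using ae by eventually_elim simp
  then show "AE y in density (lebesgue_on param_box) (\<lambda>y. ennreal (\<Prod>n\<in>UNIV. \<rho> n (y $ n))). P y"
    by (simp only: AE_density[OF measurable_density_weight[OF \<rho>]])
qed

lemma measurable_density_measure:
  fixes g :: "real ^ 'n::finite \<Rightarrow> real"
  assumes "continuous_on param_box g"
  shows "g \<in> borel_measurable (density_measure \<rho>)"
proof -
  have "g \<in> borel_measurable (lebesgue_on param_box)"
    using assms param_box_sets by (rule continuous_imp_measurable_on_sets_lebesgue)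
  then show ?thesis
    unfolding density_measure_def by (intro measurable_completion) simp
qed

context bounded_open_set
begin

text \<open>If \<open>u\<close> vanishes almost nowhere, its norm is at least some \<open>2 * \<eta>\<close> on a set of positive probability. If
  the norm of \<open>uh h\<close> were below \<open>\<eta>\<close> everywhere, the mean square error would be at least \<open>\<eta>\<^sup>2\<close> times this
  probability, contradicting convergence for small \<open>h\<close>.\<close>

lemma discrete_solution_bounded_below:
  fixes u :: "real ^ 'n::finite \<Rightarrow> 'a \<Rightarrow> real" and uh :: "real \<Rightarrow> real ^ 'n \<Rightarrow> 'a \<Rightarrow> real"
  assumes \<rho>: "\<And>n. set_borel_measurable borel {-1..1} (\<rho> n)" and prob: "prob_space (density_measure \<rho>)"
    and u: "\<And>y. y \<in> param_box \<Longrightarrow> u y \<in> H01 D" and cont: "continuous_on param_box (\<lambda>y. H01_norm D (u y))"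
    and zero: "negligible {y \<in> param_box. H01_norm D (u y) = 0}"
    and uh: "\<And>h y. h \<in> {0<..h0} \<Longrightarrow> y \<in> param_box \<Longrightarrow> uh h y \<in> H01 D"
    and s: "1 \<le> s" and h0: "0 < h0"
    and err: "\<And>h. h \<in> {0<..h0} \<Longrightarrow>
           (\<lambda>y x. u y x - uh h y x) \<in> bochner_L2 (density_measure \<rho>) (H01 D) (H01_norm D) \<and>
           bochner_L2_norm (density_measure \<rho>) (H01_norm D) (\<lambda>y x. u y x - uh h y x) \<le> Cfem * h ^ s"
  shows "\<exists>\<eta>>0. \<forall>\<^sub>F h in at_right 0. \<exists>y\<in>param_box. \<eta> \<le> H01_norm D (uh h y)"
proof -
  define P where "P = density_measure \<rho>"
  interpret P: prob_space P unfolding P_def by (rule prob)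
  have spaceP: "space P = param_box" by (simp add: P_def space_density_measure)
  let ?g = "\<lambda>y. H01_norm D (u y)"
  have g: "?g \<in> borel_measurable P" unfolding P_def by (rule measurable_density_measure[OF cont])
  define S where "S k = {y \<in> space P. inverse (real (Suc k)) \<le> ?g y}" for k
  have S: "S k \<in> sets P" for k unfolding S_def using g by measurable
  have "\<exists>k. measure P (S k) \<noteq> 0"
  proof (rule ccontr)
    assume "\<not> ?thesis"
    then have "S k \<in> null_sets P" for k
      using S by (auto simp: null_sets_def P.emeasure_eq_measure)
    then have "AE y in P. y \<notin> S k" for k by (rule AE_not_in)
    then have "AE y in P. \<forall>k. y \<notin> S k" by (simp add: AE_all_countable)
    moreover have "AE y in P. ?g y \<noteq> 0"
      unfolding P_def
    proof (rule AE_density_measureI[OF \<rho>])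
      have "AE y in lebesgue. y \<in> param_box \<longrightarrow> ?g y \<noteq> 0"
        using zero by (intro AE_I'[of "{y \<in> param_box. ?g y = 0}"]) (auto simp: negligible_iff_null_sets)
      then show "AE y in lebesgue_on param_box. ?g y \<noteq> 0"
        by (subst AE_restrict_space_iff) (use param_box_sets in auto)
    qed
    moreover have "AE y in P. y \<in> space P" by (rule AE_space)
    ultimately have "AE y in P. False"
    proof eventually_elim
      case (elim y)
      then have "0 < ?g y" using H01_norm_nonneg[of "u y"] by linarith
      then obtain k where "inverse (real (Suc k)) < ?g y" using reals_Archimedean by blast
      then have "y \<in> S k" using elim(3) by (simp add: S_def)
      then show ?case using elim(1) by blast
    qed
    then show False by simp
  qed
  then obtain k where k: "measure P (S k) \<noteq> 0" by blast
  \<comment> \<open>Half of the lower bound, so that a discrete solution below it leaves an error of at least it.\<close>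
  define \<eta> where "\<eta> = inverse (real (Suc k)) / 2"
  have \<eta>: "0 < \<eta>" by (simp add: \<eta>_def)
  define p where "p = \<eta>\<^sup>2 * measure P (S k)"
  have p: "0 < p" unfolding p_def using k \<eta> zero_less_measure_iff by (intro mult_pos_pos) (auto simp: zero_less_measure_iff)
  have lower: "\<exists>y\<in>param_box. \<eta> \<le> H01_norm D (uh h y)" if h: "h \<in> {0<..h0}" and small: "(Cfem * h ^ s)\<^sup>2 < p" for h
  proof (rule ccontr)
    assume "\<not> ?thesis"
    then have less: "H01_norm D (uh h y) < \<eta>" if "y \<in> param_box" for y using that by (auto simp: not_le)
    let ?e = "\<lambda>y. (H01_norm D (\<lambda>x. u y x - uh h y x))\<^sup>2"
    have int: "integrable P ?e" using err[OF h] by (simp add: bochner_L2_def P_def)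
    have "sqrt (LINT y|P. ?e y) \<le> Cfem * h ^ s"
      using err[OF h] by (simp add: bochner_L2_norm_def P_def)
    then have "(LINT y|P. ?e y) \<le> (Cfem * h ^ s)\<^sup>2"
      by (rule sqrt_le_D)
    have "p = (LINT y|P. \<eta>\<^sup>2 * indicator (S k) y)"
      using S[of k] by (simp add: p_def)
    also have "\<dots> \<le> (LINT y|P. ?e y)"
    proof (rule integral_mono)
      show "integrable P (\<lambda>y. \<eta>\<^sup>2 * indicator (S k) y)"
        using S[of k] by (intro integrable_mult_right integrable_real_indicator) (auto simp: P.emeasure_eq_measure)
      fix y assume y: "y \<in> space P"
      show "\<eta>\<^sup>2 * indicator (S k) y \<le> ?e y"
      proof (cases "y \<in> S k")
        case True
        have yb: "y \<in> param_box" using y spaceP by simp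
        have "2 * \<eta> \<le> ?g y" using True by (simp add: S_def \<eta>_def)
        moreover have "\<bar>?g y - H01_norm D (uh h y)\<bar> \<le> H01_norm D (\<lambda>x. u y x - uh h y x)"
          by (intro H01_norm_triangle_diff H01_sobolev u uh h yb)
        ultimately have "\<eta> \<le> H01_norm D (\<lambda>x. u y x - uh h y x)" using less[OF yb] by linarith
        then show ?thesis using True \<eta> by (simp add: power_mono)
      qed simp
    qed (rule int)
    finally show False using small \<open>(LINT y|P. ?e y) \<le> (Cfem * h ^ s)\<^sup>2\<close> by linarith
  qed
  have "((\<lambda>h. (Cfem * h ^ s)\<^sup>2) \<longlongrightarrow> (Cfem * 0 ^ s)\<^sup>2) (at_right 0)"
    by (intro tendsto_intros)
  then have "((\<lambda>h. (Cfem * h ^ s)\<^sup>2) \<longlongrightarrow> 0) (at_right 0)" using s by (simp add: power_0_left)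
  then have "\<forall>\<^sub>F h in at_right 0. (Cfem * h ^ s)\<^sup>2 < p" by (rule order_tendstoD) (rule p)
  moreover have "\<forall>\<^sub>F h in at_right 0. h \<in> {0<..h0}"
    unfolding eventually_at_right_field using h0 by (intro exI[of _ h0]) auto
  ultimately have "\<forall>\<^sub>F h in at_right 0. \<exists>y\<in>param_box. \<eta> \<le> H01_norm D (uh h y)"
    by eventually_elim (rule lower)
  with \<eta> show ?thesis by blast
qed

text \<open>Uniformity in the parameter is what matters: the mesh-dependent constants come from the basis functions
  only, and the parameter enters through \<open>\<alpha>\<close> and \<open>\<beta>\<close>. So the supremum of the condition numbers is finite
  and bounds each of them.\<close>

lemma galerkin_matrices_conditioned:
  fixes a :: "'a \<Rightarrow> real ^ 'n::finite \<Rightarrow> real"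
  assumes basis: "fe_basis D \<T> m \<phi>"
    and coeff: "\<And>y. y \<in> param_box \<Longrightarrow> bounded_coeff (\<lambda>x. a x y)"
    and \<alpha>: "0 < \<alpha>" and \<beta>: "0 < \<beta>"
    and bounded: "\<And>y v w. \<lbrakk>y \<in> param_box; v \<in> H01 D; w \<in> H01 D\<rbrakk> \<Longrightarrow>
           \<bar>diffusion_form D (\<lambda>x. a x y) v w\<bar> \<le> \<alpha> * H01_norm D v * H01_norm D w"
    and coercive: "\<And>y v. \<lbrakk>y \<in> param_box; v \<in> H01 D\<rbrakk> \<Longrightarrow>
           \<beta> * (H01_norm D v)\<^sup>2 \<le> diffusion_form D (\<lambda>x. a x y) v v"
  shows "\<exists>B. \<forall>y\<in>param_box. 1 \<le> cond_number (stiffness_matrix D (\<lambda>x. a x y) m \<phi>) \<and>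
    cond_number (stiffness_matrix D (\<lambda>x. a x y) m \<phi>) \<le> B"
proof -
  have m: "1 \<le> m" and \<phi>: "\<And>i. i < m \<Longrightarrow> \<phi> i \<in> H01 D"
    and indep: "\<And>v. v \<in> carrier_vec m \<Longrightarrow> H01_norm D (fe_function m \<phi> v) = 0 \<Longrightarrow> v = 0\<^sub>v m"
    using basis by (auto simp: fe_basis_def)
  have "\<exists>l>0. \<forall>v\<in>carrier_vec m. l * (vec_norm v)\<^sup>2 \<le> (H01_norm D (fe_function m \<phi> v))\<^sup>2"
    by (rule fe_norm_equivalence[OF \<phi> indep])
  then obtain l where l: "0 < l" "\<forall>v\<in>carrier_vec m. l * (vec_norm v)\<^sup>2 \<le> (H01_norm D (fe_function m \<phi> v))\<^sup>2"
    by blast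
  define C where "C = \<alpha> * (\<Sum>i<m. H01_norm D (\<phi> i)) * (\<Sum>i<m. H01_norm D (\<phi> i))"
  have single: "H01_norm D (\<phi> i) \<le> (\<Sum>i<m. H01_norm D (\<phi> i))" if "i < m" for i
    using that member_le_sum[of i "{..<m}" "\<lambda>i. H01_norm D (\<phi> i)"] by (simp add: H01_norm_nonneg)
  have C0: "0 \<le> C" unfolding C_def using \<alpha> by (intro mult_nonneg_nonneg sum_nonneg H01_norm_nonneg) auto
  show ?thesis
  proof (intro exI ballI)
    fix y :: "real ^ 'n" assume y: "y \<in> param_box"
    let ?A = "stiffness_matrix D (\<lambda>x. a x y) m \<phi>"
    have A: "?A \<in> carrier_mat m m" by (rule stiffness_matrix_carrier)
    have entries: "\<bar>?A $$ (i, j)\<bar> \<le> C" if ij: "i < m" "j < m" for i j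
    proof -
      have "\<bar>?A $$ (i, j)\<bar> \<le> \<alpha> * H01_norm D (\<phi> j) * H01_norm D (\<phi> i)"
        using ij bounded[OF y \<phi> \<phi>, of j i] by (simp add: stiffness_matrix_def)
      also have "\<dots> \<le> C"
        unfolding C_def using single ij \<alpha>
        by (intro mult_mono mult_nonneg_nonneg sum_nonneg H01_norm_nonneg) auto
      finally show ?thesis .
    qed
    have K: "vec_norm (?A *\<^sub>v v) \<le> real m * real m * C * vec_norm v" if "v \<in> carrier_vec m" for v
      by (rule vec_norm_mult_mat_le[OF A entries that])
    have coer: "\<beta> * l * (vec_norm v)\<^sup>2 \<le> scalar_prod v (?A *\<^sub>v v)" if v: "v \<in> carrier_vec m" for v
    proof -
      have "\<beta> * l * (vec_norm v)\<^sup>2 \<le> \<beta> * (H01_norm D (fe_function m \<phi> v))\<^sup>2"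
        using bspec[OF l(2) v] \<beta> by (simp add: mult.assoc)
      also have "\<dots> \<le> diffusion_form D (\<lambda>x. a x y) (fe_function m \<phi> v) (fe_function m \<phi> v)"
        by (intro coercive y fe_function_H01 \<phi>)
      also have "\<dots> = scalar_prod v (?A *\<^sub>v v)"
        by (rule stiffness_matrix_form[OF coeff[OF y] \<phi> v v, symmetric])
      finally show ?thesis .
    qed
    have pos: "0 \<le> real m * real m * C" "0 < \<beta> * l" using C0 \<beta> l(1) by auto
    show "1 \<le> cond_number ?A \<and> cond_number ?A \<le> real m * real m * C / (\<beta> * l)"
      using cond_number_bounds[OF A m pos K coer] by blast
  qed
qed

lemma galerkin_energy:
  assumes coeff: "bounded_coeff k" and \<phi>: "\<And>i. i < m \<Longrightarrow> \<phi> i \<in> H01 D" and c: "c \<in> carrier_vec m"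
    and \<alpha>: "0 < \<alpha>" and \<beta>: "0 < \<beta>"
    and bounded: "\<And>v. v \<in> H01 D \<Longrightarrow> \<bar>diffusion_form D k v v\<bar> \<le> \<alpha> * H01_norm D v * H01_norm D v"
    and coercive: "\<And>v. v \<in> H01 D \<Longrightarrow> \<beta> * (H01_norm D v)\<^sup>2 \<le> diffusion_form D k v v"
  shows "0 \<le> energy_norm (stiffness_matrix D k m \<phi>) (c - 0\<^sub>v (dim_vec c))"
    and "energy_norm (stiffness_matrix D k m \<phi>) (c - 0\<^sub>v (dim_vec c)) \<le> sqrt \<alpha> * H01_norm D (fe_function m \<phi> c)"
proof -
  let ?v = "fe_function m \<phi> c"
  have v: "?v \<in> H01 D" by (rule fe_function_H01[OF \<phi>])
  have "c - 0\<^sub>v (dim_vec c) = c" using c by auto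
  then have E: "energy_norm (stiffness_matrix D k m \<phi>) (c - 0\<^sub>v (dim_vec c)) = sqrt (diffusion_form D k ?v ?v)"
    by (simp add: energy_norm_def stiffness_matrix_form[OF coeff \<phi> c c])
  have "0 \<le> \<beta> * (H01_norm D ?v)\<^sup>2" using \<beta> by simp
  then have "0 \<le> diffusion_form D k ?v ?v" using coercive[OF v] by linarith
  then show "0 \<le> energy_norm (stiffness_matrix D k m \<phi>) (c - 0\<^sub>v (dim_vec c))" unfolding E by simp
  have "sqrt (diffusion_form D k ?v ?v) \<le> sqrt (\<alpha> * (H01_norm D ?v)\<^sup>2)"
    using bounded[OF v] by (simp add: power2_eq_square mult.assoc)
  then show "energy_norm (stiffness_matrix D k m \<phi>) (c - 0\<^sub>v (dim_vec c)) \<le> sqrt \<alpha> * H01_norm D ?v"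
    unfolding E by (simp add: real_sqrt_mult H01_norm_nonneg)
qed

text \<open>The load vector consists of the values of the diffusion form at the pairs of \<open>u\<close> and a basis function, all of
  which vanish.\<close>

lemma galerkin_solution_zero:
  assumes basis: "fe_basis D \<T> m \<phi>" and coeff: "bounded_coeff k" and \<beta>: "0 < \<beta>"
    and coercive: "\<And>v. v \<in> H01 D \<Longrightarrow> \<beta> * (H01_norm D v)\<^sup>2 \<le> diffusion_form D k v v"
    and sol: "weak_solution D k g u" and u: "H01_norm D u = 0"
    and c: "c \<in> carrier_vec m" "stiffness_matrix D k m \<phi> *\<^sub>v c = load_vector D g m \<phi>"
  shows "c = 0\<^sub>v m"
proof -
  have \<phi>: "\<And>i. i < m \<Longrightarrow> \<phi> i \<in> H01 D"
    and indep: "\<And>v. v \<in> carrier_vec m \<Longrightarrow> H01_norm D (fe_function m \<phi> v) = 0 \<Longrightarrow> v = 0\<^sub>v m"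
    using basis by (auto simp: fe_basis_def)
  have uH: "u \<in> H01 D" using sol by (simp add: weak_solution_def)
  have "(LINT x|lebesgue_on D. g x * \<phi> i x) = 0" if "i < m" for i
    using sol \<phi>[OF that] diffusion_form_null[OF coeff H01_sobolev[OF uH] u, of "\<phi> i"]
    unfolding weak_solution_def by force
  then have "load_vector D g m \<phi> = 0\<^sub>v m" by (auto simp: load_vector_def)
  then have "scalar_prod c (stiffness_matrix D k m \<phi> *\<^sub>v c) = 0" using c by simp
  moreover have "scalar_prod c (stiffness_matrix D k m \<phi> *\<^sub>v c)
      = diffusion_form D k (fe_function m \<phi> c) (fe_function m \<phi> c)"
    by (rule stiffness_matrix_form[OF coeff \<phi> c(1) c(1)])
  moreover have "fe_function m \<phi> c \<in> H01 D" by (rule fe_function_H01[OF \<phi>])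
  ultimately have "\<beta> * (H01_norm D (fe_function m \<phi> c))\<^sup>2 \<le> 0"
    using coercive[of "fe_function m \<phi> c"] by simp
  then have "H01_norm D (fe_function m \<phi> c) = 0" using \<beta> by (simp add: mult_le_0_iff)
  then show ?thesis by (rule indep[OF c(1)])
qed

end

section \<open>The choice of level and tolerance\<close>

text \<open>The level is chosen so that the sparse grid constraint holds with equality. The condition
  \<open>exp 2 \<le> X\<close> makes the level at least \<open>2\<close>.\<close>

lemma level_choice:
  fixes N r C \<epsilon> :: real
  assumes N: "1 \<le> N" and r: "0 < r" and C: "0 < C" and \<epsilon>: "0 < \<epsilon>"
  defines "X \<equiv> 1 / (r * N) * ln (3 * C / \<epsilon>)"
  assumes X: "exp 2 \<le> X"
  defines "L \<equiv> N / ln 2 * ln X"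
  shows "2 \<le> L" "2 powr (L / N) = X" "C * exp (- r * N * 2 powr (L / N)) = \<epsilon> / 3" "0 < ln (3 * C / \<epsilon>)"
proof -
  have X0: "0 < X" using X exp_gt_zero[of 2] by linarith
  have ln2: "0 < ln (2::real)" "ln (2::real) \<le> 1" using ln_le_minus_one[of 2] by auto
  have lnX: "2 \<le> ln X" using X X0 by (simp add: ln_ge_iff)
  have "1 * 2 \<le> N / ln 2 * ln X"
  proof (rule mult_mono)
    show "1 \<le> N / ln 2" using N ln2 by (simp add: field_simps)
  qed (use lnX N ln2 in auto)
  then show "2 \<le> L" by (simp add: L_def)
  have "L / N = ln X / ln 2" using N by (simp add: L_def)
  then show eq: "2 powr (L / N) = X" using X0 ln2 by (simp add: powr_def)
  have rN: "0 < r * N" using r N by simp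
  have "r \<noteq> 0" "N \<noteq> 0" using r N by auto
  then have "r * N * X = ln (3 * C / \<epsilon>)" by (simp add: X_def)
  then have "C * exp (- r * N * 2 powr (L / N)) = C * exp (- ln (3 * C / \<epsilon>))" by (simp add: eq)
  also have "\<dots> = \<epsilon> / 3" using C \<epsilon> by (simp add: exp_minus)
  finally show "C * exp (- r * N * 2 powr (L / N)) = \<epsilon> / 3" .
  show "0 < ln (3 * C / \<epsilon>)" using X0 rN by (simp add: X_def zero_less_divide_iff)
qed

text \<open>Since \<open>2 powr L = X ^ n\<close>, and the bracket with exponent \<open>n - 1\<close> on the right is \<open>1 + L / N\<close>, the two sides
  differ only by the factor \<open>(1 / ln 2) ^ (n - 1)\<close>, which is at least \<open>1\<close>.\<close>

lemma grid_factor_le: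
  fixes r C \<epsilon> \<Lambda> T :: real and n :: nat
  assumes n: "1 \<le> n" and r: "0 < r" and C: "0 < C" and \<epsilon>: "0 < \<epsilon>"
  defines "N \<equiv> real n"
  defines "X \<equiv> 1 / (r * N) * ln (3 * C / \<epsilon>)"
  assumes X: "exp 2 \<le> X" and \<Lambda>: "0 \<le> \<Lambda>" and T: "0 \<le> T"
  defines "L \<equiv> N / ln 2 * ln X"
  shows "2 ^ n * 2 powr L * (exp 1 * (1 + L / N)) ^ (n - 1) * (T * \<Lambda>)
    \<le> (exp 1 / ln 2) ^ (n - 1) * (2 / (r * N)) ^ n * (ln (3 * C / \<epsilon>)) ^ n
      * (1 + 1 / ln 2 * ln (1 / (r * N)) + 1 / ln 2 * ln (ln (3 * C / \<epsilon>))) ^ (n - 1) * \<Lambda> * T"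
proof -
  have N: "1 \<le> N" using n by (simp add: N_def)
  note choice = level_choice[OF N r C \<epsilon>, folded X_def, OF X, folded L_def]
  have X0: "0 < X" using X exp_gt_zero[of 2] by linarith
  have ln2: "0 < ln (2::real)" "ln (2::real) \<le> 1" using ln_le_minus_one[of 2] by auto
  have rN: "0 < 1 / (r * N)" using r N by simp
  have "2 powr L = (2 powr (L / N)) powr N" using N by (simp add: powr_powr)
  also have "\<dots> = X powr N" by (simp only: choice(2))
  also have "\<dots> = X ^ n" using X0 by (simp add: N_def powr_realpow)
  finally have pL: "2 powr L = X ^ n" .
  have lnX: "ln X = ln (1 / (r * N)) + ln (ln (3 * C / \<epsilon>))"
    unfolding X_def using rN choice(4) by (rule ln_mult_pos)
  have LN: "L / N = ln X / ln 2" using N by (simp add: L_def)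
  have q: "1 + 1 / ln 2 * ln (1 / (r * N)) + 1 / ln 2 * ln (ln (3 * C / \<epsilon>)) = 1 + L / N"
    unfolding LN lnX by (simp add: add_divide_distrib)
  have q0: "0 \<le> 1 + L / N" using choice(1) N by simp
  have XN: "(2 / (r * N)) ^ n * (ln (3 * C / \<epsilon>)) ^ n = 2 ^ n * X ^ n"
    unfolding power_mult_distrib[symmetric] X_def by simp
  have "(exp 1 * (1 + L / N)) ^ (n - 1) \<le> (exp 1 / ln 2) ^ (n - 1) * (1 + L / N) ^ (n - 1)"
    unfolding power_mult_distrib
  proof (intro mult_right_mono power_mono)
    show "exp 1 \<le> exp 1 / ln (2::real)" using ln2 by (simp add: field_simps)
  qed (use q0 in auto)
  then have "2 ^ n * X ^ n * (exp 1 * (1 + L / N)) ^ (n - 1) * (T * \<Lambda>)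
      \<le> 2 ^ n * X ^ n * ((exp 1 / ln 2) ^ (n - 1) * (1 + L / N) ^ (n - 1)) * (T * \<Lambda>)"
    using X0 T \<Lambda> by (intro mult_right_mono mult_left_mono) auto
  also have "\<dots> = (exp 1 / ln 2) ^ (n - 1) * ((2 / (r * N)) ^ n * (ln (3 * C / \<epsilon>)) ^ n) * (1 + L / N) ^ (n - 1) * \<Lambda> * T"
    unfolding XN by (simp only: mult_ac)
  finally show ?thesis unfolding pL q by (simp only: mult_ac)
qed

text \<open>By the choice of tolerance the left-hand side equals \<open>\<tau> * (C3 / \<epsilon>) * (L + 2) ^ (2 * n)\<close>. The exponential
  replaces \<open>L + 2\<close> by \<open>2 * L = 2 * n / ln 2 * ln X\<close>, which is larger as soon as \<open>L \<ge> 2\<close>.\<close>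

lemma tolerance_choice:
  fixes L X \<alpha> \<beta> \<epsilon> U :: real and n :: nat
  assumes n: "1 \<le> n" and L: "L = real n / ln 2 * ln X" "2 \<le> L"
    and pos: "0 < \<alpha>" "0 < \<beta>" "0 < \<epsilon>" "0 < U"
  shows "2 * (sqrt \<alpha> * U) \<le> sqrt \<beta> * \<epsilon> / (3 * (L + 2) ^ (2 * n))
    * exp (ln (6 * sqrt (\<alpha> / \<beta>) * U / \<epsilon>) + 2 * real n * ln (2 * real n / ln 2) + 2 * real n * ln (ln X))"
proof -
  have ln2: "0 < ln (2::real)" by simp
  have c: "0 < real n / ln 2" using n ln2 by simp
  have lnX: "0 < ln X"
  proof -
    have "0 < real n / ln 2 * ln X" using L by linarith
    then show ?thesis using c by (rule zero_less_mult_pos)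
  qed
  define Q where "Q = 6 * sqrt (\<alpha> / \<beta>) * U / \<epsilon>"
  have Q: "0 < Q" using pos by (simp add: Q_def)
  have "exp (2 * real n * ln (2 * real n / ln 2) + 2 * real n * ln (ln X))
      = exp (real (2 * n) * (ln (2 * real n / ln 2) + ln (ln X)))"
    by (simp add: algebra_simps)
  also have "\<dots> = exp (ln (2 * real n / ln 2) + ln (ln X)) ^ (2 * n)" by (rule exp_of_nat_mult)
  also have "exp (ln (2 * real n / ln 2) + ln (ln X)) = 2 * real n / ln 2 * ln X"
    using c lnX n by (simp add: exp_add)
  also have "\<dots> = 2 * L" by (simp add: L(1))
  finally have e: "exp (ln Q + 2 * real n * ln (2 * real n / ln 2) + 2 * real n * ln (ln X)) = Q * (2 * L) ^ (2 * n)"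
    using Q by (simp add: exp_add add.assoc)
  have Lp: "0 < (L + 2) ^ (2 * n)" "L + 2 \<noteq> 0" using L(2) by auto
  have "2 * (sqrt \<alpha> * U) = sqrt \<beta> * \<epsilon> / 3 * Q"
    using pos by (simp add: Q_def real_sqrt_divide)
  also have "\<dots> = sqrt \<beta> * \<epsilon> / (3 * (L + 2) ^ (2 * n)) * (Q * (L + 2) ^ (2 * n))"
    using Lp by simp
  also have "\<dots> \<le> sqrt \<beta> * \<epsilon> / (3 * (L + 2) ^ (2 * n)) * (Q * (2 * L) ^ (2 * n))"
    using L(2) pos Q Lp by (intro mult_left_mono power_mono) auto
  finally show ?thesis unfolding Q_def[symmetric] e .
qed

text \<open>The mesh size tends to zero from above together with the accuracy.\<close>

lemma eventually_at_right_mesh_size: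
  fixes C :: real and s :: nat
  assumes C: "0 < C" and s: "1 \<le> s" and P: "\<forall>\<^sub>F h in at_right 0. P h"
  shows "\<forall>\<^sub>F \<epsilon> in at_right 0. P ((\<epsilon> / (3 * C)) powr (1 / real s))"
proof -
  obtain b where b: "0 < b" "\<And>h. 0 < h \<Longrightarrow> h < b \<Longrightarrow> P h"
    using P unfolding eventually_at_right_field by blast
  show ?thesis
    unfolding eventually_at_right_field
  proof (intro exI conjI allI impI)
    show "0 < 3 * C * b ^ s" using C b(1) by simp
    fix \<epsilon> :: real assume \<epsilon>: "0 < \<epsilon>" "\<epsilon> < 3 * C * b ^ s"
    have "(\<epsilon> / (3 * C)) powr (1 / real s) < (b ^ s) powr (1 / real s)"
      using \<epsilon> C s by (intro powr_less_mono2) (auto simp: field_simps)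
    also have "\<dots> = b" using b(1) s by (simp add: powr_realpow[symmetric] powr_powr)
    finally show "P ((\<epsilon> / (3 * C)) powr (1 / real s))"
      using \<epsilon>(1) C by (intro b(2)) auto
  qed
qed

lemma eventually_level_parameter_large:
  fixes q C B :: real
  assumes q: "0 < q" and C: "0 < C"
  shows "\<forall>\<^sub>F \<epsilon> in at_right 0. B \<le> 1 / q * ln (3 * C / \<epsilon>)"
  unfolding eventually_at_right_field
proof (intro exI conjI allI impI)
  show "0 < 3 * C * exp (- (q * B))" using C by simp
  fix \<epsilon> :: real assume \<epsilon>: "0 < \<epsilon>" "\<epsilon> < 3 * C * exp (- (q * B))"
  then have "exp (q * B) \<le> 3 * C / \<epsilon>" by (simp add: exp_minus field_simps)
  then have "q * B \<le> ln (3 * C / \<epsilon>)" using \<epsilon> C by (simp add: ln_ge_iff)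
  then show "B \<le> 1 / q * ln (3 * C / \<epsilon>)" using q by (simp add: field_simps)
qed

section \<open>The iteration count\<close>

theorem theorem4p9:
  fixes D :: "'a::euclidean_space set"
    and \<rho> :: "'n::finite \<Rightarrow> real \<Rightarrow> real"
    and a f :: "'a \<Rightarrow> real ^ 'n \<Rightarrow> real"
    and u :: "real ^ 'n \<Rightarrow> 'a \<Rightarrow> real"
    and \<T> :: "real \<Rightarrow> 'a set set" and M :: "real \<Rightarrow> nat" and \<phi> :: "real \<Rightarrow> nat \<Rightarrow> 'a \<Rightarrow> real"
    and A :: "real \<Rightarrow> real ^ 'n \<Rightarrow> real mat" and c :: "real \<Rightarrow> real ^ 'n \<Rightarrow> real vec"
    and uh :: "real \<Rightarrow> real ^ 'n \<Rightarrow> 'a \<Rightarrow> real"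
    and amin amax \<alpha> \<beta> \<sigma> h0 Cfem Csc \<delta> r :: real and s :: nat and \<gamma> :: "'n \<Rightarrow> real"
  \<comment> \<open>domain and parameter density\<close>
  assumes "DIM('a) \<le> 3"
    and "open D" and "connected D" and "bounded D" and "D \<noteq> {}"
    and "\<And>n. set_borel_measurable borel {-1..1} (\<rho> n)"
    and "\<And>n t. t \<in> {-1..1} \<Longrightarrow> 0 \<le> \<rho> n t"
    and "\<exists>B. AE y in lebesgue_on param_box. (\<Prod>n\<in>UNIV. \<rho> n (vec_nth y n)) \<le> B"
    and "prob_space (density_measure \<rho>)"
  \<comment> \<open>parametrized elliptic problem\<close>
    and "0 < amin" and "\<And>y. y \<in> param_box \<Longrightarrow> (\<lambda>x. a x y) \<in> borel_measurable (lebesgue_on D)"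
    and "\<And>y. y \<in> param_box \<Longrightarrow> AE x in lebesgue_on D. amin \<le> a x y \<and> a x y \<le> amax"
    and "\<And>y. y \<in> param_box \<Longrightarrow> (\<lambda>x. f x y) \<in> L2_space D"
    and "\<And>y. y \<in> param_box \<Longrightarrow> weak_solution D (\<lambda>x. a x y) (\<lambda>x. f x y) (u y)"
    and "0 < \<alpha>" and "0 < \<beta>"
    and "\<And>y v w. \<lbrakk>y \<in> param_box; v \<in> H01 D; w \<in> H01 D\<rbrakk> \<Longrightarrow>
           \<bar>diffusion_form D (\<lambda>x. a x y) v w\<bar> \<le> \<alpha> * H01_norm D v * H01_norm D w"
    and "\<And>y v. \<lbrakk>y \<in> param_box; v \<in> H01 D\<rbrakk> \<Longrightarrow>
           \<beta> * (H01_norm D v)\<^sup>2 \<le> diffusion_form D (\<lambda>x. a x y) v v"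
  \<comment> \<open>finite elements\<close>
    and "0 < \<sigma>" and "0 < h0"
    and "\<And>h. h \<in> {0<..h0} \<Longrightarrow> uniform_mesh D \<sigma> h (\<T> h)"
    and "\<And>h. h \<in> {0<..h0} \<Longrightarrow> fe_basis D (\<T> h) (M h) (\<phi> h)"
    and "(\<lambda>h. real (M h)) \<in> O[at_right 0](\<lambda>h. 1 / h ^ DIM('a))"
    and "\<And>h y. A h y = stiffness_matrix D (\<lambda>x. a x y) (M h) (\<phi> h)"
    and "\<And>h y. \<lbrakk>h \<in> {0<..h0}; y \<in> param_box\<rbrakk> \<Longrightarrow>
           c h y \<in> carrier_vec (M h) \<and> A h y *\<^sub>v c h y = load_vector D (\<lambda>x. f x y) (M h) (\<phi> h)"
    and "\<And>h y. uh h y = fe_function (M h) (\<phi> h) (c h y)"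
    and "1 \<le> s"
    and "u \<in> bochner_L2 (density_measure \<rho>) (H01 D \<inter> sobolev D (s + 1)) (sobolev_norm D (s + 1))"
    and "0 < Cfem"
    and "\<And>h. h \<in> {0<..h0} \<Longrightarrow>
           (\<lambda>y x. u y x - uh h y x) \<in> bochner_L2 (density_measure \<rho>) (H01 D) (H01_norm D) \<and>
           bochner_L2_norm (density_measure \<rho>) (H01_norm D) (\<lambda>y x. u y x - uh h y x) \<le> Cfem * h ^ s"
  \<comment> \<open>regularity in the parameter and sparse grid interpolation\<close>
    and "\<And>n. 1 < \<gamma> n"
    and "has_analytic_extension D \<gamma> u"
    and "\<And>h. h \<in> {0<..h0} \<Longrightarrow> has_analytic_extension D \<gamma> (uh h)"
    and "0 < \<delta>" and "\<delta> < 1" and "r = (1 - \<delta>) * Min (range (\<lambda>n. ln (\<gamma> n)))"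
    and "0 < Csc"
    and "\<And>L. 1 \<le> L \<Longrightarrow>
           Linf_H01_norm D (\<lambda>y x. u y x - sparse_interpolation L u y x)
             \<le> ereal (Csc * exp (- r * real CARD('n) * 2 powr (real L / real CARD('n))))"
    and "\<And>h L. \<lbrakk>h \<in> {0<..h0}; 1 \<le> L\<rbrakk> \<Longrightarrow>
           Linf_H01_norm D (\<lambda>y x. uh h y x - sparse_interpolation L (uh h) y x)
             \<le> ereal (Csc * exp (- r * real CARD('n) * 2 powr (real L / real CARD('n))))"
  shows "\<forall>\<^sub>F \<epsilon> in at_right 0.
    (let N = real CARD('n);
         h\<epsilon> = (\<epsilon> / (3 * Cfem)) powr (1 / real s);
         \<kappa> = (SUP y\<in>param_box. cond_number (A h\<epsilon> y));
         C1 = (exp 1 / ln 2) ^ (CARD('n) - 1) * (2 / (r * N)) ^ CARD('n);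
         C2 = 1 + 1 / ln 2 * ln (1 / (r * N));
         C3 = 6 * sqrt (\<alpha> / \<beta>) * real_of_ereal (Linf_H01_norm D (uh h\<epsilon>));
         C4 = 2 * N * ln (2 * N / ln 2)
     in K_zero_min h0 s Cfem Csc r \<beta> A c \<epsilon>
        \<le> C1 * (ln (3 * Csc / \<epsilon>)) ^ CARD('n)
          * (C2 + 1 / ln 2 * ln (ln (3 * Csc / \<epsilon>))) ^ (CARD('n) - 1)
          * (1 / ln ((sqrt \<kappa> + 1) / (sqrt \<kappa> - 1)))
          * (ln (C3 / \<epsilon>) + C4 + 2 * N * ln (ln (1 / (r * N) * ln (3 * Csc / \<epsilon>)))))"
proof -
  interpret bounded_open_set D using assms(2,4) by unfold_locales
  define N where "N = real CARD('n)"
  have n1: "1 \<le> CARD('n)" by (simp add: Suc_leI)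
  then have N: "1 \<le> N" by (simp add: N_def)
  have "0 < Min (range (\<lambda>n. ln (\<gamma> n)))" using assms(31) by (subst Min_gr_iff) (auto intro: ln_gt_zero)
  then have r: "0 < r" using assms(35) unfolding assms(36) by simp
  have coeff: "bounded_coeff (\<lambda>x. a x y)" if y: "y \<in> param_box" for y
  proof -
    have "AE x in lebesgue_on D. \<bar>a x y\<bar> \<le> amax"
      using assms(12)[OF y] by eventually_elim (use assms(10) in auto)
    then show ?thesis using assms(11)[OF y] by (auto simp: bounded_coeff_def)
  qed
  have uH: "u y \<in> H01 D" if "y \<in> param_box" for y
    using assms(14)[OF that] by (simp add: weak_solution_def)
  have basis: "\<phi> h i \<in> H01 D" if "h \<in> {0<..h0}" "i < M h" for h i
    using assms(22)[OF that(1)] that(2) by (simp add: fe_basis_def)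
  have uhH: "uh h y \<in> H01 D" if "h \<in> {0<..h0}" for h y
    unfolding assms(26) by (rule fe_function_H01) (rule basis[OF that])
  have cont_u: "continuous_on param_box (\<lambda>y. H01_norm D (u y))"
    by (rule analytic_extension_continuous[OF assms(32) assms(31) uH])
  have cont_uh: "continuous_on param_box (\<lambda>y. H01_norm D (uh h y))" if h: "h \<in> {0<..h0}" for h
    by (rule analytic_extension_continuous[OF assms(33)[OF h] assms(31) uhH[OF h]])
  define U where "U h = real_of_ereal (Linf_H01_norm D (uh h))" for h
  have U: "H01_norm D (uh h y) \<le> U h" if "h \<in> {0<..h0}" "y \<in> param_box" for h y
    unfolding U_def by (rule H01_norm_le_Linf[OF cont_uh[OF that(1)] H01_norm_nonneg that(2)])
  define \<kappa> where "\<kappa> h = (SUP y\<in>param_box. cond_number (A h y))" for h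
  have cond: "1 \<le> cond_number (A h y) \<and> cond_number (A h y) \<le> \<kappa> h" if h: "h \<in> {0<..h0}" and y: "y \<in> param_box" for h y
  proof -
    have "\<exists>B. \<forall>y\<in>param_box. 1 \<le> cond_number (A h y) \<and> cond_number (A h y) \<le> B"
      unfolding assms(24) by (rule galerkin_matrices_conditioned[OF assms(22)[OF h] coeff assms(15-18)])
    then obtain B where B: "\<forall>y\<in>param_box. 1 \<le> cond_number (A h y) \<and> cond_number (A h y) \<le> B" by blast
    then have "cond_number (A h y) \<le> \<kappa> h"
      unfolding \<kappa>_def using y by (intro cSUP_upper bdd_aboveI2[where M = B]) auto
    with B y show ?thesis by blast
  qed
  let ?E = "\<lambda>h y. energy_norm (A h y) (c h y - 0\<^sub>v (dim_vec (c h y)))"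
  have energy: "0 \<le> ?E h y" "?E h y \<le> sqrt \<alpha> * H01_norm D (uh h y)" if h: "h \<in> {0<..h0}" and y: "y \<in> param_box" for h y
  proof -
    have c: "c h y \<in> carrier_vec (M h)" using assms(25)[OF h y] by blast
    show "0 \<le> ?E h y" "?E h y \<le> sqrt \<alpha> * H01_norm D (uh h y)"
      unfolding assms(24) assms(26)
      by (rule galerkin_energy[OF coeff[OF y] basis[OF h] c assms(15,16) assms(17)[OF y] assms(18)[OF y]], assumption+)+
  qed
  \<comment> \<open>The zeros of the exact solution form a null set, or it vanishes identically by the identity theorem.\<close>
  have dichotomy: "(\<forall>h\<in>{0<..h0}. \<forall>y\<in>param_box. H01_norm D (uh h y) = 0 \<and> ?E h y = 0) \<or>
      (\<exists>\<eta>>0. \<forall>\<^sub>F h in at_right 0. \<exists>y\<in>param_box. \<eta> \<le> H01_norm D (uh h y))"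
  proof (cases "negligible {y \<in> param_box. H01_norm D (u y) = 0}")
    case True
    then have "\<exists>\<eta>>0. \<forall>\<^sub>F h in at_right 0. \<exists>y\<in>param_box. \<eta> \<le> H01_norm D (uh h y)"
      using discrete_solution_bounded_below[of \<rho> u h0 uh s Cfem] assms(6,9,20,27,30) uH cont_u uhH by blast
    then show ?thesis by blast
  next
    case False
    have "H01_norm D (uh h y) = 0 \<and> ?E h y = 0" if h: "h \<in> {0<..h0}" and y: "y \<in> param_box" for h y
    proof -
      have u0: "H01_norm D (u y) = 0"
        by (rule analytic_identity[OF assms(32) assms(31) uH False y])
      have c: "c h y \<in> carrier_vec (M h)" "stiffness_matrix D (\<lambda>x. a x y) (M h) (\<phi> h) *\<^sub>v c h y = load_vector D (\<lambda>x. f x y) (M h) (\<phi> h)"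
        using assms(25)[OF h y] unfolding assms(24) by blast+
      have "c h y = 0\<^sub>v (M h)"
        by (rule galerkin_solution_zero[OF assms(22)[OF h] coeff[OF y] assms(16) assms(18)[OF y] assms(14)[OF y] u0 c])
      then have "uh h y = (\<lambda>x. 0)" by (auto simp: assms(26) fe_function_def)
      then have "H01_norm D (uh h y) = 0" by (simp add: H01_norm_zero)
      with energy[OF h y] show ?thesis by simp
    qed
    then show ?thesis by blast
  qed
  define C3 where "C3 h = 6 * sqrt (\<alpha> / \<beta>) * U h" for h
  have ab: "0 < 6 * sqrt (\<alpha> / \<beta>)" using assms(15,16) by simp
  define H where "H \<epsilon> = (\<epsilon> / (3 * Cfem)) powr (1 / real s)" for \<epsilon>
  have ev_h: "\<forall>\<^sub>F \<epsilon> in at_right 0. H \<epsilon> \<in> {0<..h0}"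
    unfolding H_def
    by (rule eventually_at_right_mesh_size[OF assms(29,27)])
       (use assms(20) in \<open>auto simp: eventually_at_right_field intro!: exI[of _ h0]\<close>)
  have ev_X: "\<forall>\<^sub>F \<epsilon> in at_right 0. exp 2 \<le> 1 / (r * N) * ln (3 * Csc / \<epsilon>)"
    using r N assms(37) by (intro eventually_level_parameter_large) auto
  have ev_pos: "\<forall>\<^sub>F \<epsilon> in at_right 0. 0 < (\<epsilon>::real)" by (rule eventually_at_right_less)
  \<comment> \<open>In the nondegenerate case \<open>C3\<close> stays away from zero, so the braces of the bound are eventually nonnegative.\<close>
  have ev_C3: "\<forall>\<^sub>F \<epsilon> in at_right 0. (\<forall>y\<in>param_box. H01_norm D (uh (H \<epsilon>) y) = 0 \<and> ?E (H \<epsilon>) y = 0) \<or> 1 \<le> C3 (H \<epsilon>) / \<epsilon>"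
    using dichotomy
  proof
    assume "\<forall>h\<in>{0<..h0}. \<forall>y\<in>param_box. H01_norm D (uh h y) = 0 \<and> ?E h y = 0"
    then show ?thesis using ev_h by (auto elim!: eventually_mono)
  next
    assume "\<exists>\<eta>>0. \<forall>\<^sub>F h in at_right 0. \<exists>y\<in>param_box. \<eta> \<le> H01_norm D (uh h y)"
    then obtain \<eta> where \<eta>: "0 < \<eta>" "\<forall>\<^sub>F h in at_right 0. \<exists>y\<in>param_box. \<eta> \<le> H01_norm D (uh h y)" by blast
    have "\<forall>\<^sub>F \<epsilon> in at_right 0. \<exists>y\<in>param_box. \<eta> \<le> H01_norm D (uh (H \<epsilon>) y)"
      unfolding H_def by (rule eventually_at_right_mesh_size[OF assms(29,27) \<eta>(2)])
    moreover have "\<forall>\<^sub>F \<epsilon> in at_right 0. \<epsilon> < 6 * sqrt (\<alpha> / \<beta>) * \<eta>"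
      using ab \<eta>(1) unfolding eventually_at_right_field by (intro exI[of _ "6 * sqrt (\<alpha> / \<beta>) * \<eta>"]) auto
    ultimately show ?thesis using ev_pos ev_h
    proof eventually_elim
      case (elim \<epsilon>)
      then obtain y where y: "y \<in> param_box" "\<eta> \<le> H01_norm D (uh (H \<epsilon>) y)" by blast
      with U[OF elim(4) y(1)] have "\<eta> \<le> U (H \<epsilon>)" by linarith
      then have "6 * sqrt (\<alpha> / \<beta>) * \<eta> \<le> C3 (H \<epsilon>)"
        unfolding C3_def using ab by (intro mult_left_mono) auto
      with elim(2) have "\<epsilon> \<le> C3 (H \<epsilon>)" by linarith
      then show ?case using elim(3) by simp
    qed
  qed
  have zero_box: "(0 :: real ^ 'n) \<in> param_box" by (simp add: param_box_def)
  show ?thesis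
    using ev_h ev_X ev_pos ev_C3
  proof eventually_elim
    case (elim \<epsilon>)
    note h = elim(1) and X = elim(2) and \<epsilon> = elim(3)
    define X where "X = 1 / (r * N) * ln (3 * Csc / \<epsilon>)"
    define L where "L = N / ln 2 * ln X"
    define T where "T = ln (C3 (H \<epsilon>) / \<epsilon>) + 2 * N * ln (2 * N / ln 2) + 2 * N * ln (ln X)"
    define \<tau> where "\<tau> = sqrt \<beta> * \<epsilon> / (3 * (L + 2) ^ (2 * CARD('n)))"
    note choice = level_choice[OF N r assms(37) \<epsilon> X, folded X_def, folded L_def]
    have L0: "0 < L" using choice(1) by linarith
    have \<tau>: "0 < \<tau>" unfolding \<tau>_def using assms(16) \<epsilon> L0 by simp
    have U0: "0 \<le> U (H \<epsilon>)" using U[OF h zero_box] H01_norm_nonneg[of "uh (H \<epsilon>) 0"] by linarith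
    \<comment> \<open>The last two terms add up to \<open>2 * N * ln (2 * L)\<close>.\<close>
    have rest: "0 \<le> 2 * N * ln (2 * N / ln 2) + 2 * N * ln (ln X)"
    proof -
      have c: "0 < 2 * N / ln 2" using N by simp
      have "0 < N / ln 2 * ln X" using L0 by (simp add: L_def)
      then have lnX: "0 < ln X" using N by (simp add: zero_less_mult_iff zero_less_divide_iff)
      have "2 * N * ln (2 * N / ln 2) + 2 * N * ln (ln X) = 2 * N * ln (2 * N / ln 2 * ln X)"
        using ln_mult_pos[OF c lnX] by (simp add: algebra_simps)
      also have "2 * N / ln 2 * ln X = 2 * L" by (simp add: L_def)
      finally show ?thesis using N choice(1) by simp
    qed
    have T0: "0 \<le> T \<and> (\<forall>y\<in>param_box. 2 * ?E (H \<epsilon>) y \<le> \<tau> * exp T)"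
      using elim(4)
    proof
      \<comment> \<open>Here \<open>C3 = 0\<close>, and the convention \<open>ln 0 = 0\<close> leaves a nonnegative bound for a vanishing count.\<close>
      assume deg: "\<forall>y\<in>param_box. H01_norm D (uh (H \<epsilon>) y) = 0 \<and> ?E (H \<epsilon>) y = 0"
      have "(\<lambda>y. ereal (H01_norm D (uh (H \<epsilon>) y))) \<in> borel_measurable (lebesgue_on param_box)"
        by (intro borel_measurable_ereal continuous_imp_measurable_on_sets_lebesgue cont_uh h param_box_sets)
      then have "Linf_H01_norm D (uh (H \<epsilon>)) \<le> 0"
        unfolding Linf_H01_norm_def by (rule esssup_I) (use deg in auto)
      then have "U (H \<epsilon>) \<le> 0"
        unfolding U_def by (cases "Linf_H01_norm D (uh (H \<epsilon>))") auto
      with U0 have "U (H \<epsilon>) = 0" by simp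
      then have "C3 (H \<epsilon>) = 0" by (simp add: C3_def)
      then have "0 \<le> T" using rest by (simp add: T_def)
      moreover have "2 * ?E (H \<epsilon>) y \<le> \<tau> * exp T" if "y \<in> param_box" for y
        using deg that \<tau> by simp
      ultimately show ?thesis by blast
    next
      assume C3: "1 \<le> C3 (H \<epsilon>) / \<epsilon>"
      then have "0 \<le> ln (C3 (H \<epsilon>) / \<epsilon>)" by simp
      then have "0 \<le> T" using rest by (simp add: T_def)
      moreover have "2 * ?E (H \<epsilon>) y \<le> \<tau> * exp T" if y: "y \<in> param_box" for y
      proof -
        have "U (H \<epsilon>) \<noteq> 0" using C3 by (auto simp: C3_def)
        then have Upos: "0 < U (H \<epsilon>)" using U0 by linarith
        have "?E (H \<epsilon>) y \<le> sqrt \<alpha> * U (H \<epsilon>)"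
        proof (rule order_trans[OF energy(2)[OF h y]])
          show "sqrt \<alpha> * H01_norm D (uh (H \<epsilon>) y) \<le> sqrt \<alpha> * U (H \<epsilon>)"
            using assms(15) by (intro mult_left_mono U h y) auto
        qed
        then have "2 * ?E (H \<epsilon>) y \<le> 2 * (sqrt \<alpha> * U (H \<epsilon>))" by simp
        also have "\<dots> \<le> \<tau> * exp T"
          using tolerance_choice[OF n1 L_def[unfolded N_def] choice(1) assms(15,16) \<epsilon> Upos]
          by (simp only: \<tau>_def T_def C3_def N_def)
        finally show ?thesis .
      qed
      ultimately show ?thesis by blast
    qed
    define S where "S = {K_zero (A h) (c h) L \<tau> | h L \<tau>.
     0 < h \<and> h \<le> h0 \<and> 0 < L \<and> 0 < \<tau> \<and>
     Cfem * h ^ s \<le> \<epsilon> / 3 \<and>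
     Csc * exp (- r * real CARD('n) * 2 powr (L / real CARD('n))) \<le> \<epsilon> / 3 \<and>
     (L + 2) ^ (2 * CARD('n)) * (\<tau> / sqrt \<beta>) \<le> \<epsilon> / 3}"
    have nonneg: "0 \<le> K_zero (A h) (c h) L \<tau>" if "0 < h" "h \<le> h0" "0 < L" "0 < \<tau>" for h L \<tau>
      using that cond energy(1) by (intro K_zero_bounds(1)) auto
    \<comment> \<open>The infimum is a lower bound only because all counts are nonnegative.\<close>
    have bdd: "bdd_below S" unfolding S_def by (rule bdd_belowI[where m = 0]) (use nonneg in blast)
    have mem: "K_zero (A (H \<epsilon>)) (c (H \<epsilon>)) L \<tau> \<in> S"
    proof -
      have "H \<epsilon> ^ s = \<epsilon> / (3 * Cfem)"
        using \<epsilon> assms(27,29) by (simp add: H_def powr_realpow[symmetric] powr_powr)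
      then have 1: "Cfem * H \<epsilon> ^ s \<le> \<epsilon> / 3" using assms(29) by simp
      have 2: "Csc * exp (- r * real CARD('n) * 2 powr (L / real CARD('n))) \<le> \<epsilon> / 3"
        using choice(3) by (simp only: N_def order_refl)
      have "L + 2 \<noteq> 0" using L0 by simp
      then have 3: "(L + 2) ^ (2 * CARD('n)) * (\<tau> / sqrt \<beta>) \<le> \<epsilon> / 3"
        using assms(16) by (simp add: \<tau>_def)
      show ?thesis unfolding S_def using h L0 \<tau> 1 2 3 by auto
    qed
    have "K_zero_min h0 s Cfem Csc r \<beta> A c \<epsilon> \<le> K_zero (A (H \<epsilon>)) (c (H \<epsilon>)) L \<tau>"
      unfolding K_zero_min_def S_def[symmetric] by (rule cInf_lower[OF mem bdd])
    also have "\<dots> \<le> 2 ^ CARD('n) * 2 powr L * (exp 1 * (1 + L / real CARD('n))) ^ (CARD('n) - 1)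
        * (T * (1 / ln ((sqrt (\<kappa> (H \<epsilon>)) + 1) / (sqrt (\<kappa> (H \<epsilon>)) - 1))))"
      using cond[OF h] energy(1)[OF h] \<tau> L0 T0 by (intro K_zero_bounds(2)) auto
    also have "\<dots> \<le> (exp 1 / ln 2) ^ (CARD('n) - 1) * (2 / (r * N)) ^ CARD('n) * (ln (3 * Csc / \<epsilon>)) ^ CARD('n)
      * (1 + 1 / ln 2 * ln (1 / (r * N)) + 1 / ln 2 * ln (ln (3 * Csc / \<epsilon>))) ^ (CARD('n) - 1)
      * (1 / ln ((sqrt (\<kappa> (H \<epsilon>)) + 1) / (sqrt (\<kappa> (H \<epsilon>)) - 1))) * T"
    proof -
      have "1 \<le> \<kappa> (H \<epsilon>)" using cond[OF h zero_box] by linarith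
      from grid_factor_le[OF n1 r assms(37) \<epsilon> X[unfolded N_def] cg_rate_nonneg[OF this] conjunct1[OF T0]]
      show ?thesis unfolding L_def X_def N_def .
    qed
    finally show ?case
      unfolding Let_def T_def X_def C3_def U_def \<kappa>_def H_def N_def .
  qed
qed

end
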